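(* Let $X$ be a compact complex surface (connected, of complex dimension $2$) that carries a Kähler metric which is Ricci-flat and not flat. Then the holomorphic tangent bundle $T^{1,0}X$ admits an RC-positive Hermitian metric.
   Context: Let $E\to X$ be a holomorphic vector bundle over a complex manifold with a smooth Hermitian metric $h$. Its Chern connection $\nabla$ is the unique connection compatible with $h$ and the holomorphic structure of $E$, and $R^h=\nabla^2$ is its Chern curvature, a $(1,1)$-form with values in $\mathrm{End}\,E$. For $u\in T^{1,0}_xX$ and $v\in E_x$, $\langle R^h v,v\rangle_h$ is the $(1,1)$-form at $x$ with $\langle R^hv,v\rangle_h(u,\bar u)=\langle R^h(u,\bar u)v,v\rangle_h=\sum R_{i\bar j\alpha\bar\beta}u_i\bar u_jv_\alpha\bar v_\beta$, where, in local coordinates $z_i$ and a local holomorphic frame $e_\alpha$ with $h_{\alpha\bar\beta}=\langle e_\alpha,e_\beta\rangle_h$, $R_{i\bar j\alpha\bar\beta}=-\frac{\partial^2 h_{\alpha\bar\beta}}{\partial z_i\partial\bar z_j}+h^{\gamma\bar\delta}\frac{\partial h_{\alpha\bar\delta}}{\partial z_i}\frac{\partial h_{\gamma\bar\beta}}{\partial\bar z_j}$. The metric $h$ is RC-positive at $x\in X$ if for every nonzero $v\in E_x$ there is a nonzero $u\in T^{1,0}_xX$ with $\langle R^hv,v\rangle_h(u,\bar u)>0$; $h$ is RC-positive if it is RC-positive at every point of $X$. A metric is flat if its Riemannian curvature tensor vanishes identically. *)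

theory Defs
  imports "HOL-Analysis.Analysis"
begin

section \<open>Smooth and holomorphic maps on open sets\<close>

primrec times_differentiable_on ::
    "nat \<Rightarrow> 'v::real_normed_vector set \<Rightarrow> ('v \<Rightarrow> 'w::real_normed_vector) \<Rightarrow> bool" where
  "times_differentiable_on 0 S f \<longleftrightarrow> continuous_on S f"
| "times_differentiable_on (Suc k) S f \<longleftrightarrow>
     (\<forall>x\<in>S. f differentiable (at x)) \<and>
     (\<forall>v. times_differentiable_on k S (\<lambda>x. frechet_derivative f (at x) v))"

definition smooth_on :: "'v::real_normed_vector set \<Rightarrow> ('v \<Rightarrow> 'w::real_normed_vector) \<Rightarrow> bool" where
  "smooth_on S f \<longleftrightarrow> (\<forall>k. times_differentiable_on k S f)"

definition holomorphic_map_on :: "(complex^'n) set \<Rightarrow> (complex^'n \<Rightarrow> complex^'m) \<Rightarrow> bool" where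
  "holomorphic_map_on S f \<longleftrightarrow>
     (\<forall>z\<in>S. \<exists>D. (f has_derivative D) (at z) \<and> (\<forall>a v. D (a *s v) = a *s D v))"

text \<open>The Wirtinger operators \<open>\<partial>/\<partial>z\<^sub>i\<close> and \<open>\<partial>/\<partial>\<bar>z\<^sub>i\<close>.\<close>

definition wirtinger :: "'n \<Rightarrow> (complex^'n \<Rightarrow> complex) \<Rightarrow> complex^'n \<Rightarrow> complex" where
  "wirtinger i f z =
     (frechet_derivative f (at z) (axis i 1) - \<i> * frechet_derivative f (at z) (axis i \<i>)) / 2"

definition wirtinger_bar :: "'n \<Rightarrow> (complex^'n \<Rightarrow> complex) \<Rightarrow> complex^'n \<Rightarrow> complex" where
  "wirtinger_bar i f z =
     (frechet_derivative f (at z) (axis i 1) + \<i> * frechet_derivative f (at z) (axis i \<i>)) / 2"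


section \<open>Complex manifolds\<close>

text \<open>A chart is a pair of its domain and its coordinate map; only the values of the coordinate
  map on the domain are meaningful.\<close>

type_synonym ('a, 'n) chart = "'a set \<times> ('a \<Rightarrow> (complex, 'n) vec)"

definition chart_image :: "('a, 'n::finite) chart \<Rightarrow> (complex^'n) set" where
  "chart_image c = snd c ` fst c"

definition overlap :: "('a, 'n::finite) chart \<Rightarrow> ('a, 'n) chart \<Rightarrow> (complex^'n) set" where
  "overlap c d = snd c ` (fst c \<inter> fst d)"

definition transition ::
    "('a, 'n::finite) chart \<Rightarrow> ('a, 'n) chart \<Rightarrow> complex^'n \<Rightarrow> complex^'n" where
  "transition c d z = snd d (inv_into (fst c) (snd c) z)"

definition complex_manifold :: "'a topology \<Rightarrow> ('a, 'n::finite) chart set \<Rightarrow> bool" where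
  "complex_manifold X \<A> \<longleftrightarrow>
     Hausdorff_space X \<and> second_countable X \<and>
     (\<Union>c\<in>\<A>. fst c) = topspace X \<and>
     (\<forall>c\<in>\<A>. openin X (fst c) \<and> open (chart_image c) \<and>
        homeomorphic_map (subtopology X (fst c)) (top_of_set (chart_image c)) (snd c)) \<and>
     (\<forall>c\<in>\<A>. \<forall>d\<in>\<A>. holomorphic_map_on (overlap c d) (transition c d))"


section \<open>Holomorphic bundles and Hermitian metrics\<close>

text \<open>A holomorphic vector bundle trivialised over the charts of an atlas is represented by its
  transition matrices: \<open>E c d z\<close> maps the fibre coordinates of a vector in the frame over \<open>c\<close> to its
  coordinates in the frame over \<open>d\<close>, at the point with \<open>c\<close>-coordinate \<open>z\<close>.\<close>

type_synonym ('a, 'n, 'r) vector_bundle =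
  "('a, 'n) chart \<Rightarrow> ('a, 'n) chart \<Rightarrow> (complex, 'n) vec \<Rightarrow> ((complex, 'r) vec, 'r) vec"

text \<open>For the holomorphic tangent bundle, with the coordinate frames \<open>\<partial>/\<partial>z\<^sub>i\<close>, this is the holomorphic
  Jacobian \<open>\<partial>w\<^sub>k/\<partial>z\<^sub>i\<close> (row \<open>k\<close>, column \<open>i\<close>) of the coordinate change.\<close>

definition holomorphic_tangent_bundle :: "('a, 'n, 'n::finite) vector_bundle" where
  "holomorphic_tangent_bundle c d z = matrix (frechet_derivative (transition c d) (at z))"

text \<open>A metric is given by its local coefficients: \<open>h c z $ \<alpha> $ \<beta>\<close> is
  \<open>h\<^sub>\<alpha>\<^sub>\<beta> = \<langle>e\<^sub>\<alpha>, e\<^sub>\<beta>\<rangle>\<close> (linear in the first, antilinear in the second argument) for the frame over \<open>c\<close>,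
  as a function of the coordinate \<open>z\<close>.\<close>

type_synonym ('a, 'n, 'r) metric =
  "('a, 'n) chart \<Rightarrow> (complex, 'n) vec \<Rightarrow> ((complex, 'r) vec, 'r) vec"

definition sesq :: "complex^'r^'r \<Rightarrow> complex^'r \<Rightarrow> complex^'r \<Rightarrow> complex" where
  "sesq H v w = (\<Sum>\<alpha>\<in>UNIV. \<Sum>\<beta>\<in>UNIV. H $ \<alpha> $ \<beta> * v $ \<alpha> * cnj (w $ \<beta>))"

definition hermitian_posdef :: "complex^'r^'r \<Rightarrow> bool" where
  "hermitian_posdef H \<longleftrightarrow>
     (\<forall>\<alpha> \<beta>. H $ \<beta> $ \<alpha> = cnj (H $ \<alpha> $ \<beta>)) \<and> (\<forall>v. v \<noteq> 0 \<longrightarrow> 0 < Re (sesq H v v))"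

definition hermitian_metric ::
    "('a, 'n::finite) chart set \<Rightarrow> ('a, 'n, 'r::finite) vector_bundle \<Rightarrow> ('a, 'n, 'r) metric \<Rightarrow> bool" where
  "hermitian_metric \<A> E h \<longleftrightarrow>
     (\<forall>c\<in>\<A>. (\<forall>\<alpha> \<beta>. smooth_on (chart_image c) (\<lambda>z. h c z $ \<alpha> $ \<beta>)) \<and>
        (\<forall>z\<in>chart_image c. hermitian_posdef (h c z))) \<and>
     (\<forall>c\<in>\<A>. \<forall>d\<in>\<A>. \<forall>z\<in>overlap c d. \<forall>v w.
        sesq (h c z) v w = sesq (h d (transition c d z)) (E c d z *v v) (E c d z *v w))"


section \<open>Chern curvature and RC-positivity\<close>

text \<open>The inverse metric \<open>h\<^sup>\<gamma>\<^sup>\<delta>\<close> is characterised by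
  \<open>\<Sum>\<delta>. h\<^sub>\<alpha>\<^sub>\<delta> h\<^sup>\<gamma>\<^sup>\<delta> = (if \<alpha> = \<gamma> then 1 else 0)\<close>, so it is the \<open>(\<delta>, \<gamma>)\<close> entry of the
  inverse matrix.\<close>

definition chern_curvature ::
    "(complex^'n \<Rightarrow> complex^'r^'r) \<Rightarrow> complex^'n \<Rightarrow> 'n \<Rightarrow> 'n \<Rightarrow> 'r \<Rightarrow> 'r \<Rightarrow> complex" where
  "chern_curvature H z i j \<alpha> \<beta> =
     - wirtinger i (wirtinger_bar j (\<lambda>y. H y $ \<alpha> $ \<beta>)) z +
     (\<Sum>\<gamma>\<in>UNIV. \<Sum>\<delta>\<in>UNIV. matrix_inv (H z) $ \<delta> $ \<gamma> *
        wirtinger i (\<lambda>y. H y $ \<alpha> $ \<delta>) z * wirtinger_bar j (\<lambda>y. H y $ \<gamma> $ \<beta>) z)"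

definition curvature_form ::
    "(complex^'n \<Rightarrow> complex^'r^'r) \<Rightarrow> complex^'n \<Rightarrow> complex^'n \<Rightarrow> complex^'r \<Rightarrow> complex" where
  "curvature_form H z u v =
     (\<Sum>i\<in>UNIV. \<Sum>j\<in>UNIV. \<Sum>\<alpha>\<in>UNIV. \<Sum>\<beta>\<in>UNIV.
        chern_curvature H z i j \<alpha> \<beta> * u $ i * cnj (u $ j) * v $ \<alpha> * cnj (v $ \<beta>))"

text \<open>For a smooth Hermitian metric the curvature form is real-valued, so \<open>Re\<close> below loses nothing.\<close>

definition RC_positive_at ::
    "('a, 'n::finite) chart set \<Rightarrow> ('a, 'n, 'r::finite) metric \<Rightarrow> 'a \<Rightarrow> bool" where
  "RC_positive_at \<A> h x \<longleftrightarrow>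
     (\<forall>c\<in>\<A>. x \<in> fst c \<longrightarrow>
        (\<forall>v. v \<noteq> 0 \<longrightarrow> (\<exists>u. u \<noteq> 0 \<and> 0 < Re (curvature_form (h c) (snd c x) u v))))"

definition RC_positive ::
    "'a topology \<Rightarrow> ('a, 'n::finite) chart set \<Rightarrow> ('a, 'n, 'r::finite) metric \<Rightarrow> bool" where
  "RC_positive X \<A> h \<longleftrightarrow> (\<forall>x\<in>topspace X. RC_positive_at \<A> h x)"


section \<open>Riemannian curvature\<close>

text \<open>Here \<open>G z\<close> is an inner product on the Euclidean space \<open>'v\<close>, depending on the point \<open>z\<close> of an
  open subset of \<open>'v\<close>. The vector \<open>christoffel G z a b\<close> is the Levi-Civita derivative
  \<open>\<nabla>\<^sub>a b\<close> at \<open>z\<close> of the constant vector field \<open>b\<close>, as determined by the Koszul formula.\<close>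

definition christoffel ::
    "('v::euclidean_space \<Rightarrow> 'v \<Rightarrow> 'v \<Rightarrow> real) \<Rightarrow> 'v \<Rightarrow> 'v \<Rightarrow> 'v \<Rightarrow> 'v" where
  "christoffel G z a b = (THE w. \<forall>c. 2 * G z w c =
     frechet_derivative (\<lambda>y. G y b c) (at z) a +
     frechet_derivative (\<lambda>y. G y a c) (at z) b -
     frechet_derivative (\<lambda>y. G y a b) (at z) c)"

text \<open>\<open>R(a, b) c = \<nabla>\<^sub>a \<nabla>\<^sub>b c - \<nabla>\<^sub>b \<nabla>\<^sub>a c\<close> for constant vector fields, which commute.\<close>

definition riemann_curvature ::
    "('v::euclidean_space \<Rightarrow> 'v \<Rightarrow> 'v \<Rightarrow> real) \<Rightarrow> 'v \<Rightarrow> 'v \<Rightarrow> 'v \<Rightarrow> 'v \<Rightarrow> 'v" where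
  "riemann_curvature G z a b c =
     frechet_derivative (\<lambda>y. christoffel G y b c) (at z) a -
     frechet_derivative (\<lambda>y. christoffel G y a c) (at z) b +
     christoffel G z a (christoffel G z b c) - christoffel G z b (christoffel G z a c)"

text \<open>The Ricci tensor is the trace of \<open>a \<mapsto> R(a, b) c\<close>; \<open>Basis\<close> serves only to compute the trace of
  an endomorphism and need not be orthonormal for \<open>G z\<close>.\<close>

definition ricci_curvature ::
    "('v::euclidean_space \<Rightarrow> 'v \<Rightarrow> 'v \<Rightarrow> real) \<Rightarrow> 'v \<Rightarrow> 'v \<Rightarrow> 'v \<Rightarrow> real" where
  "ricci_curvature G z b c = (\<Sum>e\<in>Basis. riemann_curvature G z e b c \<bullet> e)"


section \<open>Kaehler metrics\<close>

text \<open>The real tangent space is identified with \<open>T\<^sup>1\<^sup>,\<^sup>0\<close> (and, in a chart, with the space of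
  complex coordinate vectors) through the (1,0)-part. The Riemannian metric is \<open>Re h(a, b)\<close> and the
  fundamental form is \<open>\<omega>(a, b) = Re h(\<i>a, b) = - Im h(a, b)\<close>.
  Other normalisations differ by a positive constant, which affects none of the notions below.\<close>

definition riemannian_metric ::
    "(complex^'n \<Rightarrow> complex^'n^'n) \<Rightarrow> complex^'n \<Rightarrow> complex^'n \<Rightarrow> complex^'n \<Rightarrow> real" where
  "riemannian_metric H z a b = Re (sesq (H z) a b)"

definition fundamental_form ::
    "(complex^'n \<Rightarrow> complex^'n^'n) \<Rightarrow> complex^'n \<Rightarrow> complex^'n \<Rightarrow> complex^'n \<Rightarrow> real" where
  "fundamental_form H z a b = - Im (sesq (H z) a b)"

text \<open>The exterior derivative of a 2-form, evaluated on constant vector fields.\<close>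

definition exterior_derivative2 ::
    "('v::real_normed_vector \<Rightarrow> 'v \<Rightarrow> 'v \<Rightarrow> real) \<Rightarrow> 'v \<Rightarrow> 'v \<Rightarrow> 'v \<Rightarrow> 'v \<Rightarrow> real" where
  "exterior_derivative2 \<omega> z a b c =
     frechet_derivative (\<lambda>y. \<omega> y b c) (at z) a -
     frechet_derivative (\<lambda>y. \<omega> y a c) (at z) b +
     frechet_derivative (\<lambda>y. \<omega> y a b) (at z) c"

definition kaehler_metric ::
    "('a, 'n::finite) chart set \<Rightarrow> ('a, 'n, 'n) metric \<Rightarrow> bool" where
  "kaehler_metric \<A> g \<longleftrightarrow> hermitian_metric \<A> holomorphic_tangent_bundle g \<and>
     (\<forall>c\<in>\<A>. \<forall>z\<in>chart_image c. \<forall>u v w.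
        exterior_derivative2 (fundamental_form (g c)) z u v w = 0)"

definition ricci_flat :: "('a, 'n::finite) chart set \<Rightarrow> ('a, 'n, 'n) metric \<Rightarrow> bool" where
  "ricci_flat \<A> g \<longleftrightarrow> (\<forall>c\<in>\<A>. \<forall>z\<in>chart_image c. \<forall>u v.
     ricci_curvature (riemannian_metric (g c)) z u v = 0)"

definition flat :: "('a, 'n::finite) chart set \<Rightarrow> ('a, 'n, 'n) metric \<Rightarrow> bool" where
  "flat \<A> g \<longleftrightarrow> (\<forall>c\<in>\<A>. \<forall>z\<in>chart_image c. \<forall>u v w.
     riemann_curvature (riemannian_metric (g c)) z u v w = 0)"

end

theory Submission
  imports Defs "HOL-Complex_Analysis.Cauchy_Integral_Formula"
begin

text \<open>Let \<open>R\<close> be the curvature of the given metric \<open>g\<close>. Since \<open>g\<close> is Kaehler and Ricci-flat, every form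
  \<open>\<langle>R v, v\<rangle>\<close> is trace-free, so \<open>g\<close> is RC-positive at \<open>x\<close> unless \<open>\<langle>R v, v\<rangle> = 0\<close> for some \<open>v \<noteq> 0\<close>.

  This does not happen everywhere. Let \<open>A\<close> be the minimum of the holomorphic sectional curvature over the compact
  unit sphere bundle, attained at a unit vector \<open>e\<^sub>1\<close>. As the average of the holomorphic sectional curvature
  over a fibre is zero and \<open>g\<close> is not flat, \<open>A < 0\<close>. In a unitary frame \<open>e\<^sub>1, e\<^sub>2\<close> criticality gives
  \<open>R(e\<^sub>2, e\<^sub>1, e\<^sub>1, e\<^sub>1) = 0\<close>, and the Bochner formula for the Laplacian of the curvature turns the
  second-order condition at the minimum into \<open>3 A\<^sup>2 \<le> \<bar>\<beta>\<bar>\<^sup>2\<close> with \<open>\<beta> = R(e\<^sub>1, e\<^sub>2, e\<^sub>1, e\<^sub>2)\<close>, whereas a vector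
  \<open>v \<noteq> 0\<close> with \<open>\<langle>R v, v\<rangle> = 0\<close> would force \<open>\<bar>\<beta>\<bar> = \<bar>A\<bar>\<close>.

  Hence \<open>g\<close> is RC-positive on a nonempty open set \<open>V\<close>. Moving along chains of small balls into \<open>V\<close> and adding
  Hopf barriers, one finds a smooth \<open>\<phi>\<close> whose complex Laplacian is positive outside \<open>V\<close>. The curvature form of
  \<open>exp (- \<epsilon> \<phi>) g\<close> is a positive multiple of \<open>\<langle>R v, v\<rangle> + \<epsilon> \<bar>v\<bar>\<^sup>2 \<partial>\<bar>\<partial>\<phi>\<close>, which has positive trace
  outside \<open>V\<close>, and which still has a positive direction on the closure of \<open>V\<close> when \<open>\<epsilon>\<close> is small.\<close>

section \<open>Smooth maps\<close>

text \<open>By the maximum principle no function on a compact manifold has positive Laplacian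
  everywhere, so a conformal factor alone cannot repair the points where some <R v, v> vanishes: it
  needs an open set that is RC-positive beforehand and absorbs the negative part. Finding one point
  of that kind is the only purpose of the minimum.

  In a unitary frame at a point, Kaehler symmetry and Ricci-flatness leave of the curvature the real
  number A and the complex numbers \<beta> and \<kappa> = R(e2, e1, e1, e1). Varying only the
  direction at the minimum gives \<kappa> = 0 and |\<beta>| \<le> 3 |A|, which does not exclude
  |\<beta>| = |A|; so the base point has to vary too. In the resulting bound, 3 A^2 is 2 A^2 from
  the second derivatives of the metric in the trace identity plus A^2 from the derivatives of the
  connection.

  Traces are taken as det H times the trace, a polynomial expression that a change of frame
  multiplies by a positive number. Only signs matter, so neither a division nor a globally defined
  Laplacian is required.\<close>

lemma frechet_derivative_cong_open:
  assumes "open S" "x \<in> S" "\<And>y. y \<in> S \<Longrightarrow> f y = g y"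
  shows "frechet_derivative f (at x) = frechet_derivative g (at x)"
proof -
  have "(f has_derivative D) (at x) \<longleftrightarrow> (g has_derivative D) (at x)" for D
    using has_derivative_transform_within_open[OF _ assms(1,2)] assms(3) by metis
  then show ?thesis by (simp add: frechet_derivative_def)
qed

lemma frechet_derivative_eq:
  "(f has_derivative D) (at x) \<Longrightarrow> frechet_derivative f (at x) = D"
  using frechet_derivative_at by metis

lemma differentiable_cong_open:
  assumes "open S" "x \<in> S" "\<And>y. y \<in> S \<Longrightarrow> f y = g y" "f differentiable (at x)"
  shows "g differentiable (at x)"
  using assms has_derivative_transform_within_open unfolding differentiable_def by metis

lemma times_differentiable_on_cong:
  assumes "open S" "\<And>x. x \<in> S \<Longrightarrow> f x = g x" "times_differentiable_on k S f"
  shows "times_differentiable_on k S g"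
  using assms(2,3)
proof (induction k arbitrary: f g)
  case 0 then show ?case using continuous_on_cong[OF refl, of S f g] by simp
next
  case (Suc k)
  have "times_differentiable_on k S (\<lambda>x. frechet_derivative g (at x) v)" for v
  proof (rule Suc.IH)
    show "frechet_derivative f (at x) v = frechet_derivative g (at x) v" if "x \<in> S" for x
      using frechet_derivative_cong_open[OF assms(1) that, of f g] Suc.prems(1) by simp
    show "times_differentiable_on k S (\<lambda>x. frechet_derivative f (at x) v)" using Suc.prems(2) by simp
  qed
  moreover have "g differentiable at x" if "x \<in> S" for x
    using differentiable_cong_open[OF assms(1) that, of f g] Suc.prems that by simp
  ultimately show ?case by simp
qed

lemma times_differentiable_on_Suc: "times_differentiable_on (Suc k) S f \<Longrightarrow> times_differentiable_on k S f"
proof (induction k arbitrary: f)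
  case 0 then show ?case
    by (auto intro!: continuous_at_imp_continuous_on differentiable_imp_continuous_within)
next
  case (Suc k) then show ?case by simp
qed

lemma times_differentiable_on_subset:
  "times_differentiable_on k S f \<Longrightarrow> T \<subseteq> S \<Longrightarrow> times_differentiable_on k T f"
proof (induction k arbitrary: f)
  case 0 then show ?case using continuous_on_subset by auto
next
  case (Suc k) then show ?case by auto
qed

lemma times_differentiable_on_local:
  assumes "\<And>x. x \<in> S \<Longrightarrow> \<exists>U. open U \<and> x \<in> U \<and> times_differentiable_on k U f"
  shows "times_differentiable_on k S f"
  using assms
proof (induction k arbitrary: f)
  case 0
  have "isCont f x" if "x \<in> S" for x
    using 0[OF that] continuous_on_eq_continuous_at by auto
  then show ?case by (simp add: continuous_at_imp_continuous_on)
next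
  case (Suc k)
  have "f differentiable at x" if "x \<in> S" for x using Suc.prems[OF that] by auto
  moreover have "times_differentiable_on k S (\<lambda>x. frechet_derivative f (at x) v)" for v
    by (rule Suc.IH) (use Suc.prems in fastforce)
  ultimately show ?case by simp
qed

lemma times_differentiable_on_const: "times_differentiable_on k S (\<lambda>x. c)"
proof (induction k arbitrary: c)
  case (Suc k) then show ?case by (simp add: frechet_derivative_eq[OF has_derivative_const])
qed simp

lemma times_differentiable_on_bounded_linear:
  assumes "bounded_linear L" "open S" "times_differentiable_on k S f"
  shows "times_differentiable_on k S (\<lambda>x. L (f x))"
  using assms(3)
proof (induction k arbitrary: f)
  case 0 then show ?case using assms(1) by (simp add: bounded_linear.continuous_on)
next
  case (Suc k)
  have d: "((\<lambda>x. L (f x)) has_derivative (\<lambda>v. L (frechet_derivative f (at x) v))) (at x)" if "x \<in> S" for x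
    using Suc.prems that by (intro bounded_linear.has_derivative[OF assms(1)]) (auto simp: frechet_derivative_works)
  have "times_differentiable_on k S (\<lambda>x. frechet_derivative (\<lambda>x. L (f x)) (at x) v)" for v
    by (rule times_differentiable_on_cong[OF assms(2), of "\<lambda>x. L (frechet_derivative f (at x) v)"])
       (use Suc frechet_derivative_eq[OF d] in auto)
  then show ?case using d by (auto simp: differentiable_def)
qed

lemma times_differentiable_on_linear:
  assumes "bounded_linear L"
  shows "times_differentiable_on k S L"
proof (cases k)
  case (Suc k')
  have "frechet_derivative L (at x) v = L v" for x v
    by (simp add: frechet_derivative_eq[OF bounded_linear_imp_has_derivative[OF assms]])
  then show ?thesis using Suc assms
    by (simp add: times_differentiable_on_const bounded_linear_imp_differentiable)
qed (simp add: assms linear_continuous_on)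

lemma times_differentiable_on_add:
  assumes "open S" "times_differentiable_on k S f" "times_differentiable_on k S g"
  shows "times_differentiable_on k S (\<lambda>x. f x + g x)"
  using assms(2,3)
proof (induction k arbitrary: f g)
  case 0 then show ?case by (simp add: continuous_on_add)
next
  case (Suc k)
  have d: "((\<lambda>x. f x + g x) has_derivative
      (\<lambda>v. frechet_derivative f (at x) v + frechet_derivative g (at x) v)) (at x)" if "x \<in> S" for x
    using Suc.prems that by (intro has_derivative_add) (auto simp: frechet_derivative_works)
  have "times_differentiable_on k S (\<lambda>x. frechet_derivative (\<lambda>x. f x + g x) (at x) v)" for v
    by (rule times_differentiable_on_cong[OF assms(1),
          of "\<lambda>x. frechet_derivative f (at x) v + frechet_derivative g (at x) v"])
       (use Suc frechet_derivative_eq[OF d] in auto)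
  then show ?case using d by (auto simp: differentiable_def)
qed

lemma times_differentiable_on_bilinear:
  assumes "bounded_bilinear B" "open S" "times_differentiable_on k S f" "times_differentiable_on k S g"
  shows "times_differentiable_on k S (\<lambda>x. B (f x) (g x))"
  using assms(3,4)
proof (induction k arbitrary: f g)
  case 0 then show ?case using bounded_bilinear.continuous_on[OF assms(1)] by auto
next
  case (Suc k)
  have d: "((\<lambda>x. B (f x) (g x)) has_derivative
      (\<lambda>v. B (f x) (frechet_derivative g (at x) v) + B (frechet_derivative f (at x) v) (g x))) (at x)"
    if "x \<in> S" for x
    using Suc.prems that
    by (intro bounded_bilinear.FDERIV[OF assms(1)]) (auto simp: frechet_derivative_works)
  have "times_differentiable_on k S (\<lambda>x. frechet_derivative (\<lambda>x. B (f x) (g x)) (at x) v)" for v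
    by (rule times_differentiable_on_cong[OF assms(2),
          of "\<lambda>x. B (f x) (frechet_derivative g (at x) v) + B (frechet_derivative f (at x) v) (g x)"])
       (use Suc.prems frechet_derivative_eq[OF d] times_differentiable_on_Suc[OF Suc.prems(1)]
         times_differentiable_on_Suc[OF Suc.prems(2)] in
         \<open>auto intro!: times_differentiable_on_add[OF assms(2)] Suc.IH\<close>)
  then show ?case using d by (auto simp: differentiable_def)
qed

lemma times_differentiable_on_sum:
  assumes "open S" "\<And>i. i \<in> I \<Longrightarrow> times_differentiable_on k S (f i)"
  shows "times_differentiable_on k S (\<lambda>x. \<Sum>i\<in>I. f i x)"
  using assms(2)
proof (induction I rule: infinite_finite_induct)
  case (insert i I)
  then show ?case by (simp add: times_differentiable_on_add[OF assms(1)])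
qed (simp_all add: times_differentiable_on_const)

text \<open>Differentiability of order \<open>k\<close> is tested on derivatives in fixed
  directions, while the chain rule produces a direction that moves with \<open>x\<close>. Expanding
  it in \<open>Basis\<close> leaves products of scalar functions with fixed-direction derivatives of
  \<open>f\<close>, to which the induction hypothesis applies.\<close>

lemma times_differentiable_on_compose:
  fixes g :: "'a::real_normed_vector \<Rightarrow> 'b::euclidean_space"
  assumes "open S" "open T" "g ` S \<subseteq> T" "times_differentiable_on k T f" "times_differentiable_on k S g"
  shows "times_differentiable_on k S (\<lambda>x. f (g x))"
  using assms(4,5)
proof (induction k arbitrary: f)
  case 0 then show ?case using continuous_on_compose2 assms(3) by auto
next
  case (Suc k)
  have d: "((\<lambda>x. f (g x)) has_derivative
      (\<lambda>v. frechet_derivative f (at (g x)) (frechet_derivative g (at x) v))) (at x)" if "x \<in> S" for x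
    using Suc.prems that assms(3)
    by (intro has_derivative_compose[of g _ x UNIV f]) (auto simp: frechet_derivative_works)
  have e: "frechet_derivative (\<lambda>x. f (g x)) (at x) v =
      (\<Sum>b\<in>Basis. (frechet_derivative g (at x) v \<bullet> b) *\<^sub>R frechet_derivative f (at (g x)) b)" if "x \<in> S" for x v
  proof -
    have f: "f differentiable (at (g x))" using Suc.prems that assms(3) by auto
    interpret linear "frechet_derivative f (at (g x))" using f by (rule linear_frechet_derivative)
    have "frechet_derivative f (at (g x)) (frechet_derivative g (at x) v) =
      frechet_derivative f (at (g x)) (\<Sum>b\<in>Basis. (frechet_derivative g (at x) v \<bullet> b) *\<^sub>R b)"
      by (simp add: euclidean_representation)
    then show ?thesis by (simp add: frechet_derivative_eq[OF d[OF that]] sum scale)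
  qed
  have "times_differentiable_on k S (\<lambda>x. \<Sum>b\<in>Basis. (frechet_derivative g (at x) v \<bullet> b) *\<^sub>R frechet_derivative f (at (g x)) b)" for v
  proof (intro times_differentiable_on_sum[OF assms(1)]
      times_differentiable_on_bilinear[OF bounded_bilinear_scaleR assms(1)])
    fix b :: 'b
    show "times_differentiable_on k S (\<lambda>x. frechet_derivative g (at x) v \<bullet> b)"
      using Suc.prems by (intro times_differentiable_on_bounded_linear[OF bounded_linear_inner_left assms(1)]) auto
    show "times_differentiable_on k S (\<lambda>x. frechet_derivative f (at (g x)) b)"
      using Suc.prems times_differentiable_on_Suc[OF Suc.prems(2)] by (intro Suc.IH) auto
  qed
  then have "times_differentiable_on k S (\<lambda>x. frechet_derivative (\<lambda>x. f (g x)) (at x) v)" for v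
    by (rule times_differentiable_on_cong[OF assms(1), rotated]) (use e in auto)
  then show ?case using d by (auto simp: differentiable_def)
qed

lemma smooth_on_cong: "open S \<Longrightarrow> (\<And>x. x \<in> S \<Longrightarrow> f x = g x) \<Longrightarrow> smooth_on S f \<Longrightarrow> smooth_on S g"
  unfolding smooth_on_def using times_differentiable_on_cong by blast

lemma smooth_on_subset: "smooth_on S f \<Longrightarrow> T \<subseteq> S \<Longrightarrow> smooth_on T f"
  unfolding smooth_on_def using times_differentiable_on_subset by blast

lemma smooth_on_local:
  "(\<And>x. x \<in> S \<Longrightarrow> \<exists>U. open U \<and> x \<in> U \<and> smooth_on U f) \<Longrightarrow> smooth_on S f"
  unfolding smooth_on_def using times_differentiable_on_local by metis

lemma smooth_on_const: "smooth_on S (\<lambda>x. c)"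
  by (simp add: smooth_on_def times_differentiable_on_const)

lemma smooth_on_linear: "bounded_linear L \<Longrightarrow> smooth_on S L"
  by (simp add: smooth_on_def times_differentiable_on_linear)

lemma smooth_on_bounded_linear:
  "bounded_linear L \<Longrightarrow> open S \<Longrightarrow> smooth_on S f \<Longrightarrow> smooth_on S (\<lambda>x. L (f x))"
  by (simp add: smooth_on_def times_differentiable_on_bounded_linear)

lemma smooth_on_bilinear:
  "bounded_bilinear B \<Longrightarrow> open S \<Longrightarrow> smooth_on S f \<Longrightarrow> smooth_on S g \<Longrightarrow> smooth_on S (\<lambda>x. B (f x) (g x))"
  by (simp add: smooth_on_def times_differentiable_on_bilinear)

lemma smooth_on_add: "open S \<Longrightarrow> smooth_on S f \<Longrightarrow> smooth_on S g \<Longrightarrow> smooth_on S (\<lambda>x. f x + g x)"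
  by (simp add: smooth_on_def times_differentiable_on_add)

lemma smooth_on_sum:
  "open S \<Longrightarrow> (\<And>i. i \<in> I \<Longrightarrow> smooth_on S (f i)) \<Longrightarrow> smooth_on S (\<lambda>x. \<Sum>i\<in>I. f i x)"
  by (simp add: smooth_on_def times_differentiable_on_sum)

lemma smooth_on_minus: "open S \<Longrightarrow> smooth_on S f \<Longrightarrow> smooth_on S (\<lambda>x. - f x)"
  by (rule smooth_on_bounded_linear[OF bounded_linear_minus[OF bounded_linear_ident]])

lemma smooth_on_diff: "open S \<Longrightarrow> smooth_on S f \<Longrightarrow> smooth_on S g \<Longrightarrow> smooth_on S (\<lambda>x. f x - g x)"
  using smooth_on_add[of S f "\<lambda>x. - g x"] smooth_on_minus[of S g] by simp

lemma smooth_on_mult: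
  fixes f g :: "_ \<Rightarrow> 'a::real_normed_algebra"
  shows "open S \<Longrightarrow> smooth_on S f \<Longrightarrow> smooth_on S g \<Longrightarrow> smooth_on S (\<lambda>x. f x * g x)"
  by (rule smooth_on_bilinear[OF bounded_bilinear_mult])

lemma smooth_on_cnj: "open S \<Longrightarrow> smooth_on S f \<Longrightarrow> smooth_on S (\<lambda>x. cnj (f x))"
  by (rule smooth_on_bounded_linear[OF bounded_linear_cnj])

lemma smooth_on_compose:
  fixes g :: "'a::real_normed_vector \<Rightarrow> 'b::euclidean_space"
  shows "open S \<Longrightarrow> open T \<Longrightarrow> g ` S \<subseteq> T \<Longrightarrow> smooth_on T f \<Longrightarrow> smooth_on S g \<Longrightarrow> smooth_on S (\<lambda>x. f (g x))"
  unfolding smooth_on_def using times_differentiable_on_compose by blast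

lemma smooth_on_differentiable: "smooth_on S f \<Longrightarrow> x \<in> S \<Longrightarrow> f differentiable (at x)"
  unfolding smooth_on_def by (metis times_differentiable_on.simps(2))

lemma smooth_on_frechet: "smooth_on S f \<Longrightarrow> smooth_on S (\<lambda>x. frechet_derivative f (at x) v)"
  unfolding smooth_on_def by (metis times_differentiable_on.simps(2))

lemma smooth_on_continuous: "smooth_on S f \<Longrightarrow> continuous_on S f"
  unfolding smooth_on_def by (metis times_differentiable_on.simps(1))

text \<open>The derivative of \<open>inverse\<close> is again a product of copies of
  \<open>inverse\<close>, so the induction on the order closes.\<close>

lemma smooth_on_inverse:
  "smooth_on (- {0}) (inverse :: 'a::{real_normed_field} \<Rightarrow> 'a)"
  unfolding smooth_on_def
proof
  fix k
  show "times_differentiable_on k (- {0}) (inverse :: 'a \<Rightarrow> 'a)"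
  proof (induction k)
    case 0 show ?case by (auto intro!: continuous_intros)
  next
    case (Suc k)
    have d: "(inverse has_derivative (\<lambda>v. - (inverse x * v * inverse x))) (at x)" if "x \<in> - {0}" for x :: 'a
      using that by (intro has_derivative_inverse') auto
    have "times_differentiable_on k (- {0}) (\<lambda>x. frechet_derivative inverse (at x) (v::'a))" for v
    proof (rule times_differentiable_on_cong)
      show "open (- {0::'a})" by (simp add: open_Compl)
      show "times_differentiable_on k (- {0}) (\<lambda>x. - (inverse x * v * inverse x))"
        by (intro times_differentiable_on_bounded_linear[OF bounded_linear_minus[OF bounded_linear_ident]]
          times_differentiable_on_bilinear[OF bounded_bilinear_mult] times_differentiable_on_const Suc) (auto simp: open_Compl)
    qed (use frechet_derivative_eq[OF d] in auto)
    then show ?case using d by (auto simp: differentiable_def)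
  qed
qed

text \<open>A whole sequence of successive derivatives is assumed so that the induction on the order
  can move along \<open>n\<close>. It serves \<open>exp\<close>, as a constant sequence, and the
  flat functions behind the barrier.\<close>

lemma smooth_on_real_function:
  fixes f :: "nat \<Rightarrow> real \<Rightarrow> real"
  assumes "\<And>n x. (f n has_real_derivative f (Suc n) x) (at x)"
  shows "smooth_on UNIV (f n)"
  unfolding smooth_on_def
proof
  fix k show "times_differentiable_on k UNIV (f n)"
  proof (induction k arbitrary: n)
    case 0 show ?case using assms by (auto intro!: continuous_at_imp_continuous_on DERIV_isCont)
  next
    case (Suc k)
    have d: "(f n has_derivative (\<lambda>v. f (Suc n) x * v)) (at x)" for x
      using assms by (simp add: has_field_derivative_def)
    then have "f n differentiable at x" for x by (auto simp: differentiable_def)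
    moreover have "times_differentiable_on k UNIV (\<lambda>x. f (Suc n) x * v)" for v
      by (intro times_differentiable_on_bilinear[OF bounded_bilinear_mult] times_differentiable_on_const Suc) auto
    ultimately show ?case by (simp add: frechet_derivative_eq[OF d])
  qed
qed

lemma smooth_on_exp: "smooth_on UNIV (exp :: real \<Rightarrow> real)"
  by (rule smooth_on_real_function[of "\<lambda>_. exp"]) (rule DERIV_exp)

text \<open>The mean value theorem is applied twice to the mixed second difference, first in
  direction \<open>v\<close>, then in direction \<open>w\<close>. The difference itself is symmetric
  in \<open>v\<close> and \<open>w\<close>, which is what yields the symmetry of second
  derivatives.\<close>

lemma second_difference_quotient:
  fixes f :: "'a::real_normed_vector \<Rightarrow> real"
  assumes "smooth_on S f" "0 < s"
    and S: "\<And>t r. 0 \<le> t \<Longrightarrow> t \<le> s \<Longrightarrow> 0 \<le> r \<Longrightarrow> r \<le> s \<Longrightarrow> z + t *\<^sub>R v + r *\<^sub>R w \<in> S"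
  obtains t r where "0 \<le> t" "t \<le> s" "0 \<le> r" "r \<le> s"
    "f (z + s *\<^sub>R v + s *\<^sub>R w) - f (z + s *\<^sub>R v) - f (z + s *\<^sub>R w) + f z =
     s * s * frechet_derivative (\<lambda>x. frechet_derivative f (at x) v) (at (z + t *\<^sub>R v + r *\<^sub>R w)) w"
proof -
  have der: "((\<lambda>t. h (p + t *\<^sub>R u)) has_real_derivative frechet_derivative h (at (p + t *\<^sub>R u)) u) (at t)"
    if "smooth_on S h" "p + t *\<^sub>R u \<in> S" for h :: "'a \<Rightarrow> real" and p u t
  proof -
    have h: "(h has_derivative frechet_derivative h (at (p + t *\<^sub>R u))) (at (p + t *\<^sub>R u))"
      using smooth_on_differentiable[OF that] by (simp add: frechet_derivative_works)
    have "((\<lambda>t. h (p + t *\<^sub>R u)) has_derivative (\<lambda>x. frechet_derivative h (at (p + t *\<^sub>R u)) (x *\<^sub>R u))) (at t)"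
      by (rule has_derivative_compose[of "\<lambda>t. p + t *\<^sub>R u" "\<lambda>x. x *\<^sub>R u" t UNIV h, OF _ h])
         (auto intro!: derivative_eq_intros)
    moreover have "frechet_derivative h (at (p + t *\<^sub>R u)) (x *\<^sub>R u) = frechet_derivative h (at (p + t *\<^sub>R u)) u * x" for x
      using linear_frechet_derivative[OF smooth_on_differentiable[OF that]]
      by (simp add: linear_cmul mult.commute)
    ultimately show ?thesis by (simp add: has_field_derivative_def)
  qed
  have "\<exists>t>0. t < s \<and> (f (z + s *\<^sub>R w + s *\<^sub>R v) - f (z + s *\<^sub>R v)) - (f (z + s *\<^sub>R w + 0 *\<^sub>R v) - f (z + 0 *\<^sub>R v))
      = (s - 0) * (frechet_derivative f (at (z + s *\<^sub>R w + t *\<^sub>R v)) v - frechet_derivative f (at (z + t *\<^sub>R v)) v)"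
  proof (rule MVT2)
    fix t assume t: "0 \<le> t" "t \<le> s"
    have "z + s *\<^sub>R w + t *\<^sub>R v \<in> S" "z + t *\<^sub>R v \<in> S"
      using S[of t s] S[of t 0] t by (auto simp: algebra_simps)
    then show "((\<lambda>t. f (z + s *\<^sub>R w + t *\<^sub>R v) - f (z + t *\<^sub>R v)) has_real_derivative
       frechet_derivative f (at (z + s *\<^sub>R w + t *\<^sub>R v)) v - frechet_derivative f (at (z + t *\<^sub>R v)) v) (at t)"
      by (intro DERIV_diff der assms)
  qed (use assms in auto)
  then obtain t where t: "0 < t" "t < s" and e1: "f (z + s *\<^sub>R v + s *\<^sub>R w) - f (z + s *\<^sub>R v) - f (z + s *\<^sub>R w) + f z
     = s * (frechet_derivative f (at (z + s *\<^sub>R w + t *\<^sub>R v)) v - frechet_derivative f (at (z + t *\<^sub>R v)) v)"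
    by (auto simp: algebra_simps)
  let ?g = "\<lambda>x. frechet_derivative f (at x) v"
  have "\<exists>r>0. r < s \<and> ?g (z + t *\<^sub>R v + s *\<^sub>R w) - ?g (z + t *\<^sub>R v + 0 *\<^sub>R w)
      = (s - 0) * frechet_derivative ?g (at (z + t *\<^sub>R v + r *\<^sub>R w)) w"
    by (rule MVT2) (use t S assms in \<open>auto intro!: der smooth_on_frechet\<close>)
  then obtain r where "0 < r" "r < s" "?g (z + t *\<^sub>R v + s *\<^sub>R w) - ?g (z + t *\<^sub>R v)
      = s * frechet_derivative ?g (at (z + t *\<^sub>R v + r *\<^sub>R w)) w" by auto
  then show thesis using that[of t r] t e1 by (simp add: algebra_simps)
qed

lemma symmetric_second_derivative_real:
  fixes f :: "'a::real_normed_vector \<Rightarrow> real"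
  assumes "smooth_on S f" "open S" "z \<in> S"
  shows "frechet_derivative (\<lambda>x. frechet_derivative f (at x) v) (at z) w =
    frechet_derivative (\<lambda>x. frechet_derivative f (at x) w) (at z) v"
proof -
  let ?A = "\<lambda>x. frechet_derivative (\<lambda>x. frechet_derivative f (at x) v) (at x) w"
  let ?B = "\<lambda>x. frechet_derivative (\<lambda>x. frechet_derivative f (at x) w) (at x) v"
  have cont: "isCont ?A z" "isCont ?B z"
    using smooth_on_continuous[OF smooth_on_frechet[OF smooth_on_frechet[OF assms(1)]]] assms(2,3)
    by (auto simp: continuous_on_eq_continuous_at)
  have bound: "\<bar>?A z - ?B z\<bar> \<le> e" if "0 < e" for e
  proof -
    obtain d1 where d1: "0 < d1" "\<And>y. dist y z < d1 \<Longrightarrow> \<bar>?A y - ?A z\<bar> < e / 2"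
      using cont(1) \<open>0 < e\<close> unfolding continuous_at_eps_delta dist_real_def by (meson half_gt_zero)
    obtain d2 where d2: "0 < d2" "\<And>y. dist y z < d2 \<Longrightarrow> \<bar>?B y - ?B z\<bar> < e / 2"
      using cont(2) \<open>0 < e\<close> unfolding continuous_at_eps_delta dist_real_def by (meson half_gt_zero)
    obtain d3 where d3: "0 < d3" "ball z d3 \<subseteq> S" using assms openE by blast
    define d where "d = min d1 (min d2 d3)"
    \<comment> \<open>With this \<open>s\<close> the parallelogram spanned by \<open>s v\<close> and
      \<open>s w\<close> stays within \<open>d / 2\<close> of \<open>z\<close>; the \<open>1\<close>
      keeps the denominator positive when both vectors vanish.\<close>
    define s where "s = d / (2 * (norm v + norm w + 1))"
    have pos: "0 < norm v + norm w + 1" by (simp add: add_nonneg_pos)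
    have d: "0 < d" using d1 d2 d3 by (simp add: d_def)
    then have s: "0 < s" using pos by (simp add: s_def)
    have near: "dist (z + t *\<^sub>R v + r *\<^sub>R w) z < d" if "0 \<le> t" "t \<le> s" "0 \<le> r" "r \<le> s" for t r
    proof -
      have "dist (z + t *\<^sub>R v + r *\<^sub>R w) z \<le> t * norm v + r * norm w"
        using norm_triangle_ineq[of "t *\<^sub>R v" "r *\<^sub>R w"] that by (simp add: dist_norm)
      also have "\<dots> \<le> s * norm v + s * norm w" using that by (intro add_mono mult_right_mono) auto
      also have "\<dots> \<le> s * (norm v + norm w + 1)" using s by (simp add: algebra_simps)
      also have "\<dots> = d / 2" using pos by (simp add: s_def field_simps)
      finally show ?thesis using d by simp
    qed
    have inS: "z + t *\<^sub>R v + r *\<^sub>R w \<in> S" if "0 \<le> t" "t \<le> s" "0 \<le> r" "r \<le> s" for t r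
      using near[OF that] d3 by (auto simp: d_def dist_commute subset_eq)
    obtain t r where tr: "0 \<le> t" "t \<le> s" "0 \<le> r" "r \<le> s"
      "f (z + s *\<^sub>R v + s *\<^sub>R w) - f (z + s *\<^sub>R v) - f (z + s *\<^sub>R w) + f z = s * s * ?A (z + t *\<^sub>R v + r *\<^sub>R w)"
      by (rule second_difference_quotient[OF assms(1) s inS])
    have inS': "z + t *\<^sub>R w + r *\<^sub>R v \<in> S" if "0 \<le> t" "t \<le> s" "0 \<le> r" "r \<le> s" for t r
      using inS[of r t] that by (simp add: algebra_simps)
    obtain t' r' where tr': "0 \<le> t'" "t' \<le> s" "0 \<le> r'" "r' \<le> s"
      "f (z + s *\<^sub>R w + s *\<^sub>R v) - f (z + s *\<^sub>R w) - f (z + s *\<^sub>R v) + f z = s * s * ?B (z + t' *\<^sub>R w + r' *\<^sub>R v)"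
      by (rule second_difference_quotient[OF assms(1) s inS'])
    \<comment> \<open>Both orders of differencing give the same number, so the two second
      derivatives agree at two points close to \<open>z\<close>; continuity does the rest.\<close>
    have "z + s *\<^sub>R w + s *\<^sub>R v = z + s *\<^sub>R v + s *\<^sub>R w" by (simp add: algebra_simps)
    then have "f (z + s *\<^sub>R w + s *\<^sub>R v) = f (z + s *\<^sub>R v + s *\<^sub>R w)" by (rule arg_cong)
    then have "s * s * ?A (z + t *\<^sub>R v + r *\<^sub>R w) = s * s * ?B (z + t' *\<^sub>R w + r' *\<^sub>R v)"
      using tr(5) tr'(5) by linarith
    then have "?A (z + t *\<^sub>R v + r *\<^sub>R w) = ?B (z + t' *\<^sub>R w + r' *\<^sub>R v)" using s by simp
    moreover have "\<bar>?A (z + t *\<^sub>R v + r *\<^sub>R w) - ?A z\<bar> < e / 2"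
      using near[OF tr(1-4)] by (intro d1) (simp add: d_def)
    moreover have "\<bar>?B (z + r' *\<^sub>R v + t' *\<^sub>R w) - ?B z\<bar> < e / 2"
      using near[OF tr'(3,4,1,2)] by (intro d2) (simp add: d_def)
    moreover have "z + r' *\<^sub>R v + t' *\<^sub>R w = z + t' *\<^sub>R w + r' *\<^sub>R v" by (simp add: algebra_simps)
    ultimately have "\<bar>?A (z + t *\<^sub>R v + r *\<^sub>R w) - ?A z\<bar> < e / 2" "\<bar>?A (z + t *\<^sub>R v + r *\<^sub>R w) - ?B z\<bar> < e / 2"
      by simp_all
    then show ?thesis by linarith
  qed
  have "\<bar>?A z - ?B z\<bar> \<le> 0"
  proof (rule field_le_epsilon)
    fix e :: real assume "0 < e"
    from bound[OF this] show "\<bar>?A z - ?B z\<bar> \<le> 0 + e" by (simp only: add_0)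
  qed
  then show ?thesis by simp
qed

lemma symmetric_second_derivative:
  fixes f :: "'a::real_normed_vector \<Rightarrow> 'b::euclidean_space"
  assumes "smooth_on S f" "open S" "z \<in> S"
  shows "frechet_derivative (\<lambda>x. frechet_derivative f (at x) v) (at z) w =
    frechet_derivative (\<lambda>x. frechet_derivative f (at x) w) (at z) v"
proof (rule euclidean_eqI)
  fix b :: 'b
  have inner: "frechet_derivative (\<lambda>x. h x \<bullet> b) (at x) u = frechet_derivative h (at x) u \<bullet> b"
    if "smooth_on S h" "x \<in> S" for h :: "'a \<Rightarrow> 'b" and x u
  proof -
    have "((\<lambda>x. h x \<bullet> b) has_derivative (\<lambda>u. frechet_derivative h (at x) u \<bullet> b)) (at x)"
      using smooth_on_differentiable[OF that]
      by (intro bounded_linear.has_derivative[OF bounded_linear_inner_left]) (simp add: frechet_derivative_works)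
    then show ?thesis by (simp add: frechet_derivative_eq)
  qed
  have second: "frechet_derivative (\<lambda>x. frechet_derivative (\<lambda>x. f x \<bullet> b) (at x) u) (at z) u' =
    frechet_derivative (\<lambda>x. frechet_derivative f (at x) u) (at z) u' \<bullet> b" for u u'
  proof -
    have "frechet_derivative (\<lambda>x. frechet_derivative (\<lambda>x. f x \<bullet> b) (at x) u) (at z)
      = frechet_derivative (\<lambda>x. frechet_derivative f (at x) u \<bullet> b) (at z)"
      by (rule frechet_derivative_cong_open[OF assms(2,3)]) (simp add: inner assms)
    then show ?thesis by (simp add: inner smooth_on_frechet assms)
  qed
  show "frechet_derivative (\<lambda>x. frechet_derivative f (at x) v) (at z) w \<bullet> b =
    frechet_derivative (\<lambda>x. frechet_derivative f (at x) w) (at z) v \<bullet> b"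
    unfolding second[symmetric]
    by (rule symmetric_second_derivative_real[OF _ assms(2,3)])
       (rule smooth_on_bounded_linear[OF bounded_linear_inner_left assms(2,1)])
qed

section \<open>Holomorphic maps are smooth\<close>

lemma norm_smult_complex: "norm (c *s v) = norm c * norm (v :: complex^'n)"
  by (simp add: norm_vec_def norm_mult L2_set_right_distrib)

lemma bounded_bilinear_smult: "bounded_bilinear ((*s) :: complex \<Rightarrow> complex^'n \<Rightarrow> complex^'n)"
  by unfold_locales
     (auto simp: vec_eq_iff algebra_simps norm_smult_complex intro!: exI[of _ 1])

lemma has_derivative_vec_componentwise:
  fixes f :: "'a::real_normed_vector \<Rightarrow> 'b::euclidean_space^'n"
  assumes "\<And>i. ((\<lambda>x. f x $ i) has_derivative (\<lambda>v. f' v $ i)) (at a)"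
  shows "(f has_derivative f') (at a)"
proof (subst has_derivative_componentwise_within, intro ballI)
  fix b :: "'b^'n" assume "b \<in> Basis"
  then obtain i u where b: "b = axis i u" by (auto simp: Basis_vec_def)
  show "((\<lambda>x. f x \<bullet> b) has_derivative (\<lambda>x. f' x \<bullet> b)) (at a)"
    unfolding b inner_axis by (rule bounded_linear.has_derivative[OF bounded_linear_inner_left assms])
qed

text \<open>Cauchy's formula on the complex line through \<open>z\<close> in direction
  \<open>v\<close>. It trades \<open>D z v\<close>, about whose dependence on \<open>z\<close>
  nothing is known, for an integral of values of \<open>h\<close>.\<close>

lemma complex_derivative_circle_integral:
  fixes h :: "complex^'n \<Rightarrow> complex"
  assumes D: "\<And>p. p \<in> S \<Longrightarrow> (h has_derivative D p) (at p)" "\<And>p a w. p \<in> S \<Longrightarrow> D p (a *s w) = a * D p w"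
    and r: "0 < r" "\<And>\<zeta>. norm \<zeta> \<le> r \<Longrightarrow> z + \<zeta> *s v \<in> S"
  shows "D z v = integral {0..1} (\<lambda>t. inverse (r * exp (2 * of_real pi * \<i> * of_real t)) *
    h (z + (r * exp (2 * of_real pi * \<i> * of_real t)) *s v))"
proof -
  let ?g = "\<lambda>\<zeta>. h (z + \<zeta> *s v)"
  have der: "(?g has_field_derivative D (z + \<zeta> *s v) v) (at \<zeta>)" if "norm \<zeta> \<le> r" for \<zeta>
  proof -
    have "((\<lambda>\<zeta>. z + \<zeta> *s v) has_derivative (\<lambda>x. x *s v)) (at \<zeta>)"
      using bounded_linear_imp_has_derivative[OF bounded_bilinear.bounded_linear_left[OF bounded_bilinear_smult, of v]]
      by (auto intro!: derivative_eq_intros)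
    from has_derivative_compose[OF this D(1)[OF r(2)[OF that]]]
    moreover have "(\<lambda>x. D (z + \<zeta> *s v) (x *s v)) = (*) (D (z + \<zeta> *s v) v)"
      using D(2)[OF r(2)[OF that]] by (simp add: fun_eq_iff mult.commute)
    ultimately show ?thesis by (simp add: has_field_derivative_def)
  qed
  have "continuous_on (cball 0 r) ?g"
    using der by (auto intro!: continuous_at_imp_continuous_on DERIV_isCont)
  moreover have "?g holomorphic_on ball 0 r"
    unfolding holomorphic_on_def field_differentiable_def
  proof
    fix \<zeta> :: complex assume "\<zeta> \<in> ball 0 r"
    then have "norm \<zeta> \<le> r" by simp
    from has_field_derivative_at_within[OF der[OF this]]
    show "\<exists>f'. (?g has_field_derivative f') (at \<zeta> within ball 0 r)" by (rule exI)
  qed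
  ultimately have "(?g has_field_derivative
      (1 / (2 * of_real pi * \<i>) * contour_integral (circlepath 0 r) (\<lambda>u. ?g u / (u - 0)^2))) (at 0)"
    by (rule Cauchy_derivative_integral_circlepath(2)) (use r in simp)
  moreover have "(?g has_field_derivative D z v) (at 0)" using der[of 0] r by simp
  ultimately have "D z v = 1 / (2 * of_real pi * \<i>) * contour_integral (circlepath 0 r) (\<lambda>u. ?g u / (u - 0)^2)"
    by (rule DERIV_unique[symmetric])
  also have "\<dots> = integral {0..1} (\<lambda>t. 1 / (2 * of_real pi * \<i>) * (?g (circlepath 0 r t) / (circlepath 0 r t - 0)^2
      * vector_derivative (circlepath 0 r) (at t)))"
    by (simp only: contour_integral_integral integral_mult_right)
  \<comment> \<open>On the circle \<open>u = r exp (2 pi i t)\<close> one has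
    \<open>du = 2 pi i u dt\<close>, which cancels the constant in front and one of the two factors
    \<open>u\<close> in the denominator.\<close>
  also have "\<dots> = integral {0..1} (\<lambda>t. inverse (r * exp (2 * of_real pi * \<i> * of_real t)) *
    h (z + (r * exp (2 * of_real pi * \<i> * of_real t)) *s v))"
    by (rule integral_cong, unfold vector_derivative_circlepath, unfold circlepath)
       (use r in \<open>simp add: field_simps power2_eq_square\<close>)
  finally show ?thesis .
qed

lemma circle_in_open:
  fixes z0 :: "complex^'n"
  assumes "open S" "z0 \<in> S"
  obtains e r where "0 < e" "0 < r" "ball z0 e \<subseteq> S"
    "\<And>z \<zeta>. z \<in> ball z0 e \<Longrightarrow> norm \<zeta> \<le> r \<Longrightarrow> z + \<zeta> *s v \<in> S"
proof -
  obtain R where R: "0 < R" "ball z0 R \<subseteq> S" using assms openE by blast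
  define r where "r = R / (2 * (norm v + 1))"
  have nv: "0 < norm v + 1" by (simp add: add_nonneg_pos)
  show thesis
  proof (rule that[of "R / 2" r])
    show "0 < r" using R nv by (simp add: r_def)
    show "ball z0 (R / 2) \<subseteq> S" using R subset_ball[of "R / 2" R z0] by auto
    fix z and \<zeta> :: complex assume z: "z \<in> ball z0 (R / 2)" and "norm \<zeta> \<le> r"
    then have "norm (\<zeta> *s v) \<le> r * norm v" by (simp add: norm_smult_complex mult_right_mono)
    also have "\<dots> \<le> r * (norm v + 1)" using \<open>0 < r\<close> by simp
    also have "\<dots> = R / 2" using nv by (simp add: r_def divide_simps algebra_simps)
    finally have "norm (\<zeta> *s v) \<le> R / 2" .
    moreover have "dist z0 (z + \<zeta> *s v) \<le> dist z0 z + norm (\<zeta> *s v)"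
      using dist_triangle[of z0 "z + \<zeta> *s v" z] by (simp add: dist_norm)
    ultimately show "z + \<zeta> *s v \<in> S" using z R by auto
  qed (use R in auto)
qed

lemma continuous_on_circle_param:
  "continuous_on A (\<lambda>(z, t). z + (complex_of_real r * exp (2 * of_real pi * \<i> * of_real t)) *s v)"
  unfolding case_prod_unfold
  by (intro continuous_intros bounded_bilinear.continuous_on[OF bounded_bilinear_smult])

text \<open>The integrand of the circle formula is jointly continuous in the point and the
  parameter, because \<open>h\<close> is continuous; the derivative inherits this.\<close>

lemma complex_derivative_continuous:
  fixes h :: "complex^'n \<Rightarrow> complex"
  assumes "open S" and D: "\<And>p. p \<in> S \<Longrightarrow> (h has_derivative D p) (at p)" "\<And>p a w. p \<in> S \<Longrightarrow> D p (a *s w) = a * D p w"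
  shows "continuous_on S (\<lambda>p. D p v)"
proof -
  have "isCont (\<lambda>p. D p v) z0" if z0: "z0 \<in> S" for z0
  proof -
    obtain e r where e: "0 < e" "0 < r" "ball z0 e \<subseteq> S"
      "\<And>z \<zeta>. z \<in> ball z0 e \<Longrightarrow> norm \<zeta> \<le> r \<Longrightarrow> z + \<zeta> *s v \<in> S"
      using circle_in_open[OF assms(1) z0, of v] by blast
    have conth: "continuous_on S h"
      by (intro continuous_at_imp_continuous_on ballI has_derivative_continuous[OF D(1)])
    have "continuous_on (ball z0 e \<times> cbox 0 1) (\<lambda>(z, t). inverse (r * exp (2 * of_real pi * \<i> * of_real t)) *
        h (z + (r * exp (2 * of_real pi * \<i> * of_real t)) *s v))"
      unfolding case_prod_unfold using e
      by (intro continuous_intros continuous_on_compose2[OF conth] continuous_on_circle_param[unfolded case_prod_unfold])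
         (auto simp: norm_mult)
    then have "continuous_on (ball z0 e) (\<lambda>z. integral (cbox 0 1) (\<lambda>t. inverse (r * exp (2 * of_real pi * \<i> * of_real t)) *
        h (z + (r * exp (2 * of_real pi * \<i> * of_real t)) *s v)))"
      by (rule integral_continuous_on_param)
    then have "continuous_on (ball z0 e) (\<lambda>p. D p v)"
    proof (rule continuous_on_eq)
      fix z assume z: "z \<in> ball z0 e"
      show "integral (cbox 0 1) (\<lambda>t. inverse (r * exp (2 * of_real pi * \<i> * of_real t)) *
        h (z + (r * exp (2 * of_real pi * \<i> * of_real t)) *s v)) = D z v"
        unfolding cbox_interval
        by (rule complex_derivative_circle_integral[of S h D, OF D e(2) e(4)[OF z], symmetric])
    qed
    then show ?thesis using e by (simp add: continuous_on_eq_continuous_at)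
  qed
  then show ?thesis by (simp add: continuous_at_imp_continuous_on)
qed

text \<open>Differentiation under the integral sign in the circle formula: continuity of
  \<open>D\<close> makes the differentiated integrand continuous, and complex linearity of
  \<open>D\<close> passes to the integral.\<close>

lemma complex_derivative_has_derivative:
  fixes h :: "complex^'n \<Rightarrow> complex"
  assumes "open S" and D: "\<And>p. p \<in> S \<Longrightarrow> (h has_derivative D p) (at p)" "\<And>p a w. p \<in> S \<Longrightarrow> D p (a *s w) = a * D p w"
    and "z0 \<in> S"
  shows "\<exists>L. ((\<lambda>p. D p v) has_derivative L) (at z0) \<and> (\<forall>a w. L (a *s w) = a * L w)"
proof -
  obtain e r where e: "0 < e" "0 < r" "ball z0 e \<subseteq> S"
    "\<And>z \<zeta>. z \<in> ball z0 e \<Longrightarrow> norm \<zeta> \<le> r \<Longrightarrow> z + \<zeta> *s v \<in> S"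
    using circle_in_open[OF assms(1,4), of v] by blast
  define E where "E t = r * exp (2 * of_real pi * \<i> * of_real t)" for t
  have inS: "z + E t *s v \<in> S" if "z \<in> ball z0 e" for z t
    using e(4)[OF that, of "E t"] e(2) by (simp add: E_def norm_mult)
  define fx where "fx z t = Blinfun (\<lambda>w. inverse (E t) * D (z + E t *s v) w)" for z t
  have blD: "bounded_linear (D p)" if "p \<in> S" for p
    by (rule has_derivative_bounded_linear[OF D(1)[OF that]])
  have fx: "blinfun_apply (fx z t) = (\<lambda>w. inverse (E t) * D (z + E t *s v) w)" if "z \<in> ball z0 e" for z t
    unfolding fx_def
    by (rule bounded_linear_Blinfun_apply[OF bounded_linear_const_mult[OF blD[OF inS[OF that]]]])
  have contE: "continuous_on A (\<lambda>x. z' x + E (t' x) *s v)"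
    if "continuous_on A z'" "continuous_on A t'" for A :: "((complex^'n) \<times> real) set" and z' t'
    unfolding E_def by (intro continuous_intros bounded_bilinear.continuous_on[OF bounded_bilinear_smult] that)
  have E0: "E t \<noteq> 0" for t using e by (simp add: E_def)
  have "((\<lambda>z. integral (cbox 0 1) (\<lambda>t. inverse (E t) * h (z + E t *s v))) has_derivative
      integral (cbox 0 1) (fx z0)) (at z0 within ball z0 e)"
  proof (rule leibniz_rule)
    show "((\<lambda>z. inverse (E t) * h (z + E t *s v)) has_derivative blinfun_apply (fx z t)) (at z within ball z0 e)"
      if "z \<in> ball z0 e" for z t
    proof -
      have "((\<lambda>z. z + E t *s v) has_derivative (\<lambda>x. x)) (at z)" by (auto intro!: derivative_eq_intros)
      from has_derivative_compose[OF this D(1)[OF inS[OF that]]]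
      have "((\<lambda>z. h (z + E t *s v)) has_derivative D (z + E t *s v)) (at z)" .
      then show ?thesis unfolding fx[OF that]
        by (rule has_derivative_mult_right[OF has_derivative_at_withinI])
    qed
    have conth: "continuous_on S h"
      by (intro continuous_at_imp_continuous_on ballI has_derivative_continuous[OF D(1)])
    show "(\<lambda>t. inverse (E t) * h (z + E t *s v)) integrable_on cbox 0 1" if "z \<in> ball z0 e" for z
      unfolding E_def
      by (intro integrable_continuous continuous_intros continuous_on_compose2[OF conth]
          bounded_bilinear.continuous_on[OF bounded_bilinear_smult])
         (use inS[OF that] e in \<open>auto simp: E_def\<close>)
    show "continuous_on (ball z0 e \<times> cbox 0 1) (\<lambda>(z, t). fx z t)"
      unfolding case_prod_unfold
    proof (rule continuous_on_blinfun_componentwise)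
      fix i :: "complex^'n"
      have "continuous_on (ball z0 e \<times> cbox 0 1) (\<lambda>x. inverse (E (snd x)) * D (fst x + E (snd x) *s v) i)"
        using inS E0 by (intro continuous_intros continuous_on_compose2[OF complex_derivative_continuous[OF assms(1) D, of i]] contE)
           (auto simp: E_def intro!: continuous_intros)
      then show "continuous_on (ball z0 e \<times> cbox 0 1) (\<lambda>x. blinfun_apply (fx (fst x) (snd x)) i)"
        by (rule continuous_on_eq) (auto simp: fx)
    qed
    show "z0 \<in> ball z0 e" "convex (ball z0 e)" using e by auto
  qed
  then have "((\<lambda>z. integral (cbox 0 1) (\<lambda>t. inverse (E t) * h (z + E t *s v))) has_derivative
      integral (cbox 0 1) (fx z0)) (at z0)"
    using at_within_open[of z0 "ball z0 e"] e by simp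
  then have 1: "((\<lambda>p. D p v) has_derivative integral (cbox 0 1) (fx z0)) (at z0)"
  proof (rule has_derivative_transform_within_open)
    fix z assume "z \<in> ball z0 e"
    then show "integral (cbox 0 1) (\<lambda>t. inverse (E t) * h (z + E t *s v)) = D z v"
      using complex_derivative_circle_integral[of S h D, OF D e(2) e(4)] by (simp add: E_def)
  qed (use e in auto)
  have z0: "z0 \<in> ball z0 e" using e by simp
  have "continuous_on (cbox 0 1) (fx z0)"
  proof (rule continuous_on_blinfun_componentwise)
    fix i :: "complex^'n"
    show "continuous_on (cbox 0 1) (\<lambda>t. blinfun_apply (fx z0 t) i)"
      unfolding fx[OF z0] E_def
      by (intro continuous_intros continuous_on_compose2[OF complex_derivative_continuous[OF assms(1) D, of i]]
          bounded_bilinear.continuous_on[OF bounded_bilinear_smult])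
         (use inS[OF z0] e in \<open>auto simp: E_def\<close>)
  qed
  then have int: "fx z0 integrable_on cbox 0 1" by (rule integrable_continuous)
  have "integral (cbox 0 1) (fx z0) (a *s w) = a * integral (cbox 0 1) (fx z0) w" for a w
  proof -
    have "(\<lambda>t. inverse (E t) * D (z0 + E t *s v) (a *s w)) = (\<lambda>t. a * (inverse (E t) * D (z0 + E t *s v) w))"
      unfolding D(2)[OF inS[OF z0]] by (simp add: fun_eq_iff algebra_simps)
    then show ?thesis unfolding blinfun_apply_integral[OF int] fx[OF z0] by (simp only: integral_mult_right)
  qed
  then have "\<forall>a w. blinfun_apply (integral (cbox 0 1) (fx z0)) (a *s w) = a * blinfun_apply (integral (cbox 0 1) (fx z0)) w"
    by blast
  with 1 show ?thesis by (intro exI conjI)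
qed

lemma holomorphic_map_on_frechet_derivative:
  assumes "open S" "holomorphic_map_on S f"
  shows "holomorphic_map_on S (\<lambda>z. frechet_derivative f (at z) v)"
  unfolding holomorphic_map_on_def
proof
  fix z assume z: "z \<in> S"
  let ?D = "\<lambda>i p w. frechet_derivative f (at p) w $ i"
  have D1: "(f has_derivative frechet_derivative f (at p)) (at p)" if "p \<in> S" for p
    using assms(2) that frechet_derivative_eq unfolding holomorphic_map_on_def by metis
  have D2: "frechet_derivative f (at p) (a *s w) = a *s frechet_derivative f (at p) w" if "p \<in> S" for p a w
    using assms(2) that frechet_derivative_eq unfolding holomorphic_map_on_def by metis
  have "\<exists>L. ((\<lambda>p. ?D i p v) has_derivative L) (at z) \<and> (\<forall>a w. L (a *s w) = a * L w)" for i
    by (rule complex_derivative_has_derivative[OF assms(1) _ _ z, of "\<lambda>p. f p $ i"])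
       (use D1 D2 in \<open>auto intro: bounded_linear.has_derivative[OF bounded_linear_vec_nth]\<close>)
  then obtain L where L: "\<And>i. ((\<lambda>p. ?D i p v) has_derivative L i) (at z)" "\<And>i a w. L i (a *s w) = a * L i w"
    by metis
  show "\<exists>D. ((\<lambda>z. frechet_derivative f (at z) v) has_derivative D) (at z) \<and> (\<forall>a v. D (a *s v) = a *s D v)"
    by (intro exI[of _ "\<lambda>w. \<chi> i. L i w"] conjI has_derivative_vec_componentwise) (simp_all add: L vec_eq_iff)
qed

text \<open>An atlas asks the transition maps only to be complex differentiable once. Since the
  derivative of a holomorphic map is holomorphic, all orders follow.\<close>

lemma holomorphic_map_on_smooth:
  assumes "open S" "holomorphic_map_on S f"
  shows "smooth_on S f"
  unfolding smooth_on_def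
proof
  fix k show "times_differentiable_on k S f" using assms(2)
  proof (induction k arbitrary: f)
    case 0
    have "isCont f x" if "x \<in> S" for x
      using 0 that has_derivative_continuous unfolding holomorphic_map_on_def by metis
    then show ?case by (simp add: continuous_at_imp_continuous_on)
  next
    case (Suc k)
    have "f differentiable at x" if "x \<in> S" for x
      using Suc.prems that by (auto simp: holomorphic_map_on_def differentiable_def)
    then show ?case
      using Suc.IH[OF holomorphic_map_on_frechet_derivative[OF assms(1) Suc.prems]] by simp
  qed
qed

section \<open>Wirtinger calculus\<close>

text \<open>Directional form of the Wirtinger operators: \<open>dz v\<close> is complex linear and
  \<open>dzb v\<close> antilinear in \<open>v\<close>. Admitting every direction spares index sums
  when coordinates and frames change.\<close>

definition dz :: "complex^'n \<Rightarrow> (complex^'n \<Rightarrow> complex) \<Rightarrow> complex^'n \<Rightarrow> complex" where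
  "dz v f z = (frechet_derivative f (at z) v - \<i> * frechet_derivative f (at z) (\<i> *s v)) / 2"

definition dzb :: "complex^'n \<Rightarrow> (complex^'n \<Rightarrow> complex) \<Rightarrow> complex^'n \<Rightarrow> complex" where
  "dzb v f z = (frechet_derivative f (at z) v + \<i> * frechet_derivative f (at z) (\<i> *s v)) / 2"

lemma smult_axis: "c *s axis i a = axis i (c * a :: complex)"
  by (simp add: vec_eq_iff axis_def)

lemma wirtinger_dz: "wirtinger i = dz (axis i 1)"
  by (simp add: fun_eq_iff wirtinger_def dz_def smult_axis)

lemma wirtinger_bar_dzb: "wirtinger_bar i = dzb (axis i 1)"
  by (simp add: fun_eq_iff wirtinger_bar_def dzb_def smult_axis)

lemma frechet_dz_dzb: "frechet_derivative f (at z) v = dz v f z + dzb v f z"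
  by (simp add: dz_def dzb_def field_simps)

lemma dz_has_derivative:
  "(f has_derivative D) (at z) \<Longrightarrow> dz v f z = (D v - \<i> * D (\<i> *s v)) / 2"
  by (simp add: dz_def frechet_derivative_eq)

lemma dzb_has_derivative:
  "(f has_derivative D) (at z) \<Longrightarrow> dzb v f z = (D v + \<i> * D (\<i> *s v)) / 2"
  by (simp add: dzb_def frechet_derivative_eq)

lemma dz_cong_open: "open S \<Longrightarrow> z \<in> S \<Longrightarrow> (\<And>y. y \<in> S \<Longrightarrow> f y = g y) \<Longrightarrow> dz v f z = dz v g z"
  unfolding dz_def using frechet_derivative_cong_open[of S z f g] by simp

lemma dzb_cong_open: "open S \<Longrightarrow> z \<in> S \<Longrightarrow> (\<And>y. y \<in> S \<Longrightarrow> f y = g y) \<Longrightarrow> dzb v f z = dzb v g z"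
  unfolding dzb_def using frechet_derivative_cong_open[of S z f g] by simp

context
  fixes f g :: "complex^'n \<Rightarrow> complex" and z :: "complex^'n"
  assumes f: "f differentiable (at z)" and g: "g differentiable (at z)"
begin

private lemma f': "(f has_derivative frechet_derivative f (at z)) (at z)" 
  and g': "(g has_derivative frechet_derivative g (at z)) (at z)"
  using f g by (simp_all add: frechet_derivative_works)

lemma dz_add: "dz v (\<lambda>y. f y + g y) z = dz v f z + dz v g z"
  and dzb_add: "dzb v (\<lambda>y. f y + g y) z = dzb v f z + dzb v g z"
  unfolding dz_has_derivative[OF has_derivative_add[OF f' g']] dzb_has_derivative[OF has_derivative_add[OF f' g']]
  by (simp_all add: dz_def dzb_def field_simps)

lemma dz_diff: "dz v (\<lambda>y. f y - g y) z = dz v f z - dz v g z"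
  and dzb_diff: "dzb v (\<lambda>y. f y - g y) z = dzb v f z - dzb v g z"
  unfolding dz_has_derivative[OF has_derivative_diff[OF f' g']] dzb_has_derivative[OF has_derivative_diff[OF f' g']]
  by (simp_all add: dz_def dzb_def field_simps)

lemma dz_mult: "dz v (\<lambda>y. f y * g y) z = dz v f z * g z + f z * dz v g z"
  and dzb_mult: "dzb v (\<lambda>y. f y * g y) z = dzb v f z * g z + f z * dzb v g z"
  unfolding dz_has_derivative[OF has_derivative_mult[OF f' g']] dzb_has_derivative[OF has_derivative_mult[OF f' g']]
  by (simp_all add: dz_def dzb_def field_simps)

lemma dz_cnj: "dz v (\<lambda>y. cnj (f y)) z = cnj (dzb v f z)"
  and dzb_cnj: "dzb v (\<lambda>y. cnj (f y)) z = cnj (dz v f z)"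
  unfolding dz_has_derivative[OF bounded_linear.has_derivative[OF bounded_linear_cnj f']]
    dzb_has_derivative[OF bounded_linear.has_derivative[OF bounded_linear_cnj f']]
  by (simp_all add: dz_def dzb_def)

lemma dz_dir_add: "dz (v + w) f z = dz v f z + dz w f z"
  and dzb_dir_add: "dzb (v + w) f z = dzb v f z + dzb w f z"
  using linear_frechet_derivative[OF f]
  by (simp_all add: dz_def dzb_def linear_add vector_add_ldistrib field_simps)

lemma dz_dir_smult: "dz (c *s v) f z = c * dz v f z"
  and dzb_dir_smult: "dzb (c *s v) f z = cnj c * dzb v f z"
proof -
  let ?D = "frechet_derivative f (at z)"
  note L = linear_frechet_derivative[OF f]
  have 1: "c *s v = Re c *\<^sub>R v + Im c *\<^sub>R (\<i> *s v)" "\<i> *s (c *s v) = Re c *\<^sub>R (\<i> *s v) - Im c *\<^sub>R v"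
    by (simp_all add: vec_eq_iff complex_eq_iff)
  have 2: "?D (c *s v) = of_real (Re c) * ?D v + of_real (Im c) * ?D (\<i> *s v)"
    "?D (\<i> *s (c *s v)) = of_real (Re c) * ?D (\<i> *s v) - of_real (Im c) * ?D v"
    by (simp only: 1(1) linear_add[OF L] linear_cmul[OF L], simp add: scaleR_conv_of_real)
       (simp only: 1(2) linear_diff[OF L] linear_cmul[OF L], simp add: scaleR_conv_of_real)
  have c: "c = of_real (Re c) + \<i> * of_real (Im c)" "cnj c = of_real (Re c) - \<i> * of_real (Im c)"
    by (simp_all add: complex_eq_iff)
  show "dz (c *s v) f z = c * dz v f z"
    unfolding dz_def 2 by (subst (5) c) (simp add: field_simps)
  show "dzb (c *s v) f z = cnj c * dzb v f z"
    unfolding dzb_def 2 c(2) by (simp add: field_simps)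
qed

end

lemma dz_const [simp]: "dz v (\<lambda>y. c) z = 0" and dzb_const [simp]: "dzb v (\<lambda>y. c) z = 0"
  by (simp_all add: dz_def dzb_def frechet_derivative_eq[OF has_derivative_const])

lemma dz_zero [simp]: "f differentiable (at z) \<Longrightarrow> dz 0 f z = 0"
  and dzb_zero [simp]: "f differentiable (at z) \<Longrightarrow> dzb 0 f z = 0"
  using dz_dir_smult[of f z f 0 0] dzb_dir_smult[of f z f 0 0] by simp_all

lemma dz_sum: "(\<And>i. i \<in> I \<Longrightarrow> f i differentiable (at z)) \<Longrightarrow> dz v (\<lambda>y. \<Sum>i\<in>I. f i y) z = (\<Sum>i\<in>I. dz v (f i) z)"
  by (induction I rule: infinite_finite_induct) (simp_all add: dz_add)

lemma dzb_sum: "(\<And>i. i \<in> I \<Longrightarrow> f i differentiable (at z)) \<Longrightarrow> dzb v (\<lambda>y. \<Sum>i\<in>I. f i y) z = (\<Sum>i\<in>I. dzb v (f i) z)"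
  by (induction I rule: infinite_finite_induct) (simp_all add: dzb_add)

lemma dz_cmult: "f differentiable (at z) \<Longrightarrow> dz v (\<lambda>y. c * f y) z = c * dz v f z"
  and dzb_cmult: "f differentiable (at z) \<Longrightarrow> dzb v (\<lambda>y. c * f y) z = c * dzb v f z"
  by (simp_all add: dz_mult dzb_mult)

lemma dz_dir_sum: "f differentiable (at z) \<Longrightarrow> dz (\<Sum>i\<in>I. v i) f z = (\<Sum>i\<in>I. dz (v i) f z)"
  by (induction I rule: infinite_finite_induct) (simp_all add: dz_dir_add)

lemma dzb_dir_sum: "f differentiable (at z) \<Longrightarrow> dzb (\<Sum>i\<in>I. v i) f z = (\<Sum>i\<in>I. dzb (v i) f z)"
  by (induction I rule: infinite_finite_induct) (simp_all add: dzb_dir_add)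

lemma dz_expand:
  fixes v :: "complex^'n"
  shows "f differentiable (at z) \<Longrightarrow> dz v f z = (\<Sum>i\<in>UNIV. v $ i * dz (axis i 1) f z)"
  by (subst basis_expansion[of v, symmetric]) (simp add: dz_dir_sum dz_dir_smult)

lemma dzb_expand:
  fixes v :: "complex^'n"
  shows "f differentiable (at z) \<Longrightarrow> dzb v f z = (\<Sum>i\<in>UNIV. cnj (v $ i) * dzb (axis i 1) f z)"
  by (subst basis_expansion[of v, symmetric]) (simp add: dzb_dir_sum dzb_dir_smult)

lemma smooth_on_dz: "open S \<Longrightarrow> smooth_on S f \<Longrightarrow> smooth_on S (dz v f)"
  unfolding dz_def[abs_def] divide_inverse
  by (intro smooth_on_mult smooth_on_diff smooth_on_const smooth_on_frechet)

lemma smooth_on_dzb: "open S \<Longrightarrow> smooth_on S f \<Longrightarrow> smooth_on S (dzb v f)"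
  unfolding dzb_def[abs_def] divide_inverse
  by (intro smooth_on_mult smooth_on_add smooth_on_const smooth_on_frechet)

lemma frechet_dz:
  assumes "open S" "smooth_on S f" "z \<in> S"
  shows "frechet_derivative (dz v f) (at z) w =
    (frechet_derivative (\<lambda>x. frechet_derivative f (at x) v) (at z) w -
     \<i> * frechet_derivative (\<lambda>x. frechet_derivative f (at x) (\<i> *s v)) (at z) w) / 2"
proof -
  have "((\<lambda>x. frechet_derivative f (at x) u) has_derivative
     frechet_derivative (\<lambda>x. frechet_derivative f (at x) u) (at z)) (at z)" for u
    using smooth_on_differentiable[OF smooth_on_frechet[OF assms(2)] assms(3)] by (simp add: frechet_derivative_works)
  note d = this
  have "(dz v f has_derivative (\<lambda>w. (frechet_derivative (\<lambda>x. frechet_derivative f (at x) v) (at z) w -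
     \<i> * frechet_derivative (\<lambda>x. frechet_derivative f (at x) (\<i> *s v)) (at z) w) / 2)) (at z)"
    unfolding dz_def[abs_def] divide_inverse
    by (intro has_derivative_mult_left has_derivative_diff has_derivative_mult_right d)
  then show ?thesis by (simp add: frechet_derivative_eq)
qed

lemma frechet_dzb:
  assumes "open S" "smooth_on S f" "z \<in> S"
  shows "frechet_derivative (dzb v f) (at z) w =
    (frechet_derivative (\<lambda>x. frechet_derivative f (at x) v) (at z) w +
     \<i> * frechet_derivative (\<lambda>x. frechet_derivative f (at x) (\<i> *s v)) (at z) w) / 2"
proof -
  have "((\<lambda>x. frechet_derivative f (at x) u) has_derivative
     frechet_derivative (\<lambda>x. frechet_derivative f (at x) u) (at z)) (at z)" for u
    using smooth_on_differentiable[OF smooth_on_frechet[OF assms(2)] assms(3)] by (simp add: frechet_derivative_works)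
  note d = this
  have "(dzb v f has_derivative (\<lambda>w. (frechet_derivative (\<lambda>x. frechet_derivative f (at x) v) (at z) w +
     \<i> * frechet_derivative (\<lambda>x. frechet_derivative f (at x) (\<i> *s v)) (at z) w) / 2)) (at z)"
    unfolding dzb_def[abs_def] divide_inverse
    by (intro has_derivative_mult_left has_derivative_add has_derivative_mult_right d)
  then show ?thesis by (simp add: frechet_derivative_eq)
qed

lemma dz_commute:
  assumes "open S" "smooth_on S f" "z \<in> S"
  shows "dz v (dz w f) z = dz w (dz v f) z"
  unfolding dz_def[of _ "dz _ f"] frechet_dz[OF assms]
  using symmetric_second_derivative[OF assms(2,1,3)] by (simp add: field_simps)

lemma dz_dzb_commute:
  assumes "open S" "smooth_on S f" "z \<in> S"
  shows "dz v (dzb w f) z = dzb w (dz v f) z"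
  unfolding dz_def[of _ "dzb _ f"] dzb_def[of _ "dz _ f"] frechet_dz[OF assms] frechet_dzb[OF assms]
  using symmetric_second_derivative[OF assms(2,1,3)] by (simp add: field_simps)

lemma dzb_commute:
  assumes "open S" "smooth_on S f" "z \<in> S"
  shows "dzb v (dzb w f) z = dzb w (dzb v f) z"
  unfolding dzb_def[of _ "dzb _ f"] frechet_dzb[OF assms]
  using symmetric_second_derivative[OF assms(2,1,3)] by (simp add: field_simps)

text \<open>Links the mixed complex derivative to the real second derivatives along \<open>v\<close>
  and \<open>i v\<close>, the form in which the test at a minimum is available. The cross terms
  cancel by symmetry of second derivatives.\<close>

lemma dz_dzb_laplacian:
  assumes "open S" "smooth_on S f" "z \<in> S"
  shows "4 * dz v (dzb v f) z = frechet_derivative (\<lambda>x. frechet_derivative f (at x) v) (at z) v +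
    frechet_derivative (\<lambda>x. frechet_derivative f (at x) (\<i> *s v)) (at z) (\<i> *s v)"
  unfolding dz_def[of _ "dzb _ f"] frechet_dzb[OF assms]
  using symmetric_second_derivative[OF assms(2,1,3), of v "\<i> *s v"] by (simp add: field_simps)

definition dz_vec :: "complex^'n \<Rightarrow> (complex^'n \<Rightarrow> complex^'m) \<Rightarrow> complex^'n \<Rightarrow> complex^'m" where
  "dz_vec v p z = (\<chi> i. dz v (\<lambda>y. p y $ i) z)"

definition dzb_vec :: "complex^'n \<Rightarrow> (complex^'n \<Rightarrow> complex^'m) \<Rightarrow> complex^'n \<Rightarrow> complex^'m" where
  "dzb_vec v p z = (\<chi> i. dzb v (\<lambda>y. p y $ i) z)"

definition dz_mat :: "complex^'n \<Rightarrow> (complex^'n \<Rightarrow> complex^'m^'k) \<Rightarrow> complex^'n \<Rightarrow> complex^'m^'k" where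
  "dz_mat v M z = (\<chi> i j. dz v (\<lambda>y. M y $ i $ j) z)"

definition dzb_mat :: "complex^'n \<Rightarrow> (complex^'n \<Rightarrow> complex^'m^'k) \<Rightarrow> complex^'n \<Rightarrow> complex^'m^'k" where
  "dzb_mat v M z = (\<chi> i j. dzb v (\<lambda>y. M y $ i $ j) z)"

lemma holomorphic_dz_vec:
  assumes "holomorphic_map_on S p" "z \<in> S"
  shows "dz_vec v p z = frechet_derivative p (at z) v" "dzb_vec v p z = 0"
    "frechet_derivative p (at z) (a *s v) = a *s frechet_derivative p (at z) v"
    "(p has_derivative frechet_derivative p (at z)) (at z)"
proof -
  obtain D where D: "(p has_derivative D) (at z)" "\<And>a v. D (a *s v) = a *s D v"
    using assms unfolding holomorphic_map_on_def by blast
  note 1 = bounded_linear.has_derivative[OF bounded_linear_vec_nth D(1)]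
  have "dz_vec v p z = D v" "dzb_vec v p z = 0"
    by (simp_all add: dz_vec_def dzb_vec_def vec_eq_iff dz_has_derivative[OF 1] dzb_has_derivative[OF 1] D(2) field_simps)
  then show "dz_vec v p z = frechet_derivative p (at z) v" "dzb_vec v p z = 0"
    "frechet_derivative p (at z) (a *s v) = a *s frechet_derivative p (at z) v"
    "(p has_derivative frechet_derivative p (at z)) (at z)"
    using D by (simp_all add: frechet_derivative_eq[OF D(1)])
qed

lemma dz_compose_holomorphic:
  assumes "holomorphic_map_on S p" "z \<in> S" "f differentiable (at (p z))"
  shows "dz v (\<lambda>y. f (p y)) z = dz (frechet_derivative p (at z) v) f (p z)"
    "dzb v (\<lambda>y. f (p y)) z = dzb (frechet_derivative p (at z) v) f (p z)"
proof -
  have "((\<lambda>y. f (p y)) has_derivative (\<lambda>v. frechet_derivative f (at (p z)) (frechet_derivative p (at z) v))) (at z)"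
    by (rule has_derivative_compose[OF holomorphic_dz_vec(4)[OF assms(1,2)]])
       (use assms(3) in \<open>simp add: frechet_derivative_works\<close>)
  note 1 = dz_has_derivative[OF this] dzb_has_derivative[OF this]
  show "dz v (\<lambda>y. f (p y)) z = dz (frechet_derivative p (at z) v) f (p z)"
    "dzb v (\<lambda>y. f (p y)) z = dzb (frechet_derivative p (at z) v) f (p z)"
    unfolding 1 holomorphic_dz_vec(3)[OF assms(1,2)] by (simp_all add: dz_def dzb_def)
qed

text \<open>No second derivative of \<open>p\<close> appears: after \<open>dzb\<close>, the Jacobian
  enters only through its conjugate, which \<open>dz\<close> annihilates because the Jacobian is
  holomorphic.\<close>

lemma dz_dzb_compose_holomorphic:
  fixes p :: "complex^'n \<Rightarrow> complex^'m"
  assumes "open S" "open T" "holomorphic_map_on S p" "p ` S \<subseteq> T" "smooth_on T f" "z \<in> S"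
  shows "dz v (dzb w (\<lambda>y. f (p y))) z =
    dz (frechet_derivative p (at z) v) (dzb (frechet_derivative p (at z) w) f) (p z)"
proof -
  let ?J = "\<lambda>y. frechet_derivative p (at y)"
  have fd: "f differentiable (at (p y))" if "y \<in> S" for y
    using smooth_on_differentiable[OF assms(5)] assms(4) that by blast
  have sb: "smooth_on T (dzb u f)" for u by (rule smooth_on_dzb[OF assms(2,5)])
  have hd: "holomorphic_map_on S (\<lambda>y. ?J y w)" by (rule holomorphic_map_on_frechet_derivative[OF assms(1,3)])
  have Jd: "(\<lambda>y. ?J y w $ j) differentiable (at z)" for j
    using bounded_linear.has_derivative[OF bounded_linear_vec_nth holomorphic_dz_vec(4)[OF hd assms(6)]]
    by (auto simp: differentiable_def)
  have J0: "dzb v (\<lambda>y. ?J y w $ j) z = 0" for j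
    using holomorphic_dz_vec(2)[OF hd assms(6), of v] by (simp add: dzb_vec_def vec_eq_iff)
  have pz: "p z \<in> T" using assms by blast
  have bd: "(\<lambda>y. dzb u f (p y)) differentiable (at z)" for u
    using differentiable_chain_at[of p z "dzb u f"] holomorphic_dz_vec(4)[OF assms(3,6)] smooth_on_differentiable[OF sb pz]
    by (auto simp: differentiable_def o_def)
  have cd: "(\<lambda>y. cnj (?J y w $ j)) differentiable (at z)" for j
    using bounded_linear.has_derivative[OF bounded_linear_cnj] Jd[of j] unfolding differentiable_def by blast
  \<comment> \<open>The direction of \<open>dzb\<close> moves with \<open>y\<close>; expanding it
    along the axes makes it fixed before \<open>dz\<close> is applied.\<close>
  have "dz v (dzb w (\<lambda>y. f (p y))) z = dz v (\<lambda>y. \<Sum>j\<in>UNIV. cnj (?J y w $ j) * dzb (axis j 1) f (p y)) z"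
    by (rule dz_cong_open[OF assms(1,6)])
       (simp add: dz_compose_holomorphic[OF assms(3)] fd dzb_expand[of f _ "?J _ w"])
  also have "\<dots> = (\<Sum>j\<in>UNIV. cnj (?J z w $ j) * dz (?J z v) (dzb (axis j 1) f) (p z))"
    by (subst dz_sum) (simp_all add: cd bd dz_mult dz_cnj[OF Jd Jd] J0
        dz_compose_holomorphic[OF assms(3,6) smooth_on_differentiable[OF sb pz]])
  also have "\<dots> = dz (?J z v) (\<lambda>y. \<Sum>j\<in>UNIV. cnj (?J z w $ j) * dzb (axis j 1) f y) (p z)"
    by (subst dz_sum) (simp_all add: dz_cmult smooth_on_differentiable[OF sb pz])
  also have "\<dots> = dz (?J z v) (dzb (?J z w) f) (p z)"
    by (rule dz_cong_open[OF assms(2) pz])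
       (simp add: dzb_expand[of f _ "?J z w"] smooth_on_differentiable[OF assms(5)])
  finally show ?thesis .
qed

section \<open>Hermitian forms and the polarised Chern curvature\<close>

lemma sesq_add_mat: "sesq (A + B) v w = sesq A v w + sesq B v w"
  by (simp add: sesq_def distrib_right sum.distrib)
lemma sesq_diff_mat: "sesq (A - B) v w = sesq A v w - sesq B v w"
  by (simp add: sesq_def left_diff_distrib sum_subtractf)
lemma sesq_uminus_mat: "sesq (- A) v w = - sesq A v w"
  by (simp add: sesq_def sum_negf)
lemma sesq_add_left: "sesq H (u + v) w = sesq H u w + sesq H v w"
  by (simp add: sesq_def distrib_right distrib_left sum.distrib)
lemma sesq_add_right: "sesq H v (u + w) = sesq H v u + sesq H v w"
  by (simp add: sesq_def distrib_right distrib_left sum.distrib)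
lemma sesq_smult_left: "sesq H (c *s v) w = c * sesq H v w"
  by (simp add: sesq_def sum_distrib_left ac_simps)
lemma sesq_smult_right: "sesq H v (c *s w) = cnj c * sesq H v w"
  by (simp add: sesq_def sum_distrib_left ac_simps)
lemma sesq_zero_left [simp]: "sesq H 0 w = 0" and sesq_zero_right [simp]: "sesq H v 0 = 0"
  by (simp_all add: sesq_def)
lemma sesq_diff_left: "sesq H (u - v) w = sesq H u w - sesq H v w"
  by (simp add: sesq_def left_diff_distrib right_diff_distrib sum_subtractf)
lemma sesq_minus_left: "sesq H (- v) w = - sesq H v w"
  using sesq_diff_left[of H 0 v w] by simp
lemma sesq_sum_left: "sesq H (\<Sum>i\<in>I. f i) w = (\<Sum>i\<in>I. sesq H (f i) w)"
  by (induction I rule: infinite_finite_induct) (simp_all add: sesq_add_left)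
lemma sesq_mult: "sesq (M ** N) v w = sesq N (v v* M) w"
proof -
  have "sesq (M ** N) v w = (\<Sum>\<alpha>\<in>UNIV. \<Sum>\<beta>\<in>UNIV. \<Sum>k\<in>UNIV. M $ \<alpha> $ k * N $ k $ \<beta> * v $ \<alpha> * cnj (w $ \<beta>))"
    by (simp add: sesq_def matrix_matrix_mult_def sum_distrib_right)
  also have "\<dots> = (\<Sum>\<alpha>\<in>UNIV. \<Sum>k\<in>UNIV. \<Sum>\<beta>\<in>UNIV. M $ \<alpha> $ k * N $ k $ \<beta> * v $ \<alpha> * cnj (w $ \<beta>))"
    by (intro sum.cong refl sum.swap)
  also have "\<dots> = (\<Sum>k\<in>UNIV. \<Sum>\<alpha>\<in>UNIV. \<Sum>\<beta>\<in>UNIV. M $ \<alpha> $ k * N $ k $ \<beta> * v $ \<alpha> * cnj (w $ \<beta>))"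
    by (rule sum.swap)
  also have "\<dots> = (\<Sum>k\<in>UNIV. \<Sum>\<beta>\<in>UNIV. \<Sum>\<alpha>\<in>UNIV. M $ \<alpha> $ k * N $ k $ \<beta> * v $ \<alpha> * cnj (w $ \<beta>))"
    by (intro sum.cong refl sum.swap)
  also have "\<dots> = sesq N (v v* M) w"
    by (simp add: sesq_def vector_matrix_mult_def sum_distrib_left sum_distrib_right ac_simps)
  finally show ?thesis .
qed

lemma hermitian_posdef_cnj: "hermitian_posdef H \<Longrightarrow> cnj (sesq H v w) = sesq H w v"
proof -
  assume h: "hermitian_posdef H"
  then have hh: "cnj (H $ \<alpha> $ \<beta>) = H $ \<beta> $ \<alpha>" for \<alpha> \<beta> unfolding hermitian_posdef_def by metis
  have "cnj (sesq H v w) = (\<Sum>\<alpha>\<in>UNIV. \<Sum>\<beta>\<in>UNIV. H $ \<beta> $ \<alpha> * w $ \<beta> * cnj (v $ \<alpha>))"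
    by (simp add: sesq_def hh ac_simps)
  also have "\<dots> = sesq H w v" unfolding sesq_def by (rule sum.swap)
  finally show ?thesis .
qed

lemma hermitian_posdef_pos: "hermitian_posdef H \<Longrightarrow> v \<noteq> 0 \<Longrightarrow> 0 < Re (sesq H v v)"
  by (simp add: hermitian_posdef_def)

lemma hermitian_posdef_real: "hermitian_posdef H \<Longrightarrow> sesq H v v = of_real (Re (sesq H v v))"
  using hermitian_posdef_cnj[of H v v] by (simp add: complex_eq_iff)

lemma hermitian_posdef_eq_0: "hermitian_posdef H \<Longrightarrow> (\<And>w. sesq H v w = 0) \<Longrightarrow> v = 0"
  using hermitian_posdef_pos[of H v] by fastforce

lemma hermitian_posdef_cancel: "hermitian_posdef H \<Longrightarrow> (\<And>w. sesq H v w = sesq H u w) \<Longrightarrow> v = u"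
  using hermitian_posdef_eq_0[of H "v - u"] by (simp add: sesq_diff_left)

lemma hermitian_posdef_invertible: "hermitian_posdef H \<Longrightarrow> invertible H"
proof -
  assume h: "hermitian_posdef H"
  have "x = 0" if "transpose H *v x = 0" for x
  proof (rule hermitian_posdef_eq_0[OF h])
    fix w
    have "x v* H = 0" using that by simp
    then show "sesq H x w = 0" using sesq_mult[of H "mat 1" x w] by simp
  qed
  then obtain B where "B ** transpose H = mat 1" using matrix_left_invertible_ker by blast
  then have "H ** transpose B = mat 1" by (metis matrix_transpose_mul transpose_mat transpose_transpose)
  then show ?thesis using invertible_right_inverse by blast
qed

lemma matrix_inv_inverse:
  fixes A :: "'a::field^'n^'n"
  shows "invertible A \<Longrightarrow> A ** matrix_inv A = mat 1" "invertible A \<Longrightarrow> matrix_inv A ** A = mat 1"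
  unfolding invertible_def matrix_inv_def by (metis (mono_tags, lifting) someI_ex)+

lemma dz_sesq_const:
  assumes "\<And>i j. (\<lambda>y. M y $ i $ j) differentiable (at z)"
  shows "dz b (\<lambda>y. sesq (M y) v w) z = sesq (dz_mat b M z) v w"
    "dzb b (\<lambda>y. sesq (M y) v w) z = sesq (dzb_mat b M z) v w"
proof -
  have d: "(\<lambda>y. M y $ i $ j * c * d) differentiable (at z)" for i j c d
    using assms by simp
  show "dz b (\<lambda>y. sesq (M y) v w) z = sesq (dz_mat b M z) v w"
    "dzb b (\<lambda>y. sesq (M y) v w) z = sesq (dzb_mat b M z) v w"
    by (simp_all add: sesq_def dz_mat_def dzb_mat_def dz_sum dzb_sum d dz_mult dzb_mult assms)
qed

lemma sesq_differentiable:
  assumes "\<And>i j. (\<lambda>y. M y $ i $ j) differentiable (at z)"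
    "\<And>i. (\<lambda>y. p y $ i) differentiable (at z)" "\<And>i. (\<lambda>y. q y $ i) differentiable (at z)"
  shows "(\<lambda>y. sesq (M y) (p y) (q y)) differentiable (at z)"
proof -
  have c: "(\<lambda>y. cnj (q y $ i)) differentiable (at z)" for i
    using bounded_linear.has_derivative[OF bounded_linear_cnj] assms(3)[of i] unfolding differentiable_def by blast
  show ?thesis unfolding sesq_def by (simp add: assms c)
qed

lemma dz_sesq:
  assumes M: "\<And>i j. (\<lambda>y. M y $ i $ j) differentiable (at z)"
    and p: "\<And>i. (\<lambda>y. p y $ i) differentiable (at z)" and q: "\<And>i. (\<lambda>y. q y $ i) differentiable (at z)"
  shows "dz b (\<lambda>y. sesq (M y) (p y) (q y)) z =
      sesq (dz_mat b M z) (p z) (q z) + sesq (M z) (dz_vec b p z) (q z) + sesq (M z) (p z) (dzb_vec b q z)"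
    "dzb b (\<lambda>y. sesq (M y) (p y) (q y)) z =
      sesq (dzb_mat b M z) (p z) (q z) + sesq (M z) (dzb_vec b p z) (q z) + sesq (M z) (p z) (dz_vec b q z)"
proof -
  have c: "(\<lambda>y. cnj (q y $ i)) differentiable (at z)" for i
    using bounded_linear.has_derivative[OF bounded_linear_cnj] q[of i] unfolding differentiable_def by blast
  show "dz b (\<lambda>y. sesq (M y) (p y) (q y)) z =
      sesq (dz_mat b M z) (p z) (q z) + sesq (M z) (dz_vec b p z) (q z) + sesq (M z) (p z) (dzb_vec b q z)"
    "dzb b (\<lambda>y. sesq (M y) (p y) (q y)) z =
      sesq (dzb_mat b M z) (p z) (q z) + sesq (M z) (dzb_vec b p z) (q z) + sesq (M z) (p z) (dz_vec b q z)"
    by (simp_all add: sesq_def dz_mat_def dzb_mat_def dz_vec_def dzb_vec_def dz_sum dzb_sum M p q c dz_mult dzb_mult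
       dz_cnj[OF q q] dzb_cnj[OF q q] distrib_right sum.distrib)
qed

text \<open>The arguments \<open>b\<close> and \<open>c\<close> are linear, \<open>a\<close> and \<open>d\<close> antilinear:
  \<open>curvature4 H z b a c d\<close> is \<open>\<langle>R(b, \<bar>a) c, d\<rangle>\<close>.\<close>

definition curvature4 :: "(complex^'n \<Rightarrow> complex^'r^'r) \<Rightarrow> complex^'n \<Rightarrow> complex^'n \<Rightarrow> complex^'n \<Rightarrow> complex^'r \<Rightarrow> complex^'r \<Rightarrow> complex" where
  "curvature4 H z b a c d = (\<Sum>i\<in>UNIV. \<Sum>j\<in>UNIV. b $ i * cnj (a $ j) * sesq (\<chi> \<alpha> \<beta>. chern_curvature H z i j \<alpha> \<beta>) c d)"

lemma curvature_form_curvature4: "curvature_form H z u v = curvature4 H z u u v v"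
  by (simp add: curvature_form_def curvature4_def sesq_def sum_distrib_left ac_simps)

text \<open>The index order of \<open>matrix_inv\<close> in the curvature is the one for which the
  double sum is an ordinary matrix product; \<open>sesq_mult\<close> can then move its left factors
  onto the first argument of \<open>sesq\<close>.\<close>

lemma chern_curvature_matrix:
  "(\<chi> \<alpha> \<beta>. chern_curvature H z i j \<alpha> \<beta>) =
    - dz_mat (axis i 1) (dzb_mat (axis j 1) H) z + dz_mat (axis i 1) H z ** (matrix_inv (H z) ** dzb_mat (axis j 1) H z)"
proof -
  have "chern_curvature H z i j \<alpha> \<beta> = - dz (axis i 1) (dzb (axis j 1) (\<lambda>y. H y $ \<alpha> $ \<beta>)) z +
      (\<Sum>\<delta>\<in>UNIV. \<Sum>\<gamma>\<in>UNIV. dz (axis i 1) (\<lambda>y. H y $ \<alpha> $ \<delta>) z * (matrix_inv (H z) $ \<delta> $ \<gamma> * dzb (axis j 1) (\<lambda>y. H y $ \<gamma> $ \<beta>) z))" for \<alpha> \<beta>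
    unfolding chern_curvature_def wirtinger_dz wirtinger_bar_dzb
    by (subst sum.swap) (simp add: ac_simps)
  then show ?thesis
    by (simp add: vec_eq_iff dz_mat_def dzb_mat_def matrix_matrix_mult_def sum_distrib_left)
qed

lemma curvature4_eq:
  fixes H :: "complex^'n \<Rightarrow> complex^'r^'r"
  assumes "open S" "z \<in> S" and sm: "\<And>\<alpha> \<beta>. smooth_on S (\<lambda>y. H y $ \<alpha> $ \<beta>)" and pd: "hermitian_posdef (H z)"
    and w: "\<And>e. sesq (H z) w e = dz b (\<lambda>y. sesq (H y) c e) z"
  shows "curvature4 H z b a c d = - dz b (dzb a (\<lambda>y. sesq (H y) c d)) z + dzb a (\<lambda>y. sesq (H y) w d) z"
proof -
  have df: "(\<lambda>y. H y $ \<alpha> $ \<beta>) differentiable (at y)" if "y \<in> S" for \<alpha> \<beta> y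
    by (rule smooth_on_differentiable[OF sm that])
  have dfb: "(\<lambda>y. dzb u (\<lambda>y. H y $ \<alpha> $ \<beta>) y) differentiable (at y)" if "y \<in> S" for \<alpha> \<beta> y u
    by (rule smooth_on_differentiable[OF smooth_on_dzb[OF assms(1) sm] that])
  have dM: "(\<lambda>y. dzb_mat u H y $ \<alpha> $ \<beta>) differentiable (at z)" for u \<alpha> \<beta>
    using dfb[OF assms(2)] by (simp add: dzb_mat_def)
  have sdM: "(\<lambda>y. sesq (dzb_mat u H y) v v') differentiable (at z)" for u v v'
    by (rule sesq_differentiable) (simp_all add: dM)
  have sdf: "(\<lambda>y. sesq (H y) u v) differentiable (at y)" if "y \<in> S" for u v y
    by (rule sesq_differentiable) (simp_all add: df that)
  have inv: "H z ** matrix_inv (H z) = mat 1" "matrix_inv (H z) ** H z = mat 1"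
    using matrix_inv_inverse[OF hermitian_posdef_invertible[OF pd]] .
  have swp: "(\<Sum>j\<in>UNIV. f j * (\<Sum>i\<in>UNIV. g i * X i j)) = (\<Sum>i\<in>UNIV. \<Sum>j\<in>UNIV. g i * f j * X i j)"
    for f g :: "'n \<Rightarrow> complex" and X
    unfolding sum_distrib_left by (subst sum.swap) (simp add: mult_ac)
  \<comment> \<open>\<open>W i\<close> is the Chern derivative of \<open>c\<close> along the
    \<open>i\<close>-th axis; nondegeneracy of the metric shows that \<open>w\<close> is their
    combination with the coefficients of \<open>b\<close>.\<close>
  define W where "W i = c v* dz_mat (axis i 1) H z v* matrix_inv (H z)" for i
  have "w = (\<Sum>i\<in>UNIV. b $ i *s W i)"
  proof (rule hermitian_posdef_cancel[OF pd])
    fix e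
    have "sesq (H z) (W i) e = dz (axis i 1) (\<lambda>y. sesq (H y) c e) z" for i
      by (simp add: W_def sesq_mult[symmetric] matrix_mul_assoc[symmetric] inv dz_sesq_const df assms(2))
    then show "sesq (H z) w e = sesq (H z) (\<Sum>i\<in>UNIV. b $ i *s W i) e"
      by (simp add: w sesq_sum_left sesq_smult_left dz_expand[OF sdf[OF assms(2)], of b])
  qed
  note w_eq = this
  have "dzb a (\<lambda>y. sesq (H y) w d) z = (\<Sum>j\<in>UNIV. cnj (a $ j) * sesq (dzb_mat (axis j 1) H z) w d)"
    by (simp add: dzb_expand[OF sdf[OF assms(2)], of a] dz_sesq_const df assms(2))
  then have 1: "dzb a (\<lambda>y. sesq (H y) w d) z = (\<Sum>i\<in>UNIV. \<Sum>j\<in>UNIV. b $ i * cnj (a $ j) * sesq (dzb_mat (axis j 1) H z) (W i) d)"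
    by (simp add: w_eq sesq_sum_left sesq_smult_left swp)
  have "dz b (dzb a (\<lambda>y. sesq (H y) c d)) z = dz b (\<lambda>y. \<Sum>j\<in>UNIV. cnj (a $ j) * sesq (dzb_mat (axis j 1) H y) c d) z"
    by (rule dz_cong_open[OF assms(1,2)], subst dzb_expand[OF sdf]) (simp_all add: dz_sesq_const df)
  also have "\<dots> = (\<Sum>j\<in>UNIV. cnj (a $ j) * dz b (\<lambda>y. sesq (dzb_mat (axis j 1) H y) c d) z)"
    by (subst dz_sum) (simp_all add: dz_cmult sdM)
  also have "\<dots> = (\<Sum>j\<in>UNIV. cnj (a $ j) * (\<Sum>i\<in>UNIV. b $ i * sesq (dz_mat (axis i 1) (dzb_mat (axis j 1) H) z) c d))"
    by (subst dz_expand[of _ z b])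
       (simp_all add: sdM dz_sesq_const dM)
  also have "\<dots> = (\<Sum>i\<in>UNIV. \<Sum>j\<in>UNIV. b $ i * cnj (a $ j) * sesq (dz_mat (axis i 1) (dzb_mat (axis j 1) H) z) c d)"
    by (rule swp)
  finally have 2: "dz b (dzb a (\<lambda>y. sesq (H y) c d)) z = (\<Sum>i\<in>UNIV. \<Sum>j\<in>UNIV. b $ i * cnj (a $ j) * sesq (dz_mat (axis i 1) (dzb_mat (axis j 1) H) z) c d)" .
  have "sesq (\<chi> \<alpha> \<beta>. chern_curvature H z i j \<alpha> \<beta>) c d =
    - sesq (dz_mat (axis i 1) (dzb_mat (axis j 1) H) z) c d + sesq (dzb_mat (axis j 1) H z) (W i) d" for i j
    by (simp add: chern_curvature_matrix sesq_diff_mat sesq_add_mat sesq_uminus_mat sesq_mult W_def)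
  then show ?thesis unfolding curvature4_def 1 2 by (simp add: distrib_left right_diff_distrib sum_subtractf sum.distrib sum_negf)
qed

lemma ex_connection:
  fixes H :: "complex^'n \<Rightarrow> complex^'r^'r"
  assumes "hermitian_posdef (H z)" "\<And>\<alpha> \<beta>. (\<lambda>y. H y $ \<alpha> $ \<beta>) differentiable (at z)"
  shows "\<exists>w. \<forall>e. sesq (H z) w e = dz b (\<lambda>y. sesq (H y) c e) z"
proof -
  have "matrix_inv (H z) ** H z = mat 1"
    using matrix_inv_inverse[OF hermitian_posdef_invertible[OF assms(1)]] by blast
  then have "sesq (H z) (c v* dz_mat b H z v* matrix_inv (H z)) e = dz b (\<lambda>y. sesq (H y) c e) z" for e
    by (simp add: sesq_mult[symmetric] matrix_mul_assoc[symmetric] dz_sesq_const assms(2))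
  then show ?thesis by blast
qed

lemma holomorphic_map_on_cong:
  assumes "open S" and eq: "\<And>x. x \<in> S \<Longrightarrow> f x = g x" and "holomorphic_map_on S f"
  shows "holomorphic_map_on S g"
  unfolding holomorphic_map_on_def
proof
  fix z assume z: "z \<in> S"
  then obtain D where D: "(f has_derivative D) (at z)" "\<forall>a v. D (a *s v) = a *s D v"
    using assms(3) unfolding holomorphic_map_on_def by blast
  have "(g has_derivative D) (at z)"
    by (rule has_derivative_transform_within_open[OF D(1) assms(1) z eq])
  with D(2) show "\<exists>D. (g has_derivative D) (at z) \<and> (\<forall>a v. D (a *s v) = a *s D v)" by blast
qed

text \<open>Base coordinates and tangent frame change together. Second derivatives of
  \<open>p\<close> occur in both terms of the curvature of \<open>G\<close>; they cancel because the
  connection vector picks up the same derivative of the Jacobian.\<close>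

lemma curvature4_pullback:
  fixes H G :: "complex^'n \<Rightarrow> complex^'n^'n" and p :: "complex^'n \<Rightarrow> complex^'n"
  defines "J \<equiv> \<lambda>y. frechet_derivative p (at y)"
  assumes S: "open S" and T: "open T" and hol: "holomorphic_map_on S p" and pS: "p ` S \<subseteq> T"
    and smH: "\<And>\<alpha> \<beta>. smooth_on T (\<lambda>y. H y $ \<alpha> $ \<beta>)" and smG: "\<And>\<alpha> \<beta>. smooth_on S (\<lambda>y. G y $ \<alpha> $ \<beta>)"
    and G: "\<And>y v w. y \<in> S \<Longrightarrow> sesq (G y) v w = sesq (H (p y)) (J y v) (J y w)"
    and z: "z \<in> S" and pdH: "hermitian_posdef (H (p z))" and pdG: "hermitian_posdef (G z)"
    and surj: "surj (J z)"
  shows "curvature4 G z b a c d = curvature4 H (p z) (J z b) (J z a) (J z c) (J z d)"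
proof -
  have pz: "p z \<in> T" using pS z by blast
  have dfH: "(\<lambda>y. H y $ \<alpha> $ \<beta>) differentiable (at (p y))" if "y \<in> S" for \<alpha> \<beta> y
    by (rule smooth_on_differentiable[OF smH]) (use pS that in blast)
  have smp: "smooth_on S p" by (rule holomorphic_map_on_smooth[OF S hol])
  have holJ: "holomorphic_map_on S (\<lambda>y. J y v)" for v
    unfolding J_def by (rule holomorphic_map_on_frechet_derivative[OF S hol])
  have holQ: "holomorphic_map_on S (\<lambda>y. dz_vec a (\<lambda>y. J y v) y)" for v
    by (rule holomorphic_map_on_cong[OF S holomorphic_dz_vec(1)[OF holJ, symmetric]
        holomorphic_map_on_frechet_derivative[OF S holJ]])
  have nth: "(\<lambda>y. f y $ i) differentiable (at y)" if "holomorphic_map_on S f" "y \<in> S"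
    for f :: "complex^'n \<Rightarrow> complex^'n" and i y
    using bounded_linear.has_derivative[OF bounded_linear_vec_nth holomorphic_dz_vec(4)[OF that]]
    by (auto simp: differentiable_def)
  have smHp: "smooth_on S (\<lambda>y. H (p y) $ \<alpha> $ \<beta>)" for \<alpha> \<beta>
    using smooth_on_compose[OF S T pS smH smp] .
  have dHp: "(\<lambda>y. H (p y) $ \<alpha> $ \<beta>) differentiable (at y)" if "y \<in> S" for \<alpha> \<beta> y
    by (rule smooth_on_differentiable[OF smHp that])
  define Mb where "Mb y = dzb_mat a (\<lambda>y. H (p y)) y" for y
  have smMb: "smooth_on S (\<lambda>y. Mb y $ \<alpha> $ \<beta>)" for \<alpha> \<beta>
    using smooth_on_dzb[OF S smHp] by (simp add: Mb_def dzb_mat_def)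
  have dMb: "(\<lambda>y. Mb y $ \<alpha> $ \<beta>) differentiable (at y)" if "y \<in> S" for \<alpha> \<beta> y
    by (rule smooth_on_differentiable[OF smMb that])
  have dzbG: "dzb a (\<lambda>y. sesq (G y) v w) y = sesq (Mb y) (J y v) (J y w) + sesq (H (p y)) (J y v) (dz_vec a (\<lambda>y. J y w) y)"
    if "y \<in> S" for v w y
  proof -
    have "dzb a (\<lambda>y. sesq (G y) v w) y = dzb a (\<lambda>y. sesq (H (p y)) (J y v) (J y w)) y"
      by (rule dzb_cong_open[OF S that G])
    also have "\<dots> = sesq (Mb y) (J y v) (J y w) + sesq (H (p y)) (J y v) (dz_vec a (\<lambda>y. J y w) y)"
      by (subst dz_sesq(2)) (simp_all add: dHp that nth[OF holJ] holomorphic_dz_vec(2)[OF holJ that] Mb_def)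
    finally show ?thesis .
  qed
  have dzG: "dz b (\<lambda>y. sesq (G y) v w) z = sesq (dz_mat b (\<lambda>y. H (p y)) z) (J z v) (J z w) + sesq (H (p z)) (dz_vec b (\<lambda>y. J y v) z) (J z w)"
    for v w
  proof -
    have "dz b (\<lambda>y. sesq (G y) v w) z = dz b (\<lambda>y. sesq (H (p y)) (J y v) (J y w)) z"
      by (rule dz_cong_open[OF S z G])
    also have "\<dots> = sesq (dz_mat b (\<lambda>y. H (p y)) z) (J z v) (J z w) + sesq (H (p z)) (dz_vec b (\<lambda>y. J y v) z) (J z w)"
      by (subst dz_sesq(1)) (simp_all add: dHp z nth[OF holJ] holomorphic_dz_vec(2)[OF holJ z])
    finally show ?thesis .
  qed
  have dzdzbG: "dz b (dzb a (\<lambda>y. sesq (G y) c d)) z =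
      sesq (dz_mat b Mb z) (J z c) (J z d) + sesq (Mb z) (dz_vec b (\<lambda>y. J y c) z) (J z d) +
      (sesq (dz_mat b (\<lambda>y. H (p y)) z) (J z c) (dz_vec a (\<lambda>y. J y d) z) +
       sesq (H (p z)) (dz_vec b (\<lambda>y. J y c) z) (dz_vec a (\<lambda>y. J y d) z))"
  proof -
    have "dz b (dzb a (\<lambda>y. sesq (G y) c d)) z =
      dz b (\<lambda>y. sesq (Mb y) (J y c) (J y d) + sesq (H (p y)) (J y c) (dz_vec a (\<lambda>y. J y d) y)) z"
      by (rule dz_cong_open[OF S z dzbG])
    also have "\<dots> = dz b (\<lambda>y. sesq (Mb y) (J y c) (J y d)) z + dz b (\<lambda>y. sesq (H (p y)) (J y c) (dz_vec a (\<lambda>y. J y d) y)) z"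
      by (intro dz_add sesq_differentiable dMb[OF z] dHp[OF z] nth[OF holJ z] nth[OF holQ z])
    also have "dz b (\<lambda>y. sesq (Mb y) (J y c) (J y d)) z =
        sesq (dz_mat b Mb z) (J z c) (J z d) + sesq (Mb z) (dz_vec b (\<lambda>y. J y c) z) (J z d)"
      by (subst dz_sesq(1)) (simp_all add: dMb[OF z] nth[OF holJ z] holomorphic_dz_vec(2)[OF holJ z])
    also have "dz b (\<lambda>y. sesq (H (p y)) (J y c) (dz_vec a (\<lambda>y. J y d) y)) z =
       sesq (dz_mat b (\<lambda>y. H (p y)) z) (J z c) (dz_vec a (\<lambda>y. J y d) z) +
       sesq (H (p z)) (dz_vec b (\<lambda>y. J y c) z) (dz_vec a (\<lambda>y. J y d) z)"
      by (subst dz_sesq(1)) (simp_all add: dHp[OF z] nth[OF holJ z] nth[OF holQ z] holomorphic_dz_vec(2)[OF holQ z])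
    finally show ?thesis .
  qed
  have M1: "dz_mat b (\<lambda>y. H (p y)) z = dz_mat (J z b) H (p z)" and M2: "Mb z = dzb_mat (J z a) H (p z)"
    and M3: "dz_mat b Mb z = dz_mat (J z b) (dzb_mat (J z a) H) (p z)"
  proof -
    note 1 = dz_compose_holomorphic[OF hol z]
    show "dz_mat b (\<lambda>y. H (p y)) z = dz_mat (J z b) H (p z)" "Mb z = dzb_mat (J z a) H (p z)"
      by (simp_all add: Mb_def dz_mat_def dzb_mat_def vec_eq_iff 1[OF dfH[OF z]] J_def)
    have "dz b (\<lambda>y. dzb a (\<lambda>x. H (p x) $ i $ j) y) z = dz (J z b) (\<lambda>y. dzb (J z a) (\<lambda>x. H x $ i $ j) y) (p z)" for i j
      using dz_dzb_compose_holomorphic[OF S T hol pS smH z, of b a] by (simp add: J_def)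
    then show "dz_mat b Mb z = dz_mat (J z b) (dzb_mat (J z a) H) (p z)"
      by (simp add: Mb_def[abs_def] dz_mat_def dzb_mat_def vec_eq_iff)
  qed
  obtain w where w: "\<And>e. sesq (H (p z)) w e = dz (J z b) (\<lambda>y. sesq (H y) (J z c) e) (p z)"
    using ex_connection[of H "p z" "J z b" "J z c"] pdH dfH[OF z] by blast
  then have w': "\<And>e. sesq (H (p z)) w e = sesq (dz_mat (J z b) H (p z)) (J z c) e"
    by (simp add: dz_sesq_const dfH[OF z])
  \<comment> \<open>\<open>w2\<close> is the connection vector of \<open>G\<close>: its image under
    the Jacobian is that of \<open>H\<close> plus the derivative of the Jacobian. Surjectivity
    provides it.\<close>
  obtain w2 where w2: "J z w2 = w + dz_vec b (\<lambda>y. J y c) z" using surj by (metis surjD)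
  have "curvature4 G z b a c d = - dz b (dzb a (\<lambda>y. sesq (G y) c d)) z + dzb a (\<lambda>y. sesq (G y) w2 d) z"
    by (rule curvature4_eq[OF S z smG pdG]) (simp add: G[OF z] w2 dzG M1 sesq_add_left w')
  also have "\<dots> = - sesq (dz_mat (J z b) (dzb_mat (J z a) H) (p z)) (J z c) (J z d) + sesq (dzb_mat (J z a) H (p z)) w (J z d)"
    unfolding dzdzbG dzbG[OF z] M1 M2 M3 w2 by (simp add: sesq_add_left w')
  also have "\<dots> = - dz (J z b) (dzb (J z a) (\<lambda>y. sesq (H y) (J z c) (J z d))) (p z) + dzb (J z a) (\<lambda>y. sesq (H y) w (J z d)) (p z)"
  proof -
    have dT: "(\<lambda>y. H y $ \<alpha> $ \<beta>) differentiable (at x)" if "x \<in> T" for x \<alpha> \<beta>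
      by (rule smooth_on_differentiable[OF smH that])
    have dT2: "(\<lambda>y. dzb_mat (J z a) H y $ \<alpha> $ \<beta>) differentiable (at (p z))" for \<alpha> \<beta>
      using smooth_on_differentiable[OF smooth_on_dzb[OF T smH] pz] by (simp add: dzb_mat_def)
    have "dz (J z b) (dzb (J z a) (\<lambda>y. sesq (H y) (J z c) (J z d))) (p z) =
        dz (J z b) (\<lambda>y. sesq (dzb_mat (J z a) H y) (J z c) (J z d)) (p z)"
      by (rule dz_cong_open[OF T pz]) (simp add: dz_sesq_const dT)
    also have "\<dots> = sesq (dz_mat (J z b) (dzb_mat (J z a) H) (p z)) (J z c) (J z d)"
      by (simp add: dz_sesq_const dT2)
    finally show ?thesis by (simp add: dz_sesq_const dfH[OF z])
  qed
  also have "\<dots> = curvature4 H (p z) (J z b) (J z a) (J z c) (J z d)"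
    by (rule curvature4_eq[OF T pz smH pdH w, symmetric])
  finally show ?thesis .
qed

section \<open>Local Hermitian and Kaehler metrics\<close>

lemma curvature4_add:
  "curvature4 H z (b + b') a c d = curvature4 H z b a c d + curvature4 H z b' a c d"
  "curvature4 H z b (a + a') c d = curvature4 H z b a c d + curvature4 H z b a' c d"
  "curvature4 H z b a (c + c') d = curvature4 H z b a c d + curvature4 H z b a c' d"
  "curvature4 H z b a c (d + d') = curvature4 H z b a c d + curvature4 H z b a c d'"
  by (simp_all add: curvature4_def sesq_add_left sesq_add_right distrib_left distrib_right sum.distrib)

lemma curvature4_smult:
  "curvature4 H z (k *s b) a c d = k * curvature4 H z b a c d"
  "curvature4 H z b (k *s a) c d = cnj k * curvature4 H z b a c d"
  "curvature4 H z b a (k *s c) d = k * curvature4 H z b a c d"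
  "curvature4 H z b a c (k *s d) = cnj k * curvature4 H z b a c d"
  by (simp_all add: curvature4_def sesq_smult_left sesq_smult_right sum_distrib_left mult_ac)

lemma curvature4_zero [simp]: "curvature4 H z 0 a c d = 0" "curvature4 H z b 0 c d = 0" "curvature4 H z b a 0 d = 0" "curvature4 H z b a c 0 = 0"
  by (simp_all add: curvature4_def)

lemma matrix_inv_unique: "A ** B = mat 1 \<Longrightarrow> matrix_inv A = (B :: 'a::field^'n^'n)"
proof -
  assume a: "A ** B = mat 1"
  then have "invertible A" using invertible_right_inverse by blast
  then have "matrix_inv A ** (A ** B) = B" by (simp add: matrix_mul_assoc matrix_inv_inverse)
  then show ?thesis by (simp add: a)
qed

lemma det2_nonzero: "invertible (A :: complex^2^2) \<Longrightarrow> A $ 1 $ 1 * A $ 2 $ 2 - A $ 1 $ 2 * A $ 2 $ 1 \<noteq> 0"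
  using invertible_det_nz[of A] by (simp add: det_2)

lemma matrix_inv_2:
  fixes A :: "complex^2^2"
  assumes "invertible A"
  shows "matrix_inv A = (\<chi> i j. (if i = j then A $ (if i = 1 then 2 else 1) $ (if i = 1 then 2 else 1) else - A $ i $ j)
      * inverse (A $ 1 $ 1 * A $ 2 $ 2 - A $ 1 $ 2 * A $ 2 $ 1))"
proof -
  define k where "k = inverse (A $ 1 $ 1 * A $ 2 $ 2 - A $ 1 $ 2 * A $ 2 $ 1)"
  have "(A $ 1 $ 1 * A $ 2 $ 2 - A $ 1 $ 2 * A $ 2 $ 1) * k = 1"
    using det2_nonzero[OF assms] by (simp add: k_def)
  then show ?thesis unfolding k_def[symmetric]
    by (intro matrix_inv_unique)
       (simp add: vec_eq_iff matrix_matrix_mult_def sum_2 forall_2 mat_def algebra_simps)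
qed

text \<open>The explicit 2 by 2 formula reduces smoothness of the inverse matrix to that of
  \<open>inverse\<close> on nonzero numbers.\<close>

lemma smooth_on_matrix_inv:
  fixes H :: "complex^'n \<Rightarrow> complex^2^2"
  assumes S: "open S" and sm: "\<And>i j. smooth_on S (\<lambda>y. H y $ i $ j)" and inv: "\<And>y. y \<in> S \<Longrightarrow> invertible (H y)"
  shows "smooth_on S (\<lambda>y. matrix_inv (H y) $ i $ j)"
proof (rule smooth_on_cong[OF S])
  let ?d = "\<lambda>y. H y $ 1 $ 1 * H y $ 2 $ 2 - H y $ 1 $ 2 * H y $ 2 $ 1"
  have d: "smooth_on S ?d" by (intro smooth_on_diff smooth_on_mult S sm)
  have "smooth_on S (\<lambda>y. inverse (?d y))"
    by (rule smooth_on_compose[OF S _ _ smooth_on_inverse d]) (use det2_nonzero[OF inv] in \<open>auto simp: open_Compl\<close>)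
  moreover have "smooth_on S (\<lambda>y. if i = j then H y $ (if i = 1 then 2 else 1) $ (if i = 1 then 2 else 1) else - H y $ i $ j)"
    by (cases "i = j") (simp_all add: sm smooth_on_minus S)
  ultimately show "smooth_on S (\<lambda>y. (if i = j then H y $ (if i = 1 then 2 else 1) $ (if i = 1 then 2 else 1) else - H y $ i $ j) * inverse (?d y))"
    by (intro smooth_on_mult S)
  show "(if i = j then H y $ (if i = 1 then 2 else 1) $ (if i = 1 then 2 else 1) else - H y $ i $ j) * inverse (?d y)
      = matrix_inv (H y) $ i $ j" if "y \<in> S" for y
    by (simp add: matrix_inv_2[OF inv[OF that]])
qed

locale local_hermitian =
  fixes S :: "(complex^2) set" and H :: "complex^2 \<Rightarrow> complex^2^2"
  assumes S: "open S" and sm: "\<And>\<alpha> \<beta>. smooth_on S (\<lambda>y. H y $ \<alpha> $ \<beta>)"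
    and pd: "\<And>y. y \<in> S \<Longrightarrow> hermitian_posdef (H y)"
begin

abbreviation h where "h b c \<equiv> \<lambda>y. sesq (H y) b c"

text \<open>The Chern connection on constant sections. The explicit formula makes it visibly smooth
  in \<open>y\<close>; later use goes through its pairings with the metric.\<close>

definition \<Gamma> :: "complex^2 \<Rightarrow> complex^2 \<Rightarrow> complex^2 \<Rightarrow> complex^2" where
  "\<Gamma> b c y = c v* dz_mat b H y v* matrix_inv (H y)"

lemma df: "y \<in> S \<Longrightarrow> (\<lambda>y. H y $ \<alpha> $ \<beta>) differentiable (at y)"
  by (rule smooth_on_differentiable[OF sm])

lemma smooth_h: "smooth_on S (h b c)"
  unfolding sesq_def by (intro smooth_on_sum smooth_on_mult smooth_on_const S sm)

lemma h_differentiable: "y \<in> S \<Longrightarrow> h b c differentiable (at y)"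
  by (rule smooth_on_differentiable[OF smooth_h])

lemma \<Gamma>: "y \<in> S \<Longrightarrow> sesq (H y) (\<Gamma> b c y) e = dz b (h c e) y"
  using matrix_inv_inverse(2)[OF hermitian_posdef_invertible[OF pd]]
  by (simp add: \<Gamma>_def sesq_mult[symmetric] matrix_mul_assoc[symmetric] dz_sesq_const df)

lemma \<Gamma>_eqI:
  assumes "y \<in> S" "\<And>e. sesq (H y) w e = dz b (h c e) y"
  shows "\<Gamma> b c y = w"
  by (rule hermitian_posdef_cancel[OF pd[OF assms(1)]]) (simp only: \<Gamma>[OF assms(1)] assms(2))

lemma smooth_\<Gamma>: "smooth_on S (\<lambda>y. \<Gamma> b c y $ i)"
  unfolding \<Gamma>_def vector_matrix_mult_def
  by (simp add: dz_mat_def)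
     (intro smooth_on_sum smooth_on_mult smooth_on_const S smooth_on_dz sm smooth_on_matrix_inv
       hermitian_posdef_invertible pd)

lemma \<Gamma>_differentiable: "y \<in> S \<Longrightarrow> (\<lambda>y. \<Gamma> b c y $ i) differentiable (at y)"
  by (rule smooth_on_differentiable[OF smooth_\<Gamma>])

lemma dzb_h: "y \<in> S \<Longrightarrow> dzb a (h b c) y = cnj (dz a (h c b) y)"
proof -
  assume y: "y \<in> S"
  have "dzb a (h b c) y = dzb a (\<lambda>y. cnj (h c b y)) y"
    by (rule dzb_cong_open[OF S y]) (simp add: hermitian_posdef_cnj pd)
  also have "\<dots> = cnj (dz a (h c b) y)" by (rule dzb_cnj) (rule h_differentiable[OF y])+
  finally show ?thesis .
qed

lemma dzb_h_\<Gamma>: "y \<in> S \<Longrightarrow> dzb a (h b c) y = sesq (H y) b (\<Gamma> a c y)"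
  by (simp add: dzb_h \<Gamma>[symmetric] hermitian_posdef_cnj pd)

lemma curvature4_\<Gamma>: "z \<in> S \<Longrightarrow> curvature4 H z b a c d = - dz b (dzb a (h c d)) z + sesq (H z) (\<Gamma> b c z) (\<Gamma> a d z)"
  by (subst curvature4_eq[OF S _ sm pd, of z "\<Gamma> b c z"]) (simp_all add: \<Gamma> dzb_h_\<Gamma>)

lemma curvature4_cnj: "z \<in> S \<Longrightarrow> cnj (curvature4 H z b a c d) = curvature4 H z a b d c"
proof -
  assume z: "z \<in> S"
  have sb: "smooth_on S (dzb a (h c d))" by (rule smooth_on_dzb[OF S smooth_h])
  have "cnj (dz b (dzb a (h c d)) z) = dzb b (\<lambda>y. cnj (dzb a (h c d) y)) z"
    by (rule dzb_cnj[symmetric]) (rule smooth_on_differentiable[OF sb z])+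
  also have "\<dots> = dzb b (dz a (h d c)) z"
    by (rule dzb_cong_open[OF S z]) (simp add: dzb_h)
  also have "\<dots> = dz a (dzb b (h d c)) z" by (rule dz_dzb_commute[OF S smooth_h z, symmetric])
  finally show ?thesis by (simp add: curvature4_\<Gamma> z hermitian_posdef_cnj pd)
qed

text \<open>The vector on the left is the iterated covariant derivative of \<open>c\<close>, along
  \<open>b\<close> and then along \<open>a\<close>. As the derivatives on the right commute, the
  curvature has no (2,0) part.\<close>

lemma \<Gamma>_dz_vec: "z \<in> S \<Longrightarrow> sesq (H z) (dz_vec a (\<Gamma> b c) z + \<Gamma> a (\<Gamma> b c z) z) d = dz a (dz b (h c d)) z"
proof -
  assume z: "z \<in> S"
  have "dz a (dz b (h c d)) z = dz a (\<lambda>y. sesq (H y) (\<Gamma> b c y) d) z"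
    by (rule dz_cong_open[OF S z]) (simp add: \<Gamma>)
  also have "\<dots> = sesq (dz_mat a H z) (\<Gamma> b c z) d + sesq (H z) (dz_vec a (\<Gamma> b c) z) d"
    by (subst dz_sesq(1)) (simp_all add: df z \<Gamma>_differentiable, simp add: dzb_vec_def flip: zero_vec_def)
  finally show ?thesis by (simp add: sesq_add_left \<Gamma> z dz_sesq_const df)
qed

text \<open>Differentiating the pairing of \<open>\<Gamma> b c\<close> with \<open>d\<close>
  antiholomorphically produces this term and the quadratic term of the curvature, so the curvature
  is minus the antiholomorphic derivative of the connection.\<close>

lemma \<Gamma>_dzb_vec: "z \<in> S \<Longrightarrow> sesq (H z) (dzb_vec a (\<Gamma> b c) z) d = - curvature4 H z b a c d"
proof -
  assume z: "z \<in> S"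
  have "dzb a (dz b (h c d)) z = dzb a (\<lambda>y. sesq (H y) (\<Gamma> b c y) d) z"
    by (rule dzb_cong_open[OF S z]) (simp add: \<Gamma>)
  also have "\<dots> = sesq (dzb_mat a H z) (\<Gamma> b c z) d + sesq (H z) (dzb_vec a (\<Gamma> b c) z) d"
    by (subst dz_sesq(2)) (simp_all add: df z \<Gamma>_differentiable, simp add: dz_vec_def flip: zero_vec_def)
  finally have "dzb a (dz b (h c d)) z = sesq (H z) (\<Gamma> b c z) (\<Gamma> a d z) + sesq (H z) (dzb_vec a (\<Gamma> b c) z) d"
    by (simp add: dz_sesq_const(2)[OF df[OF z], symmetric] dzb_h_\<Gamma> z)
  then show ?thesis by (simp add: curvature4_\<Gamma> z dz_dzb_commute[OF S smooth_h z])
qed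

end

text \<open>This is \<open>det H\<close> times the trace of \<open>P\<close> with respect to \<open>H\<close>, without a division.\<close>

definition mixed_disc :: "complex^2^2 \<Rightarrow> complex^2^2 \<Rightarrow> complex" where
  "mixed_disc H P = H $ 2 $ 2 * P $ 1 $ 1 + H $ 1 $ 1 * P $ 2 $ 2 - H $ 2 $ 1 * P $ 1 $ 2 - H $ 1 $ 2 * P $ 2 $ 1"

definition curvature_mat :: "(complex^2 \<Rightarrow> complex^2^2) \<Rightarrow> complex^2 \<Rightarrow> complex^2 \<Rightarrow> complex^2 \<Rightarrow> complex^2^2" where
  "curvature_mat H z b a = (\<chi> \<alpha> \<beta>. curvature4 H z b a (axis \<alpha> 1) (axis \<beta> 1))"

text \<open>\<open>sym\<close> says that the (2,1) part of the exterior derivative of the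
  fundamental form vanishes; equivalently, the Chern connection has no torsion.\<close>

locale local_kaehler = local_hermitian +
  assumes sym: "\<And>y a b c. y \<in> S \<Longrightarrow> dz a (\<lambda>y. sesq (H y) b c) y = dz b (\<lambda>y. sesq (H y) a c) y"
begin

lemma \<Gamma>_commute: "y \<in> S \<Longrightarrow> \<Gamma> b c y = \<Gamma> c b y"
  by (rule \<Gamma>_eqI) (simp_all add: \<Gamma> sym[of _ b])

lemma curvature4_sym: "z \<in> S \<Longrightarrow> curvature4 H z b a c d = curvature4 H z c a b d"
proof -
  assume z: "z \<in> S"
  have "dzb_vec a (\<Gamma> b c) z = dzb_vec a (\<Gamma> c b) z"
    unfolding dzb_vec_def vec_eq_iff by (auto intro!: dzb_cong_open[OF S z] simp: \<Gamma>_commute[of _ b c])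
  then show ?thesis using \<Gamma>_dzb_vec[OF z, of a b c d] \<Gamma>_dzb_vec[OF z, of a c b d] by simp
qed

lemma curvature4_sym': "z \<in> S \<Longrightarrow> curvature4 H z b a c d = curvature4 H z b d c a"
  by (metis curvature4_cnj curvature4_sym complex_cnj_cnj)

end

lemma frechet_Re: "f differentiable (at z) \<Longrightarrow> frechet_derivative (\<lambda>y. Re (f y)) (at z) v = Re (frechet_derivative f (at z) v)"
  by (rule fun_cong[OF frechet_derivative_eq]) (auto intro!: bounded_linear.has_derivative[OF bounded_linear_Re] simp: frechet_derivative_works)

context local_hermitian
begin

lemma dz_h_linear:
  assumes "y \<in> S"
  shows "dz (k *s a) (h b c) y = k * dz a (h b c) y" "dz a (h (k *s b) c) y = k * dz a (h b c) y"
    "dz a (h b (k *s c)) y = cnj k * dz a (h b c) y"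
  by (simp_all add: dz_dir_smult[OF h_differentiable h_differentiable] assms sesq_smult_left sesq_smult_right
    dz_cmult h_differentiable)

lemma closed_imp_kaehler:
  assumes "\<And>z u v w. z \<in> S \<Longrightarrow> exterior_derivative2 (fundamental_form H) z u v w = 0"
  shows "local_kaehler S H"
proof
  fix z a b c assume z: "z \<in> S"
  \<comment> \<open>Up to a constant, the (2,1) part of the exterior derivative: linear in the first
    two arguments, antilinear in the third.\<close>
  define \<beta> where "\<beta> u v w = dz u (h v w) z - dz v (h u w) z" for u v w
  have fd: "frechet_derivative (\<lambda>y. fundamental_form H y v w) (at z) u = - Im (dz u (h v w) z + cnj (dz u (h w v) z))" for u v w
  proof -
    have "((\<lambda>y. - Im (h v w y)) has_derivative (\<lambda>u. - Im (frechet_derivative (h v w) (at z) u))) (at z)"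
      by (intro has_derivative_minus bounded_linear.has_derivative[OF bounded_linear_Im])
         (use h_differentiable[OF z] in \<open>simp add: frechet_derivative_works\<close>)
    from frechet_derivative_eq[OF this] show ?thesis
      by (simp add: fundamental_form_def[abs_def] frechet_dz_dzb dzb_h[OF z])
  qed
  have im: "Im (\<beta> u v w - \<beta> u w v + \<beta> v w u) = 0" for u v w
    using assms[OF z, of u v w] unfolding exterior_derivative2_def fd \<beta>_def by simp
  have lin: "\<beta> (k *s u) (l *s v) (m *s w) = k * l * cnj m * \<beta> u v w" for k l m u v w
    by (simp add: \<beta>_def dz_h_linear[OF z] algebra_simps)
  have lin1: "\<beta> (k *s u) v w = k * \<beta> u v w" "\<beta> u (k *s v) w = k * \<beta> u v w"
    "\<beta> u v (k *s w) = cnj k * \<beta> u v w" for k u v w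
    using lin[of k u 1 v 1 w] lin[of 1 u k v 1 w] lin[of 1 u 1 v k w] by simp_all
  \<comment> \<open>Multiplying \<open>u\<close> and \<open>v\<close> by \<open>i\<close> reverses
    the first term of \<open>im\<close> and fixes the other two, where one of these vectors stands
    in the antilinear slot. Multiplying the third argument by \<open>i\<close> then gives the real
    part.\<close>
  have "Im (\<beta> u v w) = 0" for u v w
    using im[of u v w] im[of "\<i> *s u" "\<i> *s v" w] by (simp add: lin1)
  from this[of a b c] this[of a b "\<i> *s c"] have "\<beta> a b c = 0"
    by (simp add: lin1 complex_eq_iff)
  then show "dz a (h b c) z = dz b (h a c) z" by (simp add: \<beta>_def)
qed

end

lemma sesq_axis: "sesq H (axis \<alpha> 1) (axis \<beta> 1) = H $ \<alpha> $ \<beta>"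
proof -
  have "(\<Sum>j\<in>UNIV. H $ i $ j * axis \<alpha> 1 $ i * cnj (axis \<beta> 1 $ j)) = (if i = \<alpha> then H $ i $ \<beta> else 0)" for i
  proof -
    have "H $ i $ j * axis \<alpha> 1 $ i * cnj (axis \<beta> 1 $ j) = (if j = \<beta> then (if i = \<alpha> then H $ i $ j else 0) else 0)" for j
      by (simp add: axis_def)
    then show ?thesis by simp
  qed
  then show ?thesis by (simp add: sesq_def)
qed

lemma sesq_2: "sesq (H :: complex^2^2) v w =
   H $ 1 $ 1 * v $ 1 * cnj (w $ 1) + H $ 1 $ 2 * v $ 1 * cnj (w $ 2) +
   H $ 2 $ 1 * v $ 2 * cnj (w $ 1) + H $ 2 $ 2 * v $ 2 * cnj (w $ 2)"
  by (simp add: sesq_def sum_2)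

lemma vec2_expand: "(v :: complex^2) = v $ 1 *s axis 1 1 + v $ 2 *s axis 2 1"
  by (simp add: vec_eq_iff forall_2 axis_def)

lemma sesq_eq_matrix:
  fixes f :: "complex^2 \<Rightarrow> complex^2 \<Rightarrow> complex"
  assumes "\<And>u v w. f (u + v) w = f u w + f v w" "\<And>u v w. f u (v + w) = f u v + f u w"
    "\<And>k u v. f (k *s u) v = k * f u v" "\<And>k u v. f u (k *s v) = cnj k * f u v"
  shows "sesq (\<chi> \<alpha> \<beta>. f (axis \<alpha> 1) (axis \<beta> 1)) u v = f u v"
  by (subst (2) vec2_expand[of u], subst (2) vec2_expand[of v])
     (simp only: assms sesq_2, simp add: algebra_simps)

lemma curvature_mat: "sesq (curvature_mat H z b a) c d = curvature4 H z b a c d"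
  unfolding curvature_mat_def by (rule sesq_eq_matrix) (simp_all add: curvature4_add curvature4_smult)

text \<open>The polarised determinant scales like the determinant itself. As the factor is the
  squared modulus of the frame determinant, the sign of a trace is independent of the frame.\<close>

lemma mixed_disc_pullback:
  fixes x :: "2 \<Rightarrow> complex^2"
  shows "mixed_disc (\<chi> \<alpha> \<beta>. sesq H (x \<alpha>) (x \<beta>)) (\<chi> \<alpha> \<beta>. sesq P (x \<alpha>) (x \<beta>)) =
    of_real ((cmod (x 1 $ 1 * x 2 $ 2 - x 1 $ 2 * x 2 $ 1))\<^sup>2) * mixed_disc H P"
  unfolding complex_norm_square
  by (simp add: mixed_disc_def sesq_2 algebra_simps)

lemma hermitian_posdef_2:
  fixes H :: "complex^2^2"
  assumes "hermitian_posdef H"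
  shows "H $ 2 $ 2 = of_real (Re (H $ 2 $ 2))" "0 < Re (H $ 2 $ 2)" "H $ 1 $ 1 = of_real (Re (H $ 1 $ 1))"
    "H $ 2 $ 1 = cnj (H $ 1 $ 2)"
    "0 < Re (H $ 1 $ 1) * Re (H $ 2 $ 2) - (cmod (H $ 1 $ 2))\<^sup>2"
proof -
  have c: "cnj (H $ \<alpha> $ \<beta>) = H $ \<beta> $ \<alpha>" for \<alpha> \<beta> using assms unfolding hermitian_posdef_def by metis
  show 1: "H $ 2 $ 2 = of_real (Re (H $ 2 $ 2))" and 3: "H $ 1 $ 1 = of_real (Re (H $ 1 $ 1))"
    using c[of 2 2] c[of 1 1] by (simp_all add: complex_eq_iff)
  show 4: "H $ 2 $ 1 = cnj (H $ 1 $ 2)" by (simp add: c)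
  have "0 < Re (sesq H (axis 2 1) (axis 2 1))"
    by (rule hermitian_posdef_pos[OF assms]) (simp add: axis_eq_0_iff)
  then show 2: "0 < Re (H $ 2 $ 2)" by (simp add: sesq_axis)
  \<comment> \<open>\<open>?u\<close> is \<open>H $ 2 $ 2\<close> times the component of the first
    axis vector orthogonal to the second, so its squared length is \<open>H $ 2 $ 2\<close> times
    the determinant.\<close>
  let ?u = "(\<chi> i. if i = 1 then H $ 2 $ 2 else - H $ 1 $ 2) :: complex^2"
  have "H $ 2 $ 2 \<noteq> 0" using 2 by auto
  then have "?u \<noteq> 0" by (auto simp: vec_eq_iff forall_2)
  from hermitian_posdef_pos[OF assms this]
  have "0 < Re (sesq H ?u ?u)" .
  also have "sesq H ?u ?u = of_real (Re (H $ 2 $ 2) * (Re (H $ 1 $ 1) * Re (H $ 2 $ 2) - (cmod (H $ 1 $ 2))\<^sup>2))"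
    unfolding of_real_mult of_real_diff complex_norm_square 1[symmetric] 3[symmetric]
    by (simp add: sesq_2 c algebra_simps)
  finally show "0 < Re (H $ 1 $ 1) * Re (H $ 2 $ 2) - (cmod (H $ 1 $ 2))\<^sup>2"
    using 2 by (simp add: zero_less_mult_iff)
qed

text \<open>The cofactor matrix of \<open>H\<close> is a positive combination of two squares.\<close>

lemma mixed_disc_squares:
  fixes H P :: "complex^2^2"
  assumes "hermitian_posdef H"
  defines "u \<equiv> (\<chi> i. if i = 1 then H $ 2 $ 2 else - H $ 1 $ 2) :: complex^2"
  shows "Re (H $ 2 $ 2) * Re (mixed_disc H P) =
    Re (sesq P u u) + (Re (H $ 1 $ 1) * Re (H $ 2 $ 2) - (cmod (H $ 1 $ 2))\<^sup>2) * Re (P $ 2 $ 2)"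
proof -
  note h = hermitian_posdef_2[OF assms(1)]
  have c2: "cnj (H $ 2 $ 2) = H $ 2 $ 2" using h(1) by (metis complex_cnj_complex_of_real)
  have "of_real (Re (H $ 2 $ 2)) * mixed_disc H P =
    sesq P u u + of_real (Re (H $ 1 $ 1) * Re (H $ 2 $ 2) - (cmod (H $ 1 $ 2))\<^sup>2) * P $ 2 $ 2"
    unfolding of_real_mult of_real_diff complex_norm_square h(1)[symmetric] h(3)[symmetric]
    by (simp add: sesq_2 mixed_disc_def u_def h(4) c2 algebra_simps)
  then have "Re (of_real (Re (H $ 2 $ 2)) * mixed_disc H P) =
    Re (sesq P u u + of_real (Re (H $ 1 $ 1) * Re (H $ 2 $ 2) - (cmod (H $ 1 $ 2))\<^sup>2) * P $ 2 $ 2)"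
    by (rule arg_cong)
  then show ?thesis by (simp only: Re_complex_of_real times_complex.sel Im_complex_of_real mult_zero_left diff_zero plus_complex.sel)
qed

text \<open>If no direction were positive, both squares in the decomposition of the cofactor matrix
  would contribute nonpositively.\<close>

lemma mixed_disc_pos_imp:
  assumes "hermitian_posdef H" "0 < Re (mixed_disc H P)"
  shows "\<exists>u. 0 < Re (sesq P u u)"
proof (rule ccontr)
  assume "\<not> ?thesis"
  then have n: "Re (sesq P u u) \<le> 0" for u using not_less by blast
  note h = hermitian_posdef_2[OF assms(1)]
  have "0 < Re (H $ 2 $ 2) * Re (mixed_disc H P)" using h(2) assms(2) by simp
  moreover have "Re (P $ 2 $ 2) \<le> 0" using n[of "axis 2 1"] by (simp add: sesq_axis)
  ultimately show False
    unfolding mixed_disc_squares[OF assms(1)] using n h(5) by (smt (verit) mult_nonneg_nonpos)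
qed

text \<open>The rank-one form is that of a gradient, so this is the ellipticity on which Hopf's
  barrier rests. If \<open>\<xi> $ 2\<close> vanishes, the first square of the decomposition is
  positive, otherwise the second.\<close>

lemma mixed_disc_rank_one_pos:
  assumes "hermitian_posdef H" "\<xi> \<noteq> (0 :: complex^2)"
  shows "0 < Re (mixed_disc H (\<chi> \<alpha> \<beta>. \<xi> $ \<alpha> * cnj (\<xi> $ \<beta>)))"
proof -
  note h = hermitian_posdef_2[OF assms(1)]
  let ?P = "(\<chi> \<alpha> \<beta>. \<xi> $ \<alpha> * cnj (\<xi> $ \<beta>)) :: complex^2^2"
  have s: "sesq ?P u u = of_real ((cmod (\<xi> $ 1 * u $ 1 + \<xi> $ 2 * u $ 2))\<^sup>2)" for u
    unfolding complex_norm_square by (simp add: sesq_2 algebra_simps)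
  have "0 < Re (H $ 2 $ 2) * Re (mixed_disc H ?P)"
  proof (cases "\<xi> $ 2 = 0")
    case True
    then have "\<xi> $ 1 \<noteq> 0" using assms(2) by (auto simp: vec_eq_iff forall_2)
    moreover have "H $ 2 $ 2 \<noteq> 0" using h(2) by auto
    ultimately show ?thesis unfolding mixed_disc_squares[OF assms(1)] s using True by simp
  next
    case False
    then have "0 < Re (?P $ 2 $ 2)" by (simp add: complex_norm_square[symmetric])
    then show ?thesis unfolding mixed_disc_squares[OF assms(1)] s Re_complex_of_real
      using h(5) by (intro add_nonneg_pos mult_pos_pos) auto
  qed
  then show ?thesis using h(2) by (simp add: zero_less_mult_iff)
qed

lemma Basis_complex2: "(Basis :: (complex^2) set) = {axis 1 1, axis 1 \<i>, axis 2 1, axis 2 \<i>}"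
  by (auto simp: Basis_vec_def Basis_complex_def UNIV_2)

lemma sum_Basis_complex2:
  fixes f :: "complex^2 \<Rightarrow> real"
  shows "sum f Basis = f (axis 1 1) + f (\<i> *s axis 1 1) + f (axis 2 1) + f (\<i> *s axis 2 1)"
  by (simp add: Basis_complex2 axis_eq_axis smult_axis complex_eq_iff)

lemma inner_vec_axis: "x \<bullet> axis i 1 = Re (x $ i)" "x \<bullet> (\<i> *s axis i 1) = Im ((x :: complex^'n) $ i)"
  by (simp_all add: smult_axis inner_axis inner_complex_def)

lemma frechet_vec:
  fixes g :: "complex^'n \<Rightarrow> complex^'m"
  assumes "\<And>i. (\<lambda>y. g y $ i) differentiable (at z)"
  shows "frechet_derivative g (at z) v = dz_vec v g z + dzb_vec v g z"
proof -
  have "(g has_derivative (\<lambda>v. \<chi> i. frechet_derivative (\<lambda>y. g y $ i) (at z) v)) (at z)"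
    by (rule has_derivative_vec_componentwise) (use assms in \<open>simp add: frechet_derivative_works\<close>)
  then show ?thesis by (simp add: frechet_derivative_eq dz_vec_def dzb_vec_def vec_eq_iff frechet_dz_dzb)
qed

section \<open>Riemannian curvature of a Kaehler metric through the Chern connection\<close>

context local_kaehler
begin

abbreviation g where "g \<equiv> riemannian_metric H"

lemma frechet_g: "y \<in> S \<Longrightarrow> frechet_derivative (\<lambda>y. g y b c) (at y) a = Re (dz a (h b c) y) + Re (dz a (h c b) y)"
  using frechet_Re[OF h_differentiable, of y b c a] dzb_h[of y a b c]
  by (simp add: riemannian_metric_def frechet_dz_dzb)

text \<open>By the Kaehler condition the Koszul formula collapses to twice the real part of the
  Chern pairing, so Levi-Civita and Chern connection agree. For uniqueness, a competitor
  \<open>w\<close> is tested against \<open>w - \<Gamma> a b y\<close>.\<close>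

lemma christoffel_eq:
  assumes y: "y \<in> S"
  shows "christoffel g y a b = \<Gamma> a b y"
  unfolding christoffel_def
proof (rule the_equality)
  have *: "frechet_derivative (\<lambda>y. g y b c) (at y) a + frechet_derivative (\<lambda>y. g y a c) (at y) b -
      frechet_derivative (\<lambda>y. g y a b) (at y) c = 2 * g y (\<Gamma> a b y) c" for c
    unfolding frechet_g[OF y] unfolding riemannian_metric_def \<Gamma>[OF y] sym[OF y, of b a c] sym[OF y, of c a b] sym[OF y, of c b a]
    by simp
  then show "\<forall>c. 2 * g y (\<Gamma> a b y) c = frechet_derivative (\<lambda>y. g y b c) (at y) a +
      frechet_derivative (\<lambda>y. g y a c) (at y) b - frechet_derivative (\<lambda>y. g y a b) (at y) c" by simp
  fix w assume "\<forall>c. 2 * g y w c = frechet_derivative (\<lambda>y. g y b c) (at y) a +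
      frechet_derivative (\<lambda>y. g y a c) (at y) b - frechet_derivative (\<lambda>y. g y a b) (at y) c"
  then have "2 * g y w (w - \<Gamma> a b y) = 2 * g y (\<Gamma> a b y) (w - \<Gamma> a b y)" unfolding * by blast
  then have "Re (sesq (H y) (w - \<Gamma> a b y) (w - \<Gamma> a b y)) = 0"
    by (simp add: riemannian_metric_def sesq_diff_left)
  then show "w = \<Gamma> a b y" using hermitian_posdef_pos[OF pd[OF y], of "w - \<Gamma> a b y"] by fastforce
qed

text \<open>The holomorphic derivatives and the quadratic terms combine to iterated covariant
  derivatives, which commute; only antiholomorphic derivatives of the connection survive.\<close>

lemma riemann_curvature_eq:
  assumes z: "z \<in> S"
  shows "riemann_curvature g z a b c = dzb_vec a (\<Gamma> b c) z - dzb_vec b (\<Gamma> a c) z"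
proof -
  have "frechet_derivative (\<lambda>y. christoffel g y b c) (at z) a = dz_vec a (\<Gamma> b c) z + dzb_vec a (\<Gamma> b c) z" for a b
    using frechet_derivative_cong_open[OF S z, of "\<lambda>y. christoffel g y b c" "\<Gamma> b c"]
      frechet_vec[OF \<Gamma>_differentiable[OF z]] by (simp add: christoffel_eq)
  then have R: "riemann_curvature g z a b c = (dz_vec a (\<Gamma> b c) z + \<Gamma> a (\<Gamma> b c z) z) - (dz_vec b (\<Gamma> a c) z + \<Gamma> b (\<Gamma> a c z) z)
      + (dzb_vec a (\<Gamma> b c) z - dzb_vec b (\<Gamma> a c) z)"
    by (simp add: riemann_curvature_def christoffel_eq z)
  have "dz_vec a (\<Gamma> b c) z + \<Gamma> a (\<Gamma> b c z) z = dz_vec b (\<Gamma> a c) z + \<Gamma> b (\<Gamma> a c z) z"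
    by (rule hermitian_posdef_cancel[OF pd[OF z]])
       (simp only: \<Gamma>_dz_vec[OF z] dz_commute[OF S smooth_h z, of a b])
  then show ?thesis by (simp add: R)
qed

lemma curvature4_zero_imp_flat:
  assumes z: "z \<in> S" and "\<And>b a c d. curvature4 H z b a c d = 0"
  shows "riemann_curvature g z a b c = 0"
proof -
  have "dzb_vec a (\<Gamma> b c) z = 0" for a b c
    by (rule hermitian_posdef_eq_0[OF pd[OF z]]) (simp add: \<Gamma>_dzb_vec z assms(2))
  then show ?thesis by (simp add: riemann_curvature_eq z)
qed

lemma ricci_flat_mixed_disc:
  assumes z: "z \<in> S" and ric: "\<And>b c. ricci_curvature g z b c = 0"
  shows "mixed_disc (H z) (curvature_mat H z b a) = 0"
proof -
  define L where "L a b c = dzb_vec a (\<Gamma> b c) z" for a b c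
  have L: "sesq (H z) (L a b c) d = - curvature4 H z b a c d" for a b c d by (simp add: L_def \<Gamma>_dzb_vec z)
  have lin: "L (k *s a) b c = cnj k *s L a b c" "L a (k *s b) c = k *s L a b c" "L a b (k *s c) = k *s L a b c" for k a b c
    by (rule hermitian_posdef_cancel[OF pd[OF z]], simp add: L curvature4_smult sesq_smult_left)+
  have Lsym: "L a b c = L a c b" for a b c
    by (rule hermitian_posdef_cancel[OF pd[OF z]]) (simp only: L curvature4_sym[OF z, of b])
  \<comment> \<open>In the real trace over an axis and its multiple by \<open>i\<close>, the term
    antilinear in the traced vector cancels and the linear one counts twice. What remains is the
    real part of a complex trace; replacing \<open>c\<close> by \<open>i c\<close> will give the
    imaginary part.\<close>
  have tr: "Re (L b (axis 1 1) c $ 1 + L b (axis 2 1) c $ 2) = 0" for b c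
    using ric[of b c] unfolding ricci_curvature_def riemann_curvature_eq[OF z] L_def[symmetric]
      sum_Basis_complex2 lin by (simp add: inner_vec_axis)
  have tr': "L b (axis 1 1) c $ 1 + L b (axis 2 1) c $ 2 = 0" for b c
    using tr[of b c] tr[of b "\<i> *s c"] by (simp add: lin complex_eq_iff)
  have sx: "sesq M x (axis \<beta> 1) = M $ 1 $ \<beta> * x $ 1 + M $ 2 $ \<beta> * x $ 2" for M :: "complex^2^2" and x \<beta>
    using exhaust_2[of \<beta>] by (auto simp: sesq_2 axis_def)
  have K: "curvature4 H z b a c (axis \<beta> 1) = - (H z $ 1 $ \<beta> * L a b c $ 1 + H z $ 2 $ \<beta> * L a b c $ 2)" for \<beta> c
    unfolding sx[symmetric] L by simp
  \<comment> \<open>Symmetry of \<open>L\<close> in its last two arguments turns the Ricci trace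
    into the trace of the endomorphism \<open>L a b\<close>, which is what the cofactor expansion in
    \<open>mixed_disc\<close> computes.\<close>
  have t: "L a b (axis 1 1) $ 1 = - L a b (axis 2 1) $ 2"
    using tr'[of a b] by (simp add: Lsym[of _ b] eq_neg_iff_add_eq_0)
  show ?thesis by (simp add: mixed_disc_def curvature_mat_def K t algebra_simps)
qed

end

section \<open>Curvature at a minimum of the holomorphic sectional curvature\<close>

abbreviation e1 :: "complex^2" where "e1 \<equiv> axis 1 1"
abbreviation e2 :: "complex^2" where "e2 \<equiv> axis 2 1"

lemma poly_linear_coeff_zero:
  fixes c1 :: real
  assumes "\<And>s. 0 \<le> c1 * s + c2 * s^2 + c3 * s^3 + c4 * s^4"
  shows "c1 = 0"
proof -
  have "((\<lambda>s. c1 * s + c2 * s^2 + c3 * s^3 + c4 * s^4) has_real_derivative c1) (at 0)"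
    by (auto intro!: derivative_eq_intros)
  then show ?thesis
    by (rule DERIV_local_min[where d = 1]) (use assms in auto)
qed

text \<open>The curvature at one point in a unitary frame, reduced to algebra. Unitarity is built
  into \<open>tr\<close>: the Ricci trace is the plain sum over \<open>e1\<close> and
  \<open>e2\<close>.\<close>

locale kaehler_quartic =
  fixes K :: "complex^2 \<Rightarrow> complex^2 \<Rightarrow> complex^2 \<Rightarrow> complex^2 \<Rightarrow> complex"
  assumes add: "\<And>b b' a c d. K (b + b') a c d = K b a c d + K b' a c d"
      "\<And>b a a' c d. K b (a + a') c d = K b a c d + K b a' c d"
      "\<And>b a c c' d. K b a (c + c') d = K b a c d + K b a c' d"
      "\<And>b a c d d'. K b a c (d + d') = K b a c d + K b a c d'"
    and smult: "\<And>k b a c d. K (k *s b) a c d = k * K b a c d"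
      "\<And>k b a c d. K b (k *s a) c d = cnj k * K b a c d"
      "\<And>k b a c d. K b a (k *s c) d = k * K b a c d"
      "\<And>k b a c d. K b a c (k *s d) = cnj k * K b a c d"
    and sym1: "\<And>b a c d. K b a c d = K c a b d"
    and cnj: "\<And>b a c d. cnj (K b a c d) = K a b d c"
    and tr: "\<And>b a. K b a e1 e1 + K b a e2 e2 = 0"
begin

lemma sym2: "K b a c d = K b d c a"
  by (metis cnj sym1 complex_cnj_cnj)

text \<open>\<open>A\<close> is the holomorphic sectional curvature of \<open>e1\<close>;
  \<open>\<kappa>\<close> governs its first variation towards \<open>e2\<close>, and
  \<open>\<beta>\<close> together with \<open>A\<close> the second. These five real numbers
  determine the whole tensor.\<close>

definition "A = Re (K e1 e1 e1 e1)"
definition "\<kappa> = K e2 e1 e1 e1"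
definition "\<beta> = K e1 e2 e1 e2"

lemma components:
  "K e1 e1 e1 e1 = of_real A" "K e2 e1 e1 e1 = \<kappa>" "K e1 e1 e2 e1 = \<kappa>"
  "K e1 e2 e1 e1 = cnj \<kappa>" "K e1 e1 e1 e2 = cnj \<kappa>"
  "K e1 e1 e2 e2 = - of_real A" "K e2 e2 e1 e1 = - of_real A" "K e2 e1 e1 e2 = - of_real A" "K e1 e2 e2 e1 = - of_real A"
  "K e1 e2 e1 e2 = \<beta>" "K e2 e1 e2 e1 = cnj \<beta>"
  "K e2 e1 e2 e2 = - \<kappa>" "K e2 e2 e2 e1 = - \<kappa>" "K e2 e2 e1 e2 = - cnj \<kappa>" "K e1 e2 e2 e2 = - cnj \<kappa>"
  "K e2 e2 e2 e2 = of_real A"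
proof -
  have t: "K b a e2 e2 = - K b a e1 e1" for b a using tr[of b a] by (simp add: eq_neg_iff_add_eq_0 add.commute)
  show 1: "K e1 e1 e1 e1 = of_real A" using cnj[of e1 e1 e1 e1] by (simp add: A_def complex_eq_iff)
  show 2: "K e2 e1 e1 e1 = \<kappa>" by (simp add: \<kappa>_def)
  show 3: "K e1 e1 e2 e1 = \<kappa>" by (simp add: \<kappa>_def sym1[of e1])
  show 4: "K e1 e2 e1 e1 = cnj \<kappa>" by (simp add: \<kappa>_def cnj)
  show 5: "K e1 e1 e1 e2 = cnj \<kappa>" unfolding 4[symmetric] by (rule sym2)
  show 6: "K e1 e1 e2 e2 = - of_real A" by (simp add: t 1)
  show 7: "K e2 e1 e1 e2 = - of_real A" unfolding 6[symmetric] by (rule sym1)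
  show 8: "K e1 e2 e2 e1 = - of_real A" unfolding 6[symmetric] by (rule sym2)
  show 9: "K e2 e2 e1 e1 = - of_real A" unfolding 7[symmetric] by (rule sym2)
  show "K e1 e2 e1 e2 = \<beta>" by (simp add: \<beta>_def)
  show "K e2 e1 e2 e1 = cnj \<beta>" by (simp add: \<beta>_def cnj)
  show 10: "K e2 e1 e2 e2 = - \<kappa>" by (simp add: t 2)
  show "K e2 e2 e2 e1 = - \<kappa>" unfolding 10[symmetric] by (rule sym2)
  show 11: "K e1 e2 e2 e2 = - cnj \<kappa>" by (simp add: t 4)
  show "K e2 e2 e1 e2 = - cnj \<kappa>" unfolding 11[symmetric] by (rule sym1)
  show "K e2 e2 e2 e2 = of_real A" by (simp add: t 9)
qed

text \<open>A diagonal and an off-diagonal entry of the Hermitian form <R v, v>; the other two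
  follow from trace zero and conjugation.\<close>

lemma pair_form:
  "K e1 e1 v v = of_real (A * ((cmod (v $ 1))\<^sup>2 - (cmod (v $ 2))\<^sup>2)) + \<kappa> * v $ 2 * cnj (v $ 1) + cnj \<kappa> * v $ 1 * cnj (v $ 2)"
  "K e1 e2 v v = cnj \<kappa> * of_real ((cmod (v $ 1))\<^sup>2 - (cmod (v $ 2))\<^sup>2) + \<beta> * v $ 1 * cnj (v $ 2) - of_real A * v $ 2 * cnj (v $ 1)"
proof -
  have e: "K b a v v = K b a e1 e1 * v $ 1 * cnj (v $ 1) + K b a e1 e2 * v $ 1 * cnj (v $ 2) +
      K b a e2 e1 * v $ 2 * cnj (v $ 1) + K b a e2 e2 * v $ 2 * cnj (v $ 2)" for b a
    by (subst (1 2) vec2_expand[of v]) (simp only: add smult, simp add: algebra_simps)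
  show "K e1 e1 v v = of_real (A * ((cmod (v $ 1))\<^sup>2 - (cmod (v $ 2))\<^sup>2)) + \<kappa> * v $ 2 * cnj (v $ 1) + cnj \<kappa> * v $ 1 * cnj (v $ 2)"
    "K e1 e2 v v = cnj \<kappa> * of_real ((cmod (v $ 1))\<^sup>2 - (cmod (v $ 2))\<^sup>2) + \<beta> * v $ 1 * cnj (v $ 2) - of_real A * v $ 2 * cnj (v $ 1)"
    unfolding e components of_real_mult of_real_diff complex_norm_square by (simp_all add: algebra_simps)
qed

text \<open>The coefficient \<open>- 4\<close> collects the four components with \<open>e2\<close>
  in one linear and one antilinear slot; the two components with \<open>e2\<close> in slots of equal
  type give \<open>\<beta>\<close> and its conjugate.\<close>

lemma quartic_form:
  "K (e1 + t *s e2) (e1 + t *s e2) (e1 + t *s e2) (e1 + t *s e2) =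
    of_real (A * (1 + (cmod t)^4 - 4 * (cmod t)\<^sup>2)) +
    2 * (t * \<kappa> + cnj (t * \<kappa>)) * of_real (1 - (cmod t)\<^sup>2) + t\<^sup>2 * cnj \<beta> + cnj (t\<^sup>2 * cnj \<beta>)"
proof -
  have 4: "complex_of_real ((cmod t)^4) = (t * cnj t)\<^sup>2"
    unfolding complex_norm_square[symmetric] by (simp add: power2_eq_square numeral_eq_Suc)
  show ?thesis
    unfolding of_real_mult of_real_add of_real_diff complex_norm_square 4
    by (simp only: add smult components) (simp add: algebra_simps power2_eq_square)
qed

lemma Re_quartic_form:
  "Re (K (e1 + t *s e2) (e1 + t *s e2) (e1 + t *s e2) (e1 + t *s e2)) =
    A * (1 + (cmod t)^4 - 4 * (cmod t)\<^sup>2) + 4 * Re (t * \<kappa>) * (1 - (cmod t)\<^sup>2) + 2 * Re (t\<^sup>2 * cnj \<beta>)"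
  unfolding quartic_form by (simp add: algebra_simps power2_eq_square)

lemma expand_zero:
  assumes "A = 0" "\<kappa> = 0" "\<beta> = 0"
  shows "K b a c d = 0"
  by (subst vec2_expand[of b], subst vec2_expand[of a], subst vec2_expand[of c], subst vec2_expand[of d])
     (simp only: add smult components assms, simp)

text \<open>A few values of \<open>t\<close> do the work of an integral over the fibre. Modulus one
  removes the \<open>\<kappa>\<close> term, and \<open>t = 1\<close>, \<open>t = i\<close> give
  \<open>\<beta>\<close> opposite signs, so their sum forces \<open>A = 0\<close>. The same pair
  then gives the real part of \<open>\<beta>\<close>; points with square \<open>2 i\<close> or
  \<open>- 2 i\<close>, taken with both signs to cancel \<open>\<kappa>\<close>, give the imaginary
  part.\<close>

lemma nonneg_imp_zero:
  assumes nn: "\<And>v. 0 \<le> Re (K v v v v)"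
  shows "K b a c d = 0"
proof -
  note q = nn[of "e1 + t *s e2" for t, unfolded Re_quartic_form]
  have A0: "0 \<le> A" using nn[of e1] by (simp add: A_def)
  have "A \<le> 0" using q[of 1] q[of "\<i>"] by simp
  with A0 have A: "A = 0" by simp
  have "Re \<beta> = 0" using q[of 1] q[of "\<i>"] A by simp
  moreover have "Im \<beta> = 0"
    using q[of "1 + \<i>"] q[of "- 1 - \<i>"] q[of "1 - \<i>"] q[of "\<i> - 1"] A
    by (simp add: power2_eq_square algebra_simps cmod_def)
  ultimately have b: "\<beta> = 0" by (simp add: complex_eq_iff)
  have "Re \<kappa> = 0" using q[of "1/2"] q[of "- 1/2"] A b by (simp add: power2_eq_square)
  moreover have "Im \<kappa> = 0" using q[of "\<i>/2"] q[of "- \<i>/2"] A b by (simp add: power2_eq_square norm_divide)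
  ultimately have k: "\<kappa> = 0" by (simp add: complex_eq_iff)
  show ?thesis by (rule expand_zero[OF A k b])
qed

text \<open>Along \<open>e1 + s \<tau> e2\<close> the defect in the inequality is a polynomial in
  the real variable \<open>s\<close> without constant term. Nonnegativity for both signs of
  \<open>s\<close> kills its linear coefficient, for every \<open>\<tau>\<close>.\<close>

lemma minimum_critical:
  assumes m: "\<And>v. A * ((cmod (v $ 1))\<^sup>2 + (cmod (v $ 2))\<^sup>2)\<^sup>2 \<le> Re (K v v v v)"
  shows "\<kappa> = 0"
proof -
  \<comment> \<open>The fourth-order terms of the curvature and of the squared length cancel; the
    \<open>- 6\<close> is \<open>- 4\<close> from the curvature and \<open>- 2\<close> from the
    length.\<close>
  have "0 \<le> 4 * Re (\<tau> * \<kappa>) * s + (2 * Re (\<tau>\<^sup>2 * cnj \<beta>) - 6 * A * (cmod \<tau>)\<^sup>2) * s^2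
      + (- 4 * Re (\<tau> * \<kappa>) * (cmod \<tau>)\<^sup>2) * s^3 + 0 * s^4" for s \<tau>
  proof -
    let ?t = "of_real s * \<tau>"
    have c: "(cmod ?t)\<^sup>2 = s\<^sup>2 * (cmod \<tau>)\<^sup>2" "(cmod ?t)^4 = s^4 * (cmod \<tau>)^4"
      by (simp_all add: norm_mult power_mult_distrib)
    have "A * (1 + (cmod ?t)\<^sup>2)\<^sup>2 \<le> Re (K (e1 + ?t *s e2) (e1 + ?t *s e2) (e1 + ?t *s e2) (e1 + ?t *s e2))"
      using m[of "e1 + ?t *s e2"] by (simp add: axis_def)
    moreover have "Re (?t * \<kappa>) = s * Re (\<tau> * \<kappa>)" "Re (?t\<^sup>2 * cnj \<beta>) = s\<^sup>2 * Re (\<tau>\<^sup>2 * cnj \<beta>)"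
      by (simp_all add: power_mult_distrib mult.assoc flip: of_real_power)
    ultimately show ?thesis unfolding Re_quartic_form c
      by (simp add: algebra_simps power2_eq_square numeral_eq_Suc)
  qed
  then have "4 * Re (\<tau> * \<kappa>) = 0" for \<tau> by (rule poly_linear_coeff_zero)
  from this[of 1] this[of \<i>] show ?thesis by (simp add: complex_eq_iff)
qed

text \<open>Without a positive direction the trace-free form <R v, v> vanishes. For
  \<open>\<kappa> = 0\<close> its diagonal entry makes the two components of \<open>v\<close> equal
  in modulus, and then its off-diagonal entry forces \<open>|\<beta>| = |A|\<close>.\<close>

lemma RC_positive_direction:
  assumes "\<kappa> = 0" "A \<noteq> 0" "3 * A\<^sup>2 \<le> (cmod \<beta>)\<^sup>2" "v \<noteq> 0"
  shows "\<exists>u. 0 < Re (K u u v v)"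
proof (rule ccontr)
  assume "\<not> ?thesis"
  then have n: "Re (K u u v v) \<le> 0" for u using not_less by blast
  \<comment> \<open>The trace condition concerns the second pair of arguments; the Kaehler
    symmetries exchange the pairs.\<close>
  have tr1: "K e2 e2 v v = - K e1 e1 v v"
  proof -
    have "K b a v v = K v a b v" for b a by (rule sym1)
    then have "K b a v v = K v v b a" for b a by (metis sym2)
    then show ?thesis using tr[of v v] by (simp add: eq_neg_iff_add_eq_0 add.commute)
  qed
  have r: "K e1 e1 v v = of_real (Re (K e1 e1 v v))" using cnj[of e1 e1 v v] by (simp add: complex_eq_iff)
  have 11: "K e1 e1 v v = 0" using n[of e1] n[of e2] r tr1 by (simp add: complex_eq_iff)
  \<comment> \<open>With zero diagonal entries, the vector \<open>e1 + P e2\<close> evaluates the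
    form to \<open>2 |P|^2\<close>, so the off-diagonal entry vanishes as well.\<close>
  define P where "P = K e1 e2 v v"
  have "K (e1 + P *s e2) (e1 + P *s e2) v v = of_real (2 * (cmod P)\<^sup>2)"
    unfolding of_real_mult complex_norm_square
    by (simp add: add smult tr1 11 P_def[symmetric]) (simp add: P_def cnj)
  then have "P = 0" using n[of "e1 + P *s e2"] by simp
  have "complex_of_real (A * ((cmod (v $ 1))\<^sup>2 - (cmod (v $ 2))\<^sup>2)) = 0"
    using 11 assms(1) unfolding pair_form by (simp del: of_real_mult of_real_diff)
  then have "(cmod (v $ 1))\<^sup>2 = (cmod (v $ 2))\<^sup>2" using assms(2) unfolding of_real_eq_0_iff by simp
  then have c: "cmod (v $ 1) = cmod (v $ 2)" by simp
  then have v1: "cmod (v $ 1) \<noteq> 0" using assms(4) by (auto simp: vec_eq_iff forall_2)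
  have "\<beta> * v $ 1 * cnj (v $ 2) = of_real A * v $ 2 * cnj (v $ 1)"
    using \<open>P = 0\<close> assms(1) c unfolding P_def pair_form by simp
  then have "cmod (\<beta> * v $ 1 * cnj (v $ 2)) = cmod (of_real A * v $ 2 * cnj (v $ 1))" by simp
  then have "cmod \<beta> = \<bar>A\<bar>" using v1 c by (simp add: norm_mult)
  then have "(cmod \<beta>)\<^sup>2 = A\<^sup>2" by simp
  then show False using assms(2,3) by simp
qed

end

section \<open>Second-order conditions at a minimum and derivatives of the curvature\<close>

lemma second_derivative_nonneg:
  fixes f :: "'a::real_normed_vector \<Rightarrow> real"
  assumes "open S" "smooth_on S f" "z \<in> S" and min: "\<And>y. y \<in> S \<Longrightarrow> f z \<le> f y"
  shows "0 \<le> frechet_derivative (\<lambda>x. frechet_derivative f (at x) v) (at z) v"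
proof (rule ccontr)
  let ?c = "frechet_derivative (\<lambda>x. frechet_derivative f (at x) v) (at z) v"
  assume "\<not> 0 \<le> ?c"
  then have neg: "?c < 0" by simp
  have "open ((\<lambda>t. z + t *\<^sub>R v) -` S)"
    by (rule open_vimage[OF assms(1)]) (intro continuous_intros)
  moreover have "0 \<in> (\<lambda>t::real. z + t *\<^sub>R v) -` S" using assms(3) by simp
  ultimately obtain d where d: "0 < d" "\<And>t. \<bar>t\<bar> < d \<Longrightarrow> z + t *\<^sub>R v \<in> S"
    unfolding open_dist dist_real_def by (auto, metis diff_zero)
  have der: "((\<lambda>t. h (z + t *\<^sub>R v)) has_real_derivative frechet_derivative h (at (z + t *\<^sub>R v)) v) (at t)"
    if "smooth_on S h" "\<bar>t\<bar> < d" for h :: "'a \<Rightarrow> real" and t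
  proof -
    have h: "h differentiable (at (z + t *\<^sub>R v))" by (rule smooth_on_differentiable[OF that(1) d(2)[OF that(2)]])
    have "((\<lambda>t. h (z + t *\<^sub>R v)) has_derivative (\<lambda>x. frechet_derivative h (at (z + t *\<^sub>R v)) (x *\<^sub>R v))) (at t)"
      by (rule has_derivative_compose[of "\<lambda>t. z + t *\<^sub>R v" "\<lambda>x. x *\<^sub>R v" t UNIV h])
         (use h in \<open>auto intro!: derivative_eq_intros simp: frechet_derivative_works\<close>)
    moreover have "frechet_derivative h (at (z + t *\<^sub>R v)) (x *\<^sub>R v) = frechet_derivative h (at (z + t *\<^sub>R v)) v * x" for x
      using linear_frechet_derivative[OF h] by (simp add: linear_cmul mult.commute)
    ultimately show ?thesis by (simp add: has_field_derivative_def)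
  qed
  let ?g = "\<lambda>t. frechet_derivative f (at (z + t *\<^sub>R v)) v"
  have g0: "?g 0 = 0"
    by (rule DERIV_local_min[OF der[OF assms(2)] d(1)]) (use d min in auto)
  have "(?g has_real_derivative ?c) (at 0)"
    using der[OF smooth_on_frechet[OF assms(2)], of 0 v] d(1) by simp
  from DERIV_neg_dec_right[OF this neg] obtain e where e: "0 < e" "\<And>h. 0 < h \<Longrightarrow> h < e \<Longrightarrow> ?g h < 0"
    using g0 by auto
  define s where "s = min d e / 2"
  have s: "0 < s" "s < d" "s < e" using d(1) e(1) by (auto simp: s_def min_def)
  have "\<exists>t>0. t < s \<and> f (z + s *\<^sub>R v) - f (z + 0 *\<^sub>R v) = (s - 0) * ?g t"
    by (rule MVT2[OF s(1)]) (use s in \<open>auto intro!: der[OF assms(2)]\<close>)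
  then obtain t where "0 < t" "t < s" "f (z + s *\<^sub>R v) - f z = s * ?g t" by auto
  moreover have "s * ?g t < 0" using e(2)[of t] s calculation by (simp add: mult_pos_neg)
  moreover have "f z \<le> f (z + s *\<^sub>R v)" by (rule min[OF d(2)]) (use s in simp)
  ultimately show False by simp
qed

text \<open>The mixed derivative is a quarter of the Laplacian on the complex line spanned by
  \<open>v\<close>, a sum of two real second derivatives.\<close>

lemma dz_dzb_nonneg:
  assumes "open S" "smooth_on S f" "z \<in> S" and min: "\<And>y. y \<in> S \<Longrightarrow> Re (f z) \<le> Re (f y)"
  shows "0 \<le> Re (dz v (dzb v f) z)"
proof -
  have sR: "smooth_on S (\<lambda>y. Re (f y))" by (rule smooth_on_bounded_linear[OF bounded_linear_Re assms(1,2)])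
  have "frechet_derivative (\<lambda>x. frechet_derivative (\<lambda>y. Re (f y)) (at x) u) (at z) u =
      Re (frechet_derivative (\<lambda>x. frechet_derivative f (at x) u) (at z) u)" for u
  proof -
    have "frechet_derivative (\<lambda>x. frechet_derivative (\<lambda>y. Re (f y)) (at x) u) (at z)
        = frechet_derivative (\<lambda>x. Re (frechet_derivative f (at x) u)) (at z)"
      by (rule frechet_derivative_cong_open[OF assms(1,3)]) (simp add: frechet_Re smooth_on_differentiable[OF assms(2)])
    then show ?thesis by (simp add: frechet_Re smooth_on_differentiable[OF smooth_on_frechet[OF assms(2)] assms(3)])
  qed
  then have "0 \<le> Re (frechet_derivative (\<lambda>x. frechet_derivative f (at x) u) (at z) u)" for u
    using second_derivative_nonneg[OF assms(1) sR assms(3) min, of u] by simp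
  from this[of v] this[of "\<i> *s v"] have "0 \<le> Re (4 * dz v (dzb v f) z)"
    unfolding dz_dzb_laplacian[OF assms(1-3)] by simp
  then show ?thesis by simp
qed

context
  fixes S :: "(complex^'n) set" and f g :: "complex^'n \<Rightarrow> complex" and z
  assumes S: "open S" and f: "smooth_on S f" and g: "smooth_on S g" and z: "z \<in> S"
begin

private lemma d: "y \<in> S \<Longrightarrow> f differentiable (at y)" "y \<in> S \<Longrightarrow> g differentiable (at y)"
  "y \<in> S \<Longrightarrow> dzb q f differentiable (at y)" "y \<in> S \<Longrightarrow> dzb q g differentiable (at y)"
  by (auto intro!: smooth_on_differentiable[of S] f g smooth_on_dzb[OF S])

lemma dz_dzb_add: "dz p (dzb q (\<lambda>y. f y + g y)) z = dz p (dzb q f) z + dz p (dzb q g) z"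
proof -
  have "dz p (dzb q (\<lambda>y. f y + g y)) z = dz p (\<lambda>y. dzb q f y + dzb q g y) z"
    by (rule dz_cong_open[OF S z]) (simp add: dzb_add d)
  then show ?thesis by (simp add: dz_add d z)
qed

lemma dz_dzb_diff: "dz p (dzb q (\<lambda>y. f y - g y)) z = dz p (dzb q f) z - dz p (dzb q g) z"
proof -
  have "dz p (dzb q (\<lambda>y. f y - g y)) z = dz p (\<lambda>y. dzb q f y - dzb q g y) z"
    by (rule dz_cong_open[OF S z]) (simp add: dzb_diff d)
  then show ?thesis by (simp add: dz_diff d z)
qed

lemma dz_dzb_mult:
  "dz p (dzb q (\<lambda>y. f y * g y)) z =
    dz p (dzb q f) z * g z + dzb q f z * dz p g z + dz p f z * dzb q g z + f z * dz p (dzb q g) z"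
proof -
  have "dz p (dzb q (\<lambda>y. f y * g y)) z = dz p (\<lambda>y. dzb q f y * g y + f y * dzb q g y) z"
    by (rule dz_cong_open[OF S z]) (simp add: dzb_mult d)
  then show ?thesis by (simp add: dz_add dz_mult d z)
qed

end

context local_kaehler
begin

lemma dzb_sym: "y \<in> S \<Longrightarrow> dzb a (h b c) y = dzb c (h b a) y"
  by (simp add: dzb_h sym[of y a c b])

text \<open>A Kaehler metric is locally the complex Hessian of a potential, so its derivatives are
  symmetric in all holomorphic and in all antiholomorphic indices. Here no potential is used:
  commutations of derivatives alternate with the Kaehler condition and its conjugate.\<close>

lemma fourth_derivative_sym:
  assumes z: "z \<in> S"
  shows "dz p (dzb q (dz b (dzb a (h c d)))) z = dz c (dzb d (dz b (dzb a (h p q)))) z"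
proof -
  have cz: "(\<And>y. y \<in> S \<Longrightarrow> f y = f' y) \<Longrightarrow> y \<in> S \<Longrightarrow> dz v f y = dz v f' y" for f f' v y
    by (rule dz_cong_open[OF S])
  have cb: "(\<And>y. y \<in> S \<Longrightarrow> f y = f' y) \<Longrightarrow> y \<in> S \<Longrightarrow> dzb v f y = dzb v f' y" for f f' v y
    by (rule dzb_cong_open[OF S])
  note sz = smooth_on_dz[OF S] and sb = smooth_on_dzb[OF S]
  note zb = dz_dzb_commute[OF S] and zz = dz_commute[OF S] and bb = dzb_commute[OF S]
  have "dz p (dzb q (dz b (dzb a (h c d)))) z = dz p (dzb q (dzb a (dz b (h c d)))) z"
    by (rule cz[OF cb[OF zb] z]) (rule smooth_h | assumption)+
  also have "\<dots> = dzb q (dz p (dzb a (dz b (h c d)))) z"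
    by (rule zb[OF _ z]) (intro sz sb smooth_h)
  also have "\<dots> = dzb q (dzb a (dz p (dz b (h c d)))) z"
    by (rule cb[OF zb z]) (intro sz sb smooth_h | assumption)+
  also have "\<dots> = dzb q (dzb a (dz b (dz p (h c d)))) z"
    by (rule cb[OF cb[OF zz] z]) (intro sz sb smooth_h | assumption)+
  also have "\<dots> = dzb q (dzb a (dz b (dz c (h p d)))) z"
    by (rule cb[OF cb[OF cz[OF sym]] z])
  also have "\<dots> = dzb a (dzb q (dz b (dz c (h p d)))) z"
    by (rule bb[OF _ z]) (intro sz sb smooth_h)
  also have "\<dots> = dzb a (dz b (dzb q (dz c (h p d)))) z"
    by (rule cb[OF zb[symmetric] z]) (intro sz sb smooth_h | assumption)+
  also have "\<dots> = dzb a (dz b (dz c (dzb q (h p d)))) z"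
    by (rule cb[OF cz[OF zb[symmetric]] z]) (intro sz sb smooth_h | assumption)+
  also have "\<dots> = dzb a (dz b (dz c (dzb d (h p q)))) z"
    by (rule cb[OF cz[OF cz[OF dzb_sym]] z])
  also have "\<dots> = dzb a (dz c (dz b (dzb d (h p q)))) z"
    by (rule cb[OF zz z]) (intro sz sb smooth_h | assumption)+
  also have "\<dots> = dz c (dzb a (dz b (dzb d (h p q)))) z"
    by (rule zb[OF _ z, symmetric]) (intro sz sb smooth_h)
  also have "\<dots> = dz c (dzb a (dzb d (dz b (h p q)))) z"
    by (rule cz[OF cb[OF zb] z]) (rule smooth_h | assumption)+
  also have "\<dots> = dz c (dzb d (dzb a (dz b (h p q)))) z"
    by (rule cz[OF bb z]) (intro sz sb smooth_h | assumption)+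
  also have "\<dots> = dz c (dzb d (dz b (dzb a (h p q)))) z"
    by (rule cz[OF cb[OF zb[symmetric]] z]) (intro sz sb smooth_h | assumption)+
  finally show ?thesis .
qed

lemma smooth_curvature4: "smooth_on S (\<lambda>y. curvature4 H y b a c d)"
proof (rule smooth_on_cong[OF S])
  show "smooth_on S (\<lambda>y. - dz b (dzb a (h c d)) y + sesq (H y) (\<Gamma> b c y) (\<Gamma> a d y))"
    unfolding sesq_def
    by (intro smooth_on_add smooth_on_minus smooth_on_dz smooth_on_dzb smooth_on_sum smooth_on_mult smooth_on_cnj
        S smooth_h[unfolded sesq_def] sm smooth_\<Gamma>)
qed (simp add: curvature4_\<Gamma>)

lemma kaehler_quartic_normal:
  assumes z: "z \<in> S" and H1: "H z = mat 1" and tr: "\<And>b a. mixed_disc (H z) (curvature_mat H z b a) = 0"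
  shows "kaehler_quartic (curvature4 H z)"
proof unfold_locales
  show "curvature4 H z b a e1 e1 + curvature4 H z b a e2 e2 = 0" for b a
    using tr[of b a] by (simp add: H1 mixed_disc_def mat_def curvature_mat_def)
qed (simp_all add: curvature4_add curvature4_smult curvature4_cnj z, rule curvature4_sym[OF z])

end

text \<open>The fourth derivatives of the metric are eliminated by differentiating the trace identity \<open>ric\<close> twice.\<close>

locale kaehler_normal = local_kaehler +
  fixes z :: "complex^2"
  assumes z: "z \<in> S" and H1: "H z = mat 1" and d1: "\<And>a b c. dz a (\<lambda>y. sesq (H y) b c) z = 0"
    and ric: "\<And>y b a. y \<in> S \<Longrightarrow> mixed_disc (H y) (curvature_mat H y b a) = 0"
begin

sublocale kaehler_quartic "curvature4 H z" by (rule kaehler_quartic_normal[OF z H1 ric[OF z]])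

lemma d1b: "dzb a (h b c) z = 0"
  by (simp add: dzb_h[OF z] d1)

lemma \<Gamma>0: "\<Gamma> b c z = 0"
  by (rule \<Gamma>_eqI[OF z]) (simp add: d1)

lemma hz: "h u v z = u $ 1 * cnj (v $ 1) + u $ 2 * cnj (v $ 2)"
  by (simp add: H1 sesq_2 mat_def)

lemma dz_dzb_h: "dz p (dzb q (h c d)) z = - curvature4 H z p q c d"
  by (simp add: curvature4_\<Gamma>[OF z] \<Gamma>0)

text \<open>At the centre the connection and the first derivatives of the metric vanish, so in the
  derivatives of the quadratic term only those with exactly one derivative on each connection factor
  remain.\<close>

lemma dz_dzb_curvature4:
  "dz p (dzb q (\<lambda>y. curvature4 H y b a c d)) z = - dz p (dzb q (dz b (dzb a (h c d)))) z +
    (sesq (H z) (dz_vec p (\<Gamma> b c) z) (dz_vec q (\<Gamma> a d) z) + sesq (H z) (dzb_vec q (\<Gamma> b c) z) (dzb_vec p (\<Gamma> a d) z))"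
proof -
  let ?F = "dz b (dzb a (h c d))" and ?G = "\<lambda>y. sesq (H y) (\<Gamma> b c y) (\<Gamma> a d y)"
  have sF: "smooth_on S ?F" by (intro smooth_on_dz smooth_on_dzb S smooth_h)
  have sG: "smooth_on S ?G" unfolding sesq_def
    by (intro smooth_on_sum smooth_on_mult smooth_on_cnj S sm smooth_\<Gamma>)
  have "dz p (dzb q (\<lambda>y. curvature4 H y b a c d)) z = dz p (dzb q (\<lambda>y. ?G y - ?F y)) z"
    by (rule dz_cong_open[OF S z], rule dzb_cong_open[OF S]) (simp_all add: curvature4_\<Gamma>)
  also have "\<dots> = dz p (dzb q ?G) z - dz p (dzb q ?F) z" by (rule dz_dzb_diff[OF S sG sF z])
  also have "dz p (dzb q ?G) z = dz p (\<lambda>y. (sesq (dzb_mat q H y) (\<Gamma> b c y) (\<Gamma> a d y) + sesq (H y) (dzb_vec q (\<Gamma> b c) y) (\<Gamma> a d y))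
       + sesq (H y) (\<Gamma> b c y) (dz_vec q (\<Gamma> a d) y)) z"
    by (rule dz_cong_open[OF S z]) (simp add: dz_sesq(2) df \<Gamma>_differentiable)
  also have "\<dots> = sesq (H z) (dz_vec p (\<Gamma> b c) z) (dz_vec q (\<Gamma> a d) z) + sesq (H z) (dzb_vec q (\<Gamma> b c) z) (dzb_vec p (\<Gamma> a d) z)"
  proof -
    have 1: "(\<lambda>y. dzb_mat q H y $ i $ j) differentiable (at z)" for i j
      using smooth_on_differentiable[OF smooth_on_dzb[OF S sm] z] by (simp add: dzb_mat_def)
    have 2: "(\<lambda>y. dz_vec q (\<Gamma> a d) y $ i) differentiable (at z)" for i
      using smooth_on_differentiable[OF smooth_on_dz[OF S smooth_\<Gamma>] z] by (simp add: dz_vec_def)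
    have 3: "(\<lambda>y. dzb_vec q (\<Gamma> b c) y $ i) differentiable (at z)" for i
      using smooth_on_differentiable[OF smooth_on_dzb[OF S smooth_\<Gamma>] z] by (simp add: dzb_vec_def)
    note D = 1 2 3 df[OF z] \<Gamma>_differentiable[OF z]
    have "dz p (\<lambda>y. (sesq (dzb_mat q H y) (\<Gamma> b c y) (\<Gamma> a d y) + sesq (H y) (dzb_vec q (\<Gamma> b c) y) (\<Gamma> a d y))
       + sesq (H y) (\<Gamma> b c y) (dz_vec q (\<Gamma> a d) y)) z =
      (dz p (\<lambda>y. sesq (dzb_mat q H y) (\<Gamma> b c y) (\<Gamma> a d y)) z + dz p (\<lambda>y. sesq (H y) (dzb_vec q (\<Gamma> b c) y) (\<Gamma> a d y)) z)
       + dz p (\<lambda>y. sesq (H y) (\<Gamma> b c y) (dz_vec q (\<Gamma> a d) y)) z"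
      by (simp add: dz_add sesq_differentiable D)
    then show ?thesis by (simp add: dz_sesq(1) D \<Gamma>0)
  qed
  finally show ?thesis by simp
qed

text \<open>Makes the holomorphic derivatives of the connection, which curvature does not control,
  cancel when the second derivatives of two curvature components are compared in the second
  variation.\<close>

lemma dz_vec_\<Gamma>_sym: "dz_vec p (\<Gamma> b c) z = dz_vec b (\<Gamma> c p) z"
proof (rule hermitian_posdef_cancel[OF pd[OF z]])
  fix d
  have "sesq (H z) (dz_vec p (\<Gamma> b c) z) d = dz p (dz b (h c d)) z"
    using \<Gamma>_dz_vec[OF z, of p b c d] by (simp add: \<Gamma>0)
  also have "\<dots> = dz b (dz p (h c d)) z" by (rule dz_commute[OF S smooth_h z])
  also have "\<dots> = dz b (dz c (h p d)) z" by (rule dz_cong_open[OF S z sym])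
  also have "\<dots> = sesq (H z) (dz_vec b (\<Gamma> c p) z) d"
    using \<Gamma>_dz_vec[OF z, of b c p d] by (simp add: \<Gamma>0)
  finally show "sesq (H z) (dz_vec p (\<Gamma> b c) z) d = sesq (H z) (dz_vec b (\<Gamma> c p) z) d" .
qed

text \<open>When the trace identity is differentiated twice, the metric factors contribute their
  second derivatives, which at the centre are minus the curvature. The two diagonal products give
  \<open>A^2\<close> each; the off-diagonal ones contain \<open>\<kappa>\<close>.\<close>

lemma trace_second_derivative:
  assumes "\<kappa> = 0"
  shows "dz e1 (dzb e1 (\<lambda>y. curvature4 H y e1 e1 e1 e1)) z + dz e1 (dzb e1 (\<lambda>y. curvature4 H y e1 e1 e2 e2)) z = - 2 * (of_real A)\<^sup>2"
proof -
  let ?K = "\<lambda>c d y. curvature4 H y e1 e1 c d"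
  let ?L = "\<lambda>f. dz e1 (dzb e1 f) z"
  have prod: "?L (\<lambda>y. h a b y * ?K c d y) = - curvature4 H z e1 e1 a b * ?K c d z + h a b z * ?L (?K c d)" for a b c d
    by (subst dz_dzb_mult[OF S smooth_h smooth_curvature4 z]) (simp add: d1 d1b dz_dzb_h)
  have s: "smooth_on S (\<lambda>y. h a b y * ?K c d y)" for a b c d
    by (intro smooth_on_mult S smooth_h smooth_curvature4)
  have "?L (\<lambda>y. ((h e2 e2 y * ?K e1 e1 y + h e1 e1 y * ?K e2 e2 y) - h e2 e1 y * ?K e1 e2 y) - h e1 e2 y * ?K e2 e1 y)
     = ?L (\<lambda>y. 0)"
  proof (rule dz_cong_open[OF S z], rule dzb_cong_open[OF S])
    fix y assume "y \<in> S"
    from ric[OF this, of e1 e1]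
    show "((h e2 e2 y * ?K e1 e1 y + h e1 e1 y * ?K e2 e2 y) - h e2 e1 y * ?K e1 e2 y) - h e1 e2 y * ?K e2 e1 y = 0"
      by (simp add: mixed_disc_def curvature_mat_def sesq_axis)
  qed
  moreover have "?L (\<lambda>y. 0) = 0" by (subst dzb_const[abs_def]) simp
  moreover have "?L (\<lambda>y. ((h e2 e2 y * ?K e1 e1 y + h e1 e1 y * ?K e2 e2 y) - h e2 e1 y * ?K e1 e2 y) - h e1 e2 y * ?K e2 e1 y)
    = ((?L (\<lambda>y. h e2 e2 y * ?K e1 e1 y) + ?L (\<lambda>y. h e1 e1 y * ?K e2 e2 y)) - ?L (\<lambda>y. h e2 e1 y * ?K e1 e2 y)) - ?L (\<lambda>y. h e1 e2 y * ?K e2 e1 y)"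
    by (subst dz_dzb_diff[OF S _ s z], intro smooth_on_diff smooth_on_add S s,
        subst dz_dzb_diff[OF S _ s z], intro smooth_on_add S s, subst dz_dzb_add[OF S s s z], simp)
  ultimately show ?thesis
    unfolding prod components assms hz by (simp add: axis_def power2_eq_square) (simp add: algebra_simps eq_neg_iff_add_eq_0)
qed

lemma sesq_normal: "sesq (H z) u u = of_real ((cmod (sesq (H z) u e1))\<^sup>2 + (cmod (sesq (H z) u e2))\<^sup>2)"
  unfolding of_real_add complex_norm_square by (simp add: hz axis_def)

text \<open>The complex second derivatives of \<open>?f\<close> along \<open>e1\<close> and
  \<open>e2\<close> add up to \<open>|\<beta>|^2 - 3 A^2\<close>: the trace identity contributes
  \<open>- 2 A^2\<close>, the exchange of index pairs in the fourth derivative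
  \<open>|\<beta>|^2 - A^2\<close>. The comparison term drops out of the sum because the curvature
  is trace-free.\<close>

lemma second_variation:
  assumes k: "\<kappa> = 0" and min: "\<And>y v. y \<in> S \<Longrightarrow> A * (Re (sesq (H y) v v))\<^sup>2 \<le> Re (curvature4 H y v v v v)"
  shows "3 * A\<^sup>2 \<le> (cmod \<beta>)\<^sup>2"
proof -
  let ?K = "\<lambda>y. curvature4 H y e1 e1 e1 e1"
  \<comment> \<open>The constant coordinate vector \<open>e1\<close> has unit length only at
    \<open>z\<close>, so the comparison term carries its squared length. \<open>?f\<close> is
    nonnegative and vanishes at \<open>z\<close>.\<close>
  let ?f = "\<lambda>y. ?K y - of_real A * (h e1 e1 y * h e1 e1 y)"
  have sh2: "smooth_on S (\<lambda>y. of_real A * (h e1 e1 y * h e1 e1 y))"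
    by (intro smooth_on_mult smooth_on_const S smooth_h)
  have sf: "smooth_on S ?f" by (intro smooth_on_diff smooth_curvature4 sh2 S)
  have nn: "0 \<le> Re (dz p (dzb p ?f) z)" for p
  proof (rule dz_dzb_nonneg[OF S sf z])
    fix y assume y: "y \<in> S"
    have "h e1 e1 z = 1" by (simp add: hz axis_def)
    then have fz: "Re (?f z) = 0" by (simp add: components)
    have "h e1 e1 y * h e1 e1 y = of_real ((Re (h e1 e1 y))\<^sup>2)"
      using hermitian_posdef_real[OF pd[OF y], of e1] by (metis of_real_mult power2_eq_square)
    then have "?f y = ?K y - of_real (A * (Re (h e1 e1 y))\<^sup>2)" by (simp only: of_real_mult)
    then have "Re (?f y) = Re (?K y) - A * (Re (h e1 e1 y))\<^sup>2" by (simp only: minus_complex.sel Re_complex_of_real)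
    then have "0 \<le> Re (?f y)" using min[OF y, of e1] by linarith
    then show "Re (?f z) \<le> Re (?f y)" using fz by linarith
  qed
  have L: "dz p (dzb p ?f) z = dz p (dzb p ?K) z + 2 * of_real A * curvature4 H z p p e1 e1" for p
  proof -
    have "dz p (dzb p (\<lambda>y. of_real A * (h e1 e1 y * h e1 e1 y))) z = of_real A * dz p (dzb p (\<lambda>y. h e1 e1 y * h e1 e1 y)) z"
      by (subst dz_dzb_mult[OF S smooth_on_const _ z]) (auto intro!: smooth_on_mult S smooth_h simp: dzb_const[abs_def])
    also have "dz p (dzb p (\<lambda>y. h e1 e1 y * h e1 e1 y)) z = - 2 * curvature4 H z p p e1 e1"
      by (subst dz_dzb_mult[OF S smooth_h smooth_h z]) (simp add: d1 d1b dz_dzb_h hz axis_def)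
    finally show ?thesis by (subst dz_dzb_diff[OF S smooth_curvature4 sh2 z]) simp
  qed
  \<comment> \<open>The fourth derivatives of the metric cannot be evaluated, only moved: the one
    along \<open>e2\<close> becomes one along \<open>e1\<close> of the component that the trace
    identity governs.\<close>
  have "dz e2 (dzb e2 ?K) z = dz e1 (dzb e1 (\<lambda>y. curvature4 H y e1 e1 e2 e2)) z
      + sesq (H z) (dzb_vec e2 (\<Gamma> e1 e1) z) (dzb_vec e2 (\<Gamma> e1 e1) z) - sesq (H z) (dzb_vec e1 (\<Gamma> e1 e2) z) (dzb_vec e1 (\<Gamma> e1 e2) z)"
    unfolding dz_dzb_curvature4 using fourth_derivative_sym[OF z, of e2 e2 e1 e1 e1 e1] dz_vec_\<Gamma>_sym[of e2 e1 e1]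
    by simp
  also have "\<dots> = dz e1 (dzb e1 (\<lambda>y. curvature4 H y e1 e1 e2 e2)) z + of_real ((cmod \<beta>)\<^sup>2) - of_real (A\<^sup>2)"
    unfolding sesq_normal[of "dzb_vec _ _ _"] \<Gamma>_dzb_vec[OF z] by (simp add: components k)
  finally have 2: "dz e2 (dzb e2 ?K) z = dz e1 (dzb e1 (\<lambda>y. curvature4 H y e1 e1 e2 e2)) z + of_real ((cmod \<beta>)\<^sup>2) - of_real (A\<^sup>2)" .
  have 1: "dz e1 (dzb e1 ?K) z = - 2 * (of_real A)\<^sup>2 - dz e1 (dzb e1 (\<lambda>y. curvature4 H y e1 e1 e2 e2)) z"
    using trace_second_derivative[OF k] by (simp only: eq_diff_eq)
  have "dz e1 (dzb e1 ?f) z + dz e2 (dzb e2 ?f) z = of_real ((cmod \<beta>)\<^sup>2 - 3 * A\<^sup>2)"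
    unfolding L components 1 2 by (simp add: algebra_simps)
  then have "Re (dz e1 (dzb e1 ?f) z) + Re (dz e2 (dzb e2 ?f) z) = (cmod \<beta>)\<^sup>2 - 3 * A\<^sup>2"
    by (metis Re_complex_of_real plus_complex.sel(1))
  then show ?thesis using nn[of e1] nn[of e2] by linarith
qed

lemma RC_at_normal_minimum:
  assumes "A \<noteq> 0" and min: "\<And>y v. y \<in> S \<Longrightarrow> A * (Re (sesq (H y) v v))\<^sup>2 \<le> Re (curvature4 H y v v v v)" and "v \<noteq> 0"
  shows "\<exists>u. 0 < Re (curvature4 H z u u v v)"
proof (rule RC_positive_direction[OF _ assms(1) _ assms(3)])
  have "Re (h v v z) = (cmod (v $ 1))\<^sup>2 + (cmod (v $ 2))\<^sup>2" for v
  proof -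
    have "h v v z = of_real ((cmod (v $ 1))\<^sup>2 + (cmod (v $ 2))\<^sup>2)"
      unfolding of_real_add complex_norm_square by (simp add: hz)
    then show ?thesis by simp
  qed
  then show k: "\<kappa> = 0" using min[OF z] by (intro minimum_critical) simp
  show "3 * A\<^sup>2 \<le> (cmod \<beta>)\<^sup>2" by (rule second_variation[OF k min])
qed

end

section \<open>Unitary frames and normal coordinates\<close>

lemma det2_inj:
  fixes x y :: "complex^2"
  assumes "x $ 1 * y $ 2 - x $ 2 * y $ 1 \<noteq> 0" "a *s x + b *s y = 0"
  shows "a = 0 \<and> b = 0"
proof -
  have 1: "a * x $ 1 + b * y $ 1 = 0" "a * x $ 2 + b * y $ 2 = 0"
    using assms(2) by (simp_all add: vec_eq_iff forall_2)
  have "a * (x $ 1 * y $ 2 - x $ 2 * y $ 1) = (a * x $ 1 + b * y $ 1) * y $ 2 - (a * x $ 2 + b * y $ 2) * y $ 1"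
    "b * (x $ 1 * y $ 2 - x $ 2 * y $ 1) = (a * x $ 2 + b * y $ 2) * x $ 1 - (a * x $ 1 + b * y $ 1) * x $ 2"
    by (simp_all add: algebra_simps)
  then show ?thesis using assms(1) unfolding 1 by simp
qed

lemma ex_orthonormal_basis:
  fixes M :: "complex^2^2"
  assumes M: "hermitian_posdef M" and "v \<noteq> 0"
  obtains x :: "2 \<Rightarrow> complex^2" and k :: real where "\<And>\<alpha> \<beta>. sesq M (x \<alpha>) (x \<beta>) = (if \<alpha> = \<beta> then 1 else 0)"
    "x 1 = of_real k *s v" "0 < k" "x 1 $ 1 * x 2 $ 2 - x 1 $ 2 * x 2 $ 1 \<noteq> 0"
proof -
  have normalise: "\<exists>k>0. sesq M (of_real k *s u) (of_real k *s u) = 1" if "u \<noteq> 0" for u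
  proof (intro exI conjI)
    let ?n = "Re (sesq M u u)"
    have n: "0 < ?n" by (rule hermitian_posdef_pos[OF M that])
    show "0 < 1 / sqrt ?n" using n by simp
    show "sesq M (of_real (1 / sqrt ?n) *s u) (of_real (1 / sqrt ?n) *s u) = 1"
      by (subst hermitian_posdef_real[OF M])
         (use n in \<open>simp add: sesq_smult_left sesq_smult_right real_sqrt_mult_self flip: of_real_mult of_real_divide\<close>)
  qed
  obtain k where k: "0 < k" "sesq M (of_real k *s v) (of_real k *s v) = 1" using normalise[OF assms(2)] by blast
  define x1 where "x1 = of_real k *s v"
  have x1: "x1 \<noteq> 0" using k assms(2) by (simp add: x1_def vec_eq_iff)
  \<comment> \<open>\<open>u\<close> spans the orthogonal complement of \<open>x1\<close>: its
    entries are the pairings of the axes with \<open>x1\<close>, swapped and with one sign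
    changed.\<close>
  define u :: "complex^2" where "u = (\<chi> i. if i = 1 then sesq M (axis 2 1) x1 else - sesq M (axis 1 1) x1)"
  have s: "sesq M w x1 = w $ 1 * sesq M (axis 1 1) x1 + w $ 2 * sesq M (axis 2 1) x1" for w
    by (subst vec2_expand[of w]) (simp add: sesq_add_left sesq_smult_left)
  have "u \<noteq> 0"
  proof
    assume "u = 0"
    then have "sesq M (axis 1 1) x1 = 0" "sesq M (axis 2 1) x1 = 0"
      by (simp_all add: u_def vec_eq_iff forall_2)
    then have "sesq M x1 x1 = 0" by (subst s) simp
    then show False using k by (simp add: x1_def)
  qed
  then obtain l where l: "0 < l" "sesq M (of_real l *s u) (of_real l *s u) = 1" using normalise by blast
  define x2 where "x2 = of_real l *s u"
  have 21: "sesq M x2 x1 = 0" unfolding x2_def sesq_smult_left by (subst s) (simp add: u_def)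
  then have 12: "sesq M x1 x2 = 0" using hermitian_posdef_cnj[OF M, of x2 x1] by simp
  define x where "x = (\<lambda>i::2. if i = 1 then x1 else x2)"
  have on: "sesq M (x \<alpha>) (x \<beta>) = (if \<alpha> = \<beta> then 1 else 0)" for \<alpha> \<beta>
    using k l 12 21 exhaust_2[of \<alpha>] exhaust_2[of \<beta>] by (auto simp: x_def x1_def x2_def)
  \<comment> \<open>The polarised determinant of the Gram matrix with itself is twice its
    determinant, here \<open>2\<close>; by the scaling rule a vanishing frame determinant would make
    it zero.\<close>
  have "mixed_disc (\<chi> \<alpha> \<beta>. sesq M (x \<alpha>) (x \<beta>)) (\<chi> \<alpha> \<beta>. sesq M (x \<alpha>) (x \<beta>)) = 2" by (simp add: mixed_disc_def on)
  then have "x 1 $ 1 * x 2 $ 2 - x 1 $ 2 * x 2 $ 1 \<noteq> 0" unfolding mixed_disc_pullback by auto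
  then show thesis using that[of x k] on k by (simp add: x_def x1_def)
qed

lemma smooth_on_vec_nth: "open S \<Longrightarrow> smooth_on S f \<Longrightarrow> smooth_on S (\<lambda>y. f y $ i)"
  by (rule smooth_on_bounded_linear[OF bounded_linear_vec_nth])

lemma mixed_disc_pullback_zero:
  assumes "\<And>b a. mixed_disc H (curvature_mat H' z b a) = 0" "\<And>v w. sesq G v w = sesq H (J v) (J w)"
    "\<And>b a c d. curvature4 G' z' b a c d = curvature4 H' z (J b) (J a) (J c) (J d)"
  shows "mixed_disc G (curvature_mat G' z' b a) = 0"
proof -
  have "G = (\<chi> \<alpha> \<beta>. sesq H (J (axis \<alpha> 1)) (J (axis \<beta> 1)))"
    by (simp add: vec_eq_iff assms(2)[symmetric] sesq_axis)
  moreover have "curvature_mat G' z' b a = (\<chi> \<alpha> \<beta>. sesq (curvature_mat H' z (J b) (J a)) (J (axis \<alpha> 1)) (J (axis \<beta> 1)))"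
    by (simp add: curvature_mat curvature_mat_def[of G'] assms(3))
  ultimately show ?thesis
    using mixed_disc_pullback[of H "\<lambda>\<alpha>. J (axis \<alpha> 1)" "curvature_mat H' z (J b) (J a)"] assms(1) by simp
qed

text \<open>A Kaehler metric in new holomorphic coordinates. The instance in view is the quadratic
  map that defines normal coordinates, for which the condition on the determinant holds only near
  the centre.\<close>

locale kaehler_pullback = local_kaehler +
  fixes S' :: "(complex^2) set" and p :: "complex^2 \<Rightarrow> complex^2"
  assumes S': "open S'" and hol: "holomorphic_map_on S' p" and pS: "p ` S' \<subseteq> S"
    and det: "\<And>y. y \<in> S' \<Longrightarrow> frechet_derivative p (at y) e1 $ 1 * frechet_derivative p (at y) e2 $ 2
      - frechet_derivative p (at y) e1 $ 2 * frechet_derivative p (at y) e2 $ 1 \<noteq> 0"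
begin

abbreviation J where "J y \<equiv> frechet_derivative p (at y)"

definition G :: "complex^2 \<Rightarrow> complex^2^2" where
  "G y = (\<chi> \<alpha> \<beta>. sesq (H (p y)) (J y (axis \<alpha> 1)) (J y (axis \<beta> 1)))"

lemma J_lin:
  assumes "y \<in> S'"
  shows "J y (a *s v) = a *s J y v" "J y (u + v) = J y u + J y v"
  using holomorphic_dz_vec(3,4)[OF hol assms] by (auto intro: linear_add has_derivative_linear)

lemma sesq_G: "y \<in> S' \<Longrightarrow> sesq (G y) v w = sesq (H (p y)) (J y v) (J y w)"
  unfolding G_def
  by (rule sesq_eq_matrix) (simp_all add: J_lin sesq_add_left sesq_add_right sesq_smult_left sesq_smult_right)

lemma holJ: "holomorphic_map_on S' (\<lambda>y. J y v)"
  by (rule holomorphic_map_on_frechet_derivative[OF S' hol])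

lemma smp: "smooth_on S' p" by (rule holomorphic_map_on_smooth[OF S' hol])

lemma smooth_H_p: "smooth_on S' (\<lambda>y. H (p y) $ \<alpha> $ \<beta>)"
  by (rule smooth_on_compose[OF S' S pS sm smp])

lemma smooth_G: "smooth_on S' (\<lambda>y. G y $ \<alpha> $ \<beta>)"
proof -
  have "smooth_on S' (\<lambda>y. sesq (H (p y)) (J y (axis \<alpha> 1)) (J y (axis \<beta> 1)))"
    unfolding sesq_def
    by (intro smooth_on_sum smooth_on_mult smooth_on_cnj S' smooth_H_p smooth_on_vec_nth holomorphic_map_on_smooth[OF S' holJ])
  then show ?thesis by (simp add: G_def)
qed

lemma J_inj: "y \<in> S' \<Longrightarrow> v \<noteq> 0 \<Longrightarrow> J y v \<noteq> 0"
proof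
  assume y: "y \<in> S'" and v: "v \<noteq> 0" and 0: "J y v = 0"
  have "J y v = v $ 1 *s J y e1 + v $ 2 *s J y e2"
    by (subst vec2_expand[of v]) (simp only: J_lin[OF y])
  then have "v $ 1 = 0 \<and> v $ 2 = 0" using det2_inj[OF det[OF y]] 0 by simp
  then show False using v by (simp add: vec_eq_iff forall_2)
qed

lemma posdef_G: "y \<in> S' \<Longrightarrow> hermitian_posdef (G y)"
proof -
  assume y: "y \<in> S'"
  then have p: "hermitian_posdef (H (p y))" using pS pd by blast
  have "G y $ \<beta> $ \<alpha> = cnj (G y $ \<alpha> $ \<beta>)" for \<alpha> \<beta> by (simp add: G_def hermitian_posdef_cnj[OF p])
  moreover have "0 < Re (sesq (G y) v v)" if "v \<noteq> 0" for v
    by (simp add: sesq_G y hermitian_posdef_pos[OF p] J_inj[OF y that])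
  ultimately show ?thesis unfolding hermitian_posdef_def by blast
qed

lemma surj_J: "y \<in> S' \<Longrightarrow> surj (J y)"
proof -
  assume y: "y \<in> S'"
  have l: "linear (J y)" using holomorphic_dz_vec(4)[OF hol y] has_derivative_linear by blast
  then have "inj (J y)" using J_inj[OF y] by (auto simp: linear_injective_0)
  then show ?thesis using l linear_injective_imp_surjective by blast
qed

lemma curvature4_G: "y \<in> S' \<Longrightarrow> curvature4 G y b a c d = curvature4 H (p y) (J y b) (J y a) (J y c) (J y d)"
  by (rule curvature4_pullback[OF S' S hol pS sm smooth_G]) (use pS in \<open>auto simp: sesq_G pd posdef_G surj_J\<close>)

lemma mixed_disc_G: "y \<in> S' \<Longrightarrow> (\<And>b a. mixed_disc (H (p y)) (curvature_mat H (p y) b a) = 0) \<Longrightarrow> mixed_disc (G y) (curvature_mat G y b a) = 0"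
  by (rule mixed_disc_pullback_zero[of "H (p y)" H "p y" "G y" "J y"]) (simp_all add: sesq_G curvature4_G)

text \<open>The second summand carries the second derivative of \<open>p\<close>, the free quantity
  with which normal coordinates cancel the first derivative of the metric.\<close>

lemma dz_G:
  assumes y: "y \<in> S'"
  shows "dz a (\<lambda>y. sesq (G y) b c) y = dz (J y a) (h (J y b) (J y c)) (p y) +
    sesq (H (p y)) (frechet_derivative (\<lambda>y. J y b) (at y) a) (J y c)"
proof -
  have py: "p y \<in> S" using pS y by blast
  have nth: "(\<lambda>y. J y v $ i) differentiable (at y)" for v i
    by (rule smooth_on_differentiable[OF smooth_on_vec_nth[OF S' holomorphic_map_on_smooth[OF S' holJ]] y])
  have "dz a (\<lambda>y. sesq (G y) b c) y = dz a (\<lambda>y. sesq (H (p y)) (J y b) (J y c)) y"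
    by (rule dz_cong_open[OF S' y sesq_G])
  also have "\<dots> = sesq (dz_mat a (\<lambda>y. H (p y)) y) (J y b) (J y c) + sesq (H (p y)) (dz_vec a (\<lambda>y. J y b) y) (J y c)"
    by (subst dz_sesq(1)) (simp_all add: nth smooth_on_differentiable[OF smooth_H_p y] holomorphic_dz_vec(2)[OF holJ y])
  also have "dz_mat a (\<lambda>y. H (p y)) y = dz_mat (J y a) H (p y)"
    by (simp add: dz_mat_def vec_eq_iff dz_compose_holomorphic(1)[OF hol y df[OF py]])
  finally show ?thesis by (simp add: holomorphic_dz_vec(1)[OF holJ y] dz_sesq_const(1)[OF df[OF py]])
qed

text \<open>Both summands of \<open>dz_G\<close> are symmetric, one by the Kaehler condition and the
  other by symmetry of the second derivatives of \<open>p\<close>.\<close>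

lemma kaehler_G: "local_kaehler S' G"
proof
  fix y a b c assume y: "y \<in> S'"
  have py: "p y \<in> S" using pS y by blast
  show "dz a (\<lambda>y. sesq (G y) b c) y = dz b (\<lambda>y. sesq (G y) a c) y"
    unfolding dz_G[OF y] symmetric_second_derivative[OF smp S' y, of a b] by (simp only: sym[OF py, of "J y a"])
qed (rule S' smooth_G posdef_G | assumption)+

end

lemma has_derivative_quadratic:
  fixes z0 x1 x2 B11 B12 B22 :: "complex^2"
  shows "((\<lambda>w. z0 + w $ 1 *s x1 + w $ 2 *s x2 - (1/2) *s ((w $ 1)\<^sup>2 *s B11 + (2 * w $ 1 * w $ 2) *s B12 + (w $ 2)\<^sup>2 *s B22))
    has_derivative (\<lambda>v. v $ 1 *s x1 + v $ 2 *s x2 - ((w $ 1 * v $ 1) *s B11 + (w $ 1 * v $ 2 + w $ 2 * v $ 1) *s B12 + (w $ 2 * v $ 2) *s B22))) (at w)"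
  by (rule has_derivative_vec_componentwise)
     (auto intro!: derivative_eq_intros bounded_linear.has_derivative[OF bounded_linear_vec_nth] simp: field_simps)

context local_kaehler
begin

lemma \<Gamma>_add: "y \<in> S \<Longrightarrow> \<Gamma> (b + b') c y = \<Gamma> b c y + \<Gamma> b' c y"
  by (rule \<Gamma>_eqI) (simp_all add: \<Gamma> sesq_add_left dz_dir_add[OF h_differentiable h_differentiable])

lemma \<Gamma>_smult: "y \<in> S \<Longrightarrow> \<Gamma> (k *s b) c y = k *s \<Gamma> b c y"
  by (rule \<Gamma>_eqI) (simp_all add: \<Gamma> sesq_smult_left dz_h_linear)

lemma \<Gamma>_right:
  assumes "y \<in> S"
  shows "\<Gamma> b (c + c') y = \<Gamma> b c y + \<Gamma> b c' y" "\<Gamma> b (k *s c) y = k *s \<Gamma> b c y"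
  unfolding \<Gamma>_commute[OF assms, of b] by (simp_all add: \<Gamma>_add \<Gamma>_smult assms)

text \<open>Reduction to the normal form: a unitary frame whose first vector is proportional to the
  minimising direction, and quadratic coordinates in which the first derivatives of the metric
  vanish at the point.\<close>

lemma RC_at_minimum:
  assumes z0: "z0 \<in> S" and ric: "\<And>y b a. y \<in> S \<Longrightarrow> mixed_disc (H y) (curvature_mat H y b a) = 0"
    and min: "\<And>y v. y \<in> S \<Longrightarrow> m * (Re (sesq (H y) v v))\<^sup>2 \<le> Re (curvature4 H y v v v v)"
    and v0: "v0 \<noteq> 0" "Re (curvature4 H z0 v0 v0 v0 v0) = m * (Re (sesq (H z0) v0 v0))\<^sup>2" and m: "m \<noteq> 0"
    and v: "v \<noteq> 0"
  shows "\<exists>u. 0 < Re (curvature4 H z0 u u v v)"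
proof -
  obtain x :: "2 \<Rightarrow> complex^2" and k where on: "\<And>\<alpha> \<beta>. sesq (H z0) (x \<alpha>) (x \<beta>) = (if \<alpha> = \<beta> then 1 else 0)"
    and x1: "x 1 = of_real k *s v0" "0 < k" and dt: "x 1 $ 1 * x 2 $ 2 - x 1 $ 2 * x 2 $ 1 \<noteq> 0"
    using ex_orthonormal_basis[OF pd[OF z0] v0(1)] by metis
  define B where "B i j = \<Gamma> (x i) (x j) z0" for i j
  have B21: "B 2 1 = B 1 2" unfolding B_def by (rule \<Gamma>_commute[OF z0])
  \<comment> \<open>The quadratic correction is minus one half of the connection in the frame
    \<open>x\<close>, so the second derivative of \<open>p\<close> at the origin is exactly what
    removes the first derivatives of the pulled-back metric.\<close>
  define p where "p w = z0 + w $ 1 *s x 1 + w $ 2 *s x 2 - (1/2) *s ((w $ 1)\<^sup>2 *s B 1 1 + (2 * w $ 1 * w $ 2) *s B 1 2 + (w $ 2)\<^sup>2 *s B 2 2)" for w :: "complex^2"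
  define D where "D w v = v $ 1 *s x 1 + v $ 2 *s x 2 - ((w $ 1 * v $ 1) *s B 1 1 + (w $ 1 * v $ 2 + w $ 2 * v $ 1) *s B 1 2 + (w $ 2 * v $ 2) *s B 2 2)" for w v :: "complex^2"
  have pD: "(p has_derivative D w) (at w)" for w
    unfolding p_def[abs_def] D_def[abs_def] by (rule has_derivative_quadratic)
  have fp: "frechet_derivative p (at w) = D w" for w by (rule frechet_derivative_eq[OF pD])
  define Q where "Q a b = (a $ 1 * b $ 1) *s B 1 1 + (a $ 1 * b $ 2 + a $ 2 * b $ 1) *s B 1 2 + (a $ 2 * b $ 2) *s B 2 2" for a b :: "complex^2"
  have DD: "((\<lambda>w. D w b) has_derivative (\<lambda>a. - Q a b)) (at w)" for w b
    unfolding D_def Q_def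
    by (rule has_derivative_vec_componentwise)
       (auto intro!: derivative_eq_intros bounded_linear.has_derivative[OF bounded_linear_vec_nth] simp: field_simps)
  have hol: "holomorphic_map_on T p" for T
    unfolding holomorphic_map_on_def
  proof
    fix w
    have "\<forall>a v. D w (a *s v) = a *s D w v" by (simp add: D_def vec_eq_iff algebra_simps)
    then show "\<exists>D. (p has_derivative D) (at w) \<and> (\<forall>a v. D (a *s v) = a *s D v)" using pD by blast
  qed
  define dd where "dd w = D w e1 $ 1 * D w e2 $ 2 - D w e1 $ 2 * D w e2 $ 1" for w
  have Dc: "continuous_on UNIV (\<lambda>w. D w b $ i)" for b i
    using bounded_linear.has_derivative[OF bounded_linear_vec_nth DD, THEN has_derivative_continuous]
    by (intro continuous_at_imp_continuous_on ballI)
  have dc: "continuous_on UNIV dd" unfolding dd_def[abs_def] by (intro continuous_intros Dc)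
  have pc: "continuous_on UNIV p"
    by (intro continuous_at_imp_continuous_on ballI has_derivative_continuous[OF pD])
  \<comment> \<open>The quadratic map is a coordinate change only near the origin; the second
    condition keeps its Jacobian determinant away from zero.\<close>
  define S' where "S' = p -` S \<inter> dd -` (- {0})"
  have S': "open S'" unfolding S'_def
    by (intro open_Int open_vimage S pc dc) (simp add: open_Compl)
  have p0: "p 0 = z0" by (simp add: p_def)
  have D0: "D 0 v = v $ 1 *s x 1 + v $ 2 *s x 2" for v by (simp add: D_def)
  have De: "D 0 e1 = x 1" "D 0 e2 = x 2" by (simp_all add: D0 axis_def)
  have 0: "0 \<in> S'" using z0 dt by (simp add: S'_def p0 dd_def De)
  interpret P: kaehler_pullback S H S' p
    by unfold_locales (rule S' hol | auto simp: S'_def fp dd_def)+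
  have G0: "P.G 0 = mat 1"
    using exhaust_2 by (auto simp: P.G_def fp p0 De on vec_eq_iff forall_2 mat_def)
  have G1: "dz a (\<lambda>y. sesq (P.G y) b c) 0 = 0" for a b c
  proof -
    have "\<Gamma> (D 0 a) (D 0 b) z0 = Q a b"
      unfolding D0 Q_def \<Gamma>_add[OF z0] \<Gamma>_smult[OF z0] \<Gamma>_right[OF z0] B_def[symmetric]
      by (simp add: B21 vec_eq_iff algebra_simps)
    then have "dz (D 0 a) (h (D 0 b) (D 0 c)) z0 = sesq (H z0) (Q a b) (D 0 c)"
      using \<Gamma>[OF z0, of "D 0 a" "D 0 b" "D 0 c"] by simp
    then show ?thesis
      unfolding P.dz_G[OF 0] fp p0 frechet_derivative_eq[OF DD] by (simp add: sesq_minus_left)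
  qed
  interpret N: kaehler_normal S' P.G 0
  proof -
    interpret LG: local_kaehler S' P.G by (rule P.kaehler_G)
    show "kaehler_normal S' P.G 0"
      by unfold_locales (use 0 G0 G1 P.mixed_disc_G ric P.pS in \<open>auto simp: image_subset_iff\<close>)
  qed
  \<comment> \<open>\<open>k\<close> scales \<open>v0\<close> to unit length and the curvature is
    homogeneous of degree four, so the normal form sees the minimum \<open>m\<close> as its
    \<open>A\<close>.\<close>
  have "N.A = k^4 * Re (curvature4 H z0 v0 v0 v0 v0)"
    unfolding N.A_def P.curvature4_G[OF 0] fp De p0 x1 curvature4_smult
    by (simp add: power4_eq_xxxx mult.assoc flip: of_real_mult)
  also have "\<dots> = m * (k\<^sup>2 * Re (sesq (H z0) v0 v0))\<^sup>2"
    unfolding v0(2) by (simp add: power_mult_distrib flip: power_mult)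
  also have "k\<^sup>2 * Re (sesq (H z0) v0 v0) = Re (sesq (H z0) (x 1) (x 1))"
    by (simp add: x1 sesq_smult_left sesq_smult_right power2_eq_square mult.assoc flip: of_real_mult)
  finally have NA: "N.A = m" by (simp add: on)
  obtain v' where v': "D 0 v' = v" using P.surj_J[OF 0] unfolding fp by (metis surjD)
  then have "v' \<noteq> 0" using v by (auto simp: D0)
  then have "\<exists>u. 0 < Re (curvature4 P.G 0 u u v' v')"
    using N.RC_at_normal_minimum[unfolded NA] m min P.pS by (auto simp: P.curvature4_G P.sesq_G image_subset_iff)
  then show ?thesis unfolding P.curvature4_G[OF 0] fp p0 v' by blast
qed

text \<open>The claim concerns one point only, so a linear change to a unitary frame
  \<open>E\<close> reaches \<open>kaehler_quartic\<close> without normalising derivatives of the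
  metric.\<close>

lemma nonneg_imp_curvature4_zero:
  assumes z0: "z0 \<in> S" and ric: "\<And>b a. mixed_disc (H z0) (curvature_mat H z0 b a) = 0"
    and nn: "\<And>v. 0 \<le> Re (curvature4 H z0 v v v v)"
  shows "curvature4 H z0 b a c d = 0"
proof -
  obtain x :: "2 \<Rightarrow> complex^2" and k where on: "\<And>\<alpha> \<beta>. sesq (H z0) (x \<alpha>) (x \<beta>) = (if \<alpha> = \<beta> then 1 else 0)"
    and "0 < (k::real)" and dt: "x 1 $ 1 * x 2 $ 2 - x 1 $ 2 * x 2 $ 1 \<noteq> 0"
    using ex_orthonormal_basis[OF pd[OF z0], of e1] by (metis axis_eq_0_iff zero_neq_one)
  define E where "E v = v $ 1 *s x 1 + v $ 2 *s x 2" for v :: "complex^2"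
  have E: "E (a *s v) = a *s E v" "E (u + v) = E u + E v" for a u v
    by (simp_all add: E_def vec_eq_iff algebra_simps)
  have Ee: "E e1 = x 1" "E e2 = x 2" by (simp_all add: E_def axis_def)
  have "kaehler_quartic (\<lambda>b a c d. curvature4 H z0 (E b) (E a) (E c) (E d))"
  proof
    fix b a
    have "of_real ((cmod (x 1 $ 1 * x 2 $ 2 - x 1 $ 2 * x 2 $ 1))\<^sup>2) * mixed_disc (H z0) (curvature_mat H z0 (E b) (E a)) = 0"
      by (simp add: ric)
    then show "curvature4 H z0 (E b) (E a) (E e1) (E e1) + curvature4 H z0 (E b) (E a) (E e2) (E e2) = 0"
      unfolding mixed_disc_pullback[symmetric] by (simp add: mixed_disc_def on curvature_mat Ee)
  qed (simp_all add: E curvature4_add curvature4_smult curvature4_cnj z0, rule curvature4_sym[OF z0])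
  then have K0: "curvature4 H z0 (E b) (E a) (E c) (E d) = 0" for b a c d
    by (rule kaehler_quartic.nonneg_imp_zero) (rule nn)
  have "r *\<^sub>R v = complex_of_real r *s v" for r and v :: "complex^2" by (simp add: vec_eq_iff complex_eq_iff)
  then have "E (r *\<^sub>R v) = r *\<^sub>R E v" for r v by (simp only: E(1))
  then have "linear E" by (intro linearI E(2))
  moreover have "v = 0" if "E v = 0" for v
    using det2_inj[OF dt, of "v $ 1" "v $ 2"] that unfolding E_def by (simp add: vec_eq_iff forall_2)
  ultimately have "inj E" using linear_injective_0 by blast
  then have "surj E" using \<open>linear E\<close> linear_injective_imp_surjective by blast
  then obtain b' a' c' d' where "b = E b'" "a = E a'" "c = E c'" "d = E d'" by (metis surjD)
  then show ?thesis using K0 by simp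
qed

end

section \<open>Charts and metrics on a manifold\<close>

lemma matrix_complex_linear:
  assumes "\<And>a v. f (a *s v) = a *s f v" "\<And>u v. f (u + v) = f u + (f v :: complex^'m)"
  shows "matrix f *v v = f (v :: complex^'n)"
proof -
  have "f 0 = 0" using assms(1)[of 0 0] by simp
  then have s: "f (\<Sum>j\<in>I. g j) = (\<Sum>j\<in>I. f (g j))" for g :: "'n \<Rightarrow> complex^'n" and I
    by (induction I rule: infinite_finite_induct) (simp_all add: assms(2))
  have "f v = f (\<Sum>j\<in>UNIV. v $ j *s axis j 1)" by (simp add: basis_expansion)
  also have "\<dots> = (\<Sum>j\<in>UNIV. v $ j *s f (axis j 1))" by (simp add: s assms(1))
  finally show ?thesis by (simp add: vec_eq_iff matrix_vector_mult_def matrix_def mult.commute)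
qed

definition chart_inv :: "('a, 'n::finite) chart \<Rightarrow> complex^'n \<Rightarrow> 'a" where
  "chart_inv c = inv_into (fst c) (snd c)"

locale complex_manifold_atlas =
  fixes X :: "'a topology" and \<A> :: "('a, 'n::finite) chart set"
  assumes manifold: "complex_manifold X \<A>"
begin

context
  fixes c assumes c: "c \<in> \<A>"
begin

lemma open_chart: "openin X (fst c)" and open_image: "open (chart_image c)"
  and homeo: "homeomorphic_map (subtopology X (fst c)) (top_of_set (chart_image c)) (snd c)"
  using manifold c unfolding complex_manifold_def by blast+

lemma topspace_chart: "topspace (subtopology X (fst c)) = fst c"
  using openin_subset[OF open_chart] by auto

lemma chart_subset: "fst c \<subseteq> topspace X" by (rule openin_subset[OF open_chart])

lemma inj_chart: "inj_on (snd c) (fst c)"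
  using homeomorphic_imp_injective_map[OF homeo] unfolding topspace_chart .

lemma chart_in: "x \<in> fst c \<Longrightarrow> snd c x \<in> chart_image c" by (simp add: chart_image_def)

lemma chart_inv [simp]: "x \<in> fst c \<Longrightarrow> chart_inv c (snd c x) = x"
  unfolding chart_inv_def by (rule inv_into_f_f[OF inj_chart])

lemma chart_inv_in [simp]: "z \<in> chart_image c \<Longrightarrow> chart_inv c z \<in> fst c"
  unfolding chart_inv_def chart_image_def by (rule inv_into_into)

lemma chart_chart_inv [simp]: "z \<in> chart_image c \<Longrightarrow> snd c (chart_inv c z) = z"
  unfolding chart_inv_def chart_image_def by (rule f_inv_into_f)

lemma openin_chart_preimage:
  assumes "open W" shows "openin X {x \<in> fst c. snd c x \<in> W}"
proof -
  have "openin (subtopology X (fst c)) {x \<in> topspace (subtopology X (fst c)). snd c x \<in> W \<inter> chart_image c}"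
    by (rule openin_continuous_map_preimage[OF homeomorphic_imp_continuous_map[OF homeo]])
       (use assms in \<open>auto simp: openin_open\<close>)
  moreover have "{x \<in> topspace (subtopology X (fst c)). snd c x \<in> W \<inter> chart_image c} = {x \<in> fst c. snd c x \<in> W}"
    unfolding topspace_chart using chart_in by auto
  ultimately show ?thesis using openin_open_subtopology[OF open_chart] by simp
qed

lemma open_chart_image:
  assumes "openin X U" shows "open (snd c ` (fst c \<inter> U))"
proof -
  have "openin (subtopology X (fst c)) (fst c \<inter> U)"
    using assms openin_open_subtopology[OF open_chart] open_chart by (simp add: openin_Int)
  then have "openin (top_of_set (chart_image c)) (snd c ` (fst c \<inter> U))"
    using homeomorphic_imp_open_map[OF homeo] unfolding open_map_def by blast
  then show ?thesis using openin_open_trans[OF _ open_image] by blast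
qed

lemma compactin_chart_preimage:
  assumes "compact W" "W \<subseteq> chart_image c" shows "compactin X {x \<in> fst c. snd c x \<in> W}"
proof -
  let ?U = "{x \<in> fst c. snd c x \<in> W}"
  have "snd c ` ?U = W" using assms(2) by (force simp: chart_image_def)
  then have "compactin (top_of_set (chart_image c)) (snd c ` ?U)"
    using assms by (simp add: compactin_subtopology)
  then have "compactin (subtopology X (fst c)) ?U"
    using homeomorphic_map_compactness[OF homeo, of ?U] unfolding topspace_chart by blast
  then show ?thesis by (simp add: compactin_subtopology)
qed

text \<open>This is where the Hausdorff property enters: compact subsets of \<open>X\<close> are
  closed, which later permits extension of functions by zero.\<close>

lemma closedin_chart_preimage:
  "compact W \<Longrightarrow> W \<subseteq> chart_image c \<Longrightarrow> closedin X {x \<in> fst c. snd c x \<in> W}"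
  using compactin_imp_closedin[OF _ compactin_chart_preimage] manifold
  unfolding complex_manifold_def by blast

end

lemma ex_chart: "x \<in> topspace X \<Longrightarrow> \<exists>c\<in>\<A>. x \<in> fst c"
  using manifold unfolding complex_manifold_def by blast

context
  fixes c d assumes c: "c \<in> \<A>" and d: "d \<in> \<A>"
begin

lemma open_overlap: "open (overlap c d)"
  unfolding overlap_def by (rule open_chart_image[OF c open_chart[OF d]])

lemma overlap_subset: "overlap c d \<subseteq> chart_image c"
  by (auto simp: overlap_def chart_image_def)

lemma transition_holomorphic: "holomorphic_map_on (overlap c d) (transition c d)"
  using manifold c d unfolding complex_manifold_def by blast

lemma transition_smooth: "smooth_on (overlap c d) (transition c d)"
  by (rule holomorphic_map_on_smooth[OF open_overlap transition_holomorphic])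

lemma transition_chart: "x \<in> fst c \<Longrightarrow> transition c d (snd c x) = snd d x"
  using chart_inv[OF c] by (simp add: transition_def chart_inv_def)

lemma overlap_chart_inv: "z \<in> overlap c d \<Longrightarrow> chart_inv c z \<in> fst c \<and> chart_inv c z \<in> fst d"
  using chart_inv[OF c] by (auto simp: overlap_def)

lemma transition_in: "z \<in> overlap c d \<Longrightarrow> transition c d z \<in> chart_image d"
  using overlap_chart_inv chart_in[OF d] by (simp add: transition_def chart_inv_def)

lemma overlap_in: "x \<in> fst c \<Longrightarrow> x \<in> fst d \<Longrightarrow> snd c x \<in> overlap c d"
  by (auto simp: overlap_def)

lemma transition_image: "transition c d ` overlap c d \<subseteq> chart_image d"
  using transition_in by blast

lemma transition_derivative:
  assumes "z \<in> overlap c d"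
  shows "holomorphic_tangent_bundle c d z *v v = frechet_derivative (transition c d) (at z) v"
  unfolding holomorphic_tangent_bundle_def
proof (rule matrix_complex_linear)
  note D = holomorphic_dz_vec(3,4)[OF transition_holomorphic assms]
  show "frechet_derivative (transition c d) (at z) (a *s v) = a *s frechet_derivative (transition c d) (at z) v" for a v
    by (rule D(1))
  show "frechet_derivative (transition c d) (at z) (u + v) =
      frechet_derivative (transition c d) (at z) u + frechet_derivative (transition c d) (at z) v" for u v
    by (rule linear_add[OF has_derivative_linear[OF D(2)]])
qed

end

end

lemma compact_space_finite_cover:
  assumes "compact_space X" "\<And>x. x \<in> topspace X \<Longrightarrow> openin X (U x) \<and> x \<in> U x"
  obtains F where "finite F" "F \<subseteq> topspace X" "topspace X \<subseteq> (\<Union>x\<in>F. U x)"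
proof -
  have c: "\<And>\<U>. (\<forall>U\<in>\<U>. openin X U) \<and> topspace X \<subseteq> \<Union>\<U> \<Longrightarrow>
      \<exists>\<F>. finite \<F> \<and> \<F> \<subseteq> \<U> \<and> topspace X \<subseteq> \<Union>\<F>"
    using assms(1) unfolding compact_space_def compactin_def by blast
  have "\<exists>\<F>. finite \<F> \<and> \<F> \<subseteq> U ` topspace X \<and> topspace X \<subseteq> \<Union>\<F>"
    by (rule c) (use assms(2) in auto)
  then obtain \<F> where F: "finite \<F>" "\<F> \<subseteq> U ` topspace X" "topspace X \<subseteq> \<Union>\<F>" by blast
  from finite_subset_image[OF F(1,2)] obtain G where "G \<subseteq> topspace X" "finite G" "\<F> = U ` G" by blast
  then show thesis using that[of G] F(3) by blast
qed

locale hermitian_manifold = complex_manifold_atlas X \<A> for X :: "'a topology" and \<A> :: "('a, 2) chart set" +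
  fixes g :: "('a, 2, 2) metric"
  assumes metric: "hermitian_metric \<A> holomorphic_tangent_bundle g"
begin

lemma local_hermitian: "c \<in> \<A> \<Longrightarrow> local_hermitian (chart_image c) (g c)"
  using metric open_image unfolding hermitian_metric_def local_hermitian_def by blast

context
  fixes c d z assumes c: "c \<in> \<A>" and d: "d \<in> \<A>" and z: "z \<in> overlap c d"
begin

abbreviation (input) T where "T \<equiv> frechet_derivative (transition c d) (at z)"

lemma sesq_transition: "sesq (g c z) v w = sesq (g d (transition c d z)) (T v) (T w)"
  using metric c d z unfolding hermitian_metric_def by (simp add: transition_derivative[OF c d])

lemma T_has_derivative: "(transition c d has_derivative T) (at z)"
  by (rule holomorphic_dz_vec(4)[OF transition_holomorphic[OF c d] z])

lemma zc: "z \<in> chart_image c" using overlap_subset[OF c d] z by blast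

lemma T_nonzero: "v \<noteq> 0 \<Longrightarrow> T v \<noteq> 0"
proof
  assume v: "v \<noteq> 0" and "T v = 0"
  then have "sesq (g c z) v v = 0" by (simp add: sesq_transition)
  then show False
    using hermitian_posdef_pos[OF local_hermitian.pd[OF local_hermitian[OF c] zc] v] by simp
qed

lemma T_surj: "surj T"
proof -
  have l: "linear T" using T_has_derivative has_derivative_linear by blast
  have "v = 0" if "T v = 0" for v using T_nonzero that by blast
  then have "inj T" using l linear_injective_0 by blast
  then show ?thesis using l linear_injective_imp_surjective by blast
qed

lemma curvature4_transition: "curvature4 (g c) z b a u v = curvature4 (g d) (transition c d z) (T b) (T a) (T u) (T v)"
proof (rule curvature4_pullback[OF open_overlap[OF c d] open_image[OF d] transition_holomorphic[OF c d] transition_image[OF c d]])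
  interpret C: local_hermitian "chart_image c" "g c" by (rule local_hermitian[OF c])
  interpret D: local_hermitian "chart_image d" "g d" by (rule local_hermitian[OF d])
  show "smooth_on (chart_image d) (\<lambda>y. g d y $ \<alpha> $ \<beta>)" for \<alpha> \<beta> by (rule D.sm)
  show "smooth_on (overlap c d) (\<lambda>y. g c y $ \<alpha> $ \<beta>)" for \<alpha> \<beta>
    by (rule smooth_on_subset[OF C.sm overlap_subset[OF c d]])
  show "sesq (g c y) v w = sesq (g d (transition c d y)) (frechet_derivative (transition c d) (at y) v)
      (frechet_derivative (transition c d) (at y) w)" if "y \<in> overlap c d" for y v w
    using metric c d that unfolding hermitian_metric_def by (simp add: transition_derivative[OF c d])
  show "hermitian_posdef (g d (transition c d z))" by (rule D.pd[OF transition_in[OF c d z]])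
  show "hermitian_posdef (g c z)" by (rule C.pd[OF zc])
qed (rule z T_surj)+

end

text \<open>Curvature is transported by the Jacobian of the transition, which is injective on
  \<open>v\<close> and surjective on \<open>u\<close>; that the direction is nonzero can be read off
  from positivity.\<close>

lemma RC_positive_at_chart:
  assumes c: "c \<in> \<A>" and x: "x \<in> fst c"
    and rc: "\<And>v. v \<noteq> 0 \<Longrightarrow> \<exists>u. 0 < Re (curvature4 (g c) (snd c x) u u v v)"
  shows "RC_positive_at \<A> g x"
  unfolding RC_positive_at_def curvature_form_curvature4
proof (intro ballI impI allI)
  fix d and v :: "complex^2" assume d: "d \<in> \<A>" and xd: "x \<in> fst d" and v: "v \<noteq> 0"
  have z: "snd d x \<in> overlap d c" by (rule overlap_in[OF d c xd x])
  let ?T = "frechet_derivative (transition d c) (at (snd d x))"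
  obtain u where u: "0 < Re (curvature4 (g c) (snd c x) u u (?T v) (?T v))"
    using rc[OF T_nonzero[OF d c z v]] by blast
  obtain u' where "?T u' = u" using T_surj[OF d c z] by (metis surjD)
  then have "0 < Re (curvature4 (g d) (snd d x) u' u' v v)"
    using u by (simp add: curvature4_transition[OF d c z] transition_chart[OF d c xd])
  moreover from this have "u' \<noteq> 0" by auto
  ultimately show "\<exists>u. u \<noteq> 0 \<and> 0 < Re (curvature4 (g d) (snd d x) u u v v)" by blast
qed

end

lemma curvature4_chern_curvature:
  fixes H :: "complex^2 \<Rightarrow> complex^2^2"
  shows "curvature4 H z (axis i 1) (axis j 1) (axis \<alpha> 1) (axis \<beta> 1) = chern_curvature H z i j \<alpha> \<beta>"
  using exhaust_2[of i] exhaust_2[of j] unfolding curvature4_def sesq_axis by (auto simp: sum_2 axis_def)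

context local_kaehler
begin

lemma continuous_on_curvature4 [continuous_intros]:
  assumes "continuous_on A z" "z ` A \<subseteq> S" "continuous_on A b" "continuous_on A a" "continuous_on A c" "continuous_on A d"
  shows "continuous_on A (\<lambda>t. curvature4 H (z t) (b t) (a t) (c t) (d t))"
proof -
  have "continuous_on A (\<lambda>t. chern_curvature H (z t) i j \<alpha> \<beta>)" for i j \<alpha> \<beta>
    unfolding curvature4_chern_curvature[symmetric]
    by (rule continuous_on_compose2[OF smooth_on_continuous[OF smooth_curvature4] assms(1,2)])
  then show ?thesis unfolding curvature4_def sesq_def
    by (intro continuous_intros assms) simp
qed

lemma continuous_on_sesq [continuous_intros]:
  assumes "continuous_on A z" "z ` A \<subseteq> S" "continuous_on A b" "continuous_on A c"
  shows "continuous_on A (\<lambda>t. sesq (H (z t)) (b t) (c t))"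
  unfolding sesq_def
  by (intro continuous_intros assms continuous_on_compose2[OF smooth_on_continuous[OF sm] assms(1,2)])

end

section \<open>The minimum of the holomorphic sectional curvature on the manifold\<close>

locale ricci_flat_manifold = hermitian_manifold +
  assumes kaehler: "kaehler_metric \<A> g" and compact: "compact_space X"
    and ricci: "ricci_flat \<A> g" and not_flat: "\<not> flat \<A> g"
begin

lemma local_kaehler: "c \<in> \<A> \<Longrightarrow> local_kaehler (chart_image c) (g c)"
  using local_hermitian.closed_imp_kaehler[OF local_hermitian] kaehler unfolding kaehler_metric_def by blast

lemma mixed_disc_zero: "c \<in> \<A> \<Longrightarrow> z \<in> chart_image c \<Longrightarrow> mixed_disc (g c z) (curvature_mat (g c) z b a) = 0"
  by (rule local_kaehler.ricci_flat_mixed_disc[OF local_kaehler]) (use ricci in \<open>auto simp: ricci_flat_def\<close>)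

text \<open>Curvature divided by the squared length squared is homogeneous of degree zero in the
  direction, so the Euclidean unit sphere of the chart, the same at every point, can replace the
  unit sphere of the metric.\<close>

lemma local_minimum:
  assumes c: "c \<in> \<A>" and K: "compact K" "K \<noteq> {}" "K \<subseteq> chart_image c"
  obtains z0 v0 m where "z0 \<in> K" "v0 \<noteq> 0" "Re (curvature4 (g c) z0 v0 v0 v0 v0) = m * (Re (sesq (g c z0) v0 v0))\<^sup>2"
    "\<And>z v. z \<in> K \<Longrightarrow> m * (Re (sesq (g c z) v v))\<^sup>2 \<le> Re (curvature4 (g c) z v v v v)"
proof -
  interpret L: local_kaehler "chart_image c" "g c" by (rule local_kaehler[OF c])
  define q where "q t = Re (curvature4 (g c) (fst t) (snd t) (snd t) (snd t) (snd t)) / (Re (sesq (g c (fst t)) (snd t) (snd t)))\<^sup>2" for t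
  let ?C = "K \<times> sphere (0::complex^2) 1"
  have pos: "0 < Re (sesq (g c z) v v)" if "z \<in> K" "v \<noteq> 0" for z v
    using hermitian_posdef_pos[OF L.pd] that K by blast
  have "continuous_on ?C q" unfolding q_def
  proof (intro continuous_intros)
    show "\<forall>x\<in>?C. (Re (sesq (g c (fst x)) (snd x) (snd x)))\<^sup>2 \<noteq> 0"
    proof
      fix x assume "x \<in> ?C"
      then have "fst x \<in> K" "snd x \<noteq> 0" by auto
      from pos[OF this] show "(Re (sesq (g c (fst x)) (snd x) (snd x)))\<^sup>2 \<noteq> 0" by simp
    qed
  qed (use K in auto)
  moreover have "compact ?C" by (intro compact_Times K compact_sphere)
  moreover have "?C \<noteq> {}" using K vector_choose_size[of 1] by (auto simp: times_eq_iff)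
  ultimately obtain t where t: "t \<in> ?C" "\<And>s. s \<in> ?C \<Longrightarrow> q t \<le> q s"
    using continuous_attains_inf[of ?C q] by blast
  show thesis
  proof (rule that[of "fst t" "snd t" "q t"])
    show 1: "fst t \<in> K" "snd t \<noteq> 0" using t(1) by auto
    show "Re (curvature4 (g c) (fst t) (snd t) (snd t) (snd t) (snd t)) = q t * (Re (sesq (g c (fst t)) (snd t) (snd t)))\<^sup>2"
      using pos[OF 1] by (simp add: q_def)
    fix z v assume z: "z \<in> K"
    show "q t * (Re (sesq (g c z) v v))\<^sup>2 \<le> Re (curvature4 (g c) z v v v v)"
    proof (cases "v = 0")
      case False
      define u where "u = complex_of_real (1 / norm v) *s v"
      have v: "v = complex_of_real (norm v) *s u" using False by (simp add: u_def vec_eq_iff)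
      have "norm u = 1" using False by (simp add: u_def norm_smult_complex norm_divide)
      then have u: "(z, u) \<in> ?C" "u \<noteq> 0" using z by auto
      have "q t * (Re (sesq (g c z) u u))\<^sup>2 \<le> Re (curvature4 (g c) z u u u u)"
        using t(2)[OF u(1)] pos[OF z u(2)] by (simp add: q_def pos_le_divide_eq)
      then have "(norm v)^4 * (q t * (Re (sesq (g c z) u u))\<^sup>2) \<le> (norm v)^4 * Re (curvature4 (g c) z u u u u)"
        by (intro mult_left_mono) auto
      moreover have "sesq (g c z) v v = of_real ((norm v)\<^sup>2) * sesq (g c z) u u"
        by (subst (1 2) v) (simp add: sesq_smult_left sesq_smult_right power2_eq_square)
      then have "Re (sesq (g c z) v v) = (norm v)\<^sup>2 * Re (sesq (g c z) u u)" by (simp flip: of_real_power)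
      moreover have "curvature4 (g c) z v v v v = of_real ((norm v)^4) * curvature4 (g c) z u u u u"
        by (subst (1 2 3 4) v) (simp add: curvature4_smult power4_eq_xxxx)
      then have "Re (curvature4 (g c) z v v v v) = (norm v)^4 * Re (curvature4 (g c) z u u u u)" by (simp flip: of_real_power)
      ultimately show ?thesis by (simp add: power_mult_distrib algebra_simps flip: power_mult)
    qed simp
  qed
qed

text \<open>Open chart balls cover the manifold while the minima are taken over the closed ones. The
  least of the finitely many minima is global because both sides of the inequality are independent
  of the chart.\<close>

lemma global_minimum:
  obtains c0 z0 v0 m where "c0 \<in> \<A>" "z0 \<in> chart_image c0" "v0 \<noteq> 0"
    "Re (curvature4 (g c0) z0 v0 v0 v0 v0) = m * (Re (sesq (g c0 z0) v0 v0))\<^sup>2"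
    "\<And>c z v. c \<in> \<A> \<Longrightarrow> z \<in> chart_image c \<Longrightarrow> m * (Re (sesq (g c z) v v))\<^sup>2 \<le> Re (curvature4 (g c) z v v v v)"
proof -
  have "\<exists>c r. c \<in> \<A> \<and> x \<in> fst c \<and> 0 < r \<and> cball (snd c x) r \<subseteq> chart_image c" if "x \<in> topspace X" for x
    using ex_chart[OF that] open_image chart_in open_contains_cball by metis
  then obtain c r where cr: "\<And>x. x \<in> topspace X \<Longrightarrow> c x \<in> \<A> \<and> x \<in> fst (c x) \<and> 0 < r x \<and> cball (snd (c x) x) (r x) \<subseteq> chart_image (c x)"
    by metis
  define U where "U x = {y \<in> fst (c x). snd (c x) y \<in> ball (snd (c x) x) (r x)}" for x
  have "openin X (U x) \<and> x \<in> U x" if "x \<in> topspace X" for x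
    using openin_chart_preimage[of "c x" "ball (snd (c x) x) (r x)"] cr[OF that] by (auto simp: U_def)
  then obtain F where F: "finite F" "F \<subseteq> topspace X" "topspace X \<subseteq> (\<Union>x\<in>F. U x)"
    using compact_space_finite_cover[OF compact] by metis
  let ?P = "\<lambda>x z0 v0 m. z0 \<in> cball (snd (c x) x) (r x) \<and> v0 \<noteq> 0 \<and>
      Re (curvature4 (g (c x)) z0 v0 v0 v0 v0) = m * (Re (sesq (g (c x) z0) v0 v0))\<^sup>2 \<and>
      (\<forall>z v. z \<in> cball (snd (c x) x) (r x) \<longrightarrow> m * (Re (sesq (g (c x) z) v v))\<^sup>2 \<le> Re (curvature4 (g (c x)) z v v v v))"
  have "\<exists>z0 v0 m. ?P x z0 v0 m" if "x \<in> topspace X" for x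
  proof -
    have "cball (snd (c x) x) (r x) \<noteq> {}" using cr[OF that] by auto
    from local_minimum[OF _ compact_cball this] cr[OF that] show ?thesis by metis
  qed
  then obtain z0 v0 m where P: "\<And>x. x \<in> topspace X \<Longrightarrow> ?P x (z0 x) (v0 x) (m x)" by metis
  \<comment> \<open>A metric on an empty manifold would be flat; so there is a point, and the finite
    cover is not empty.\<close>
  obtain d z where "d \<in> \<A>" "z \<in> chart_image d" using not_flat unfolding flat_def by blast
  then have "chart_inv d z \<in> topspace X" using chart_inv_in chart_subset by blast
  then have "F \<noteq> {}" using F(3) by blast
  define x0 where "x0 = arg_min_on m F"
  have x0: "x0 \<in> F" "\<And>y. y \<in> F \<Longrightarrow> m x0 \<le> m y"
    using arg_min_if_finite[OF F(1) \<open>F \<noteq> {}\<close>, of m] unfolding x0_def by (auto simp: not_less)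
  then have x0X: "x0 \<in> topspace X" using F(2) by blast
  show thesis
  proof (rule that[of "c x0" "z0 x0" "v0 x0" "m x0"])
    show "c x0 \<in> \<A>" "z0 x0 \<in> chart_image (c x0)" "v0 x0 \<noteq> 0"
      "Re (curvature4 (g (c x0)) (z0 x0) (v0 x0) (v0 x0) (v0 x0) (v0 x0)) = m x0 * (Re (sesq (g (c x0) (z0 x0)) (v0 x0) (v0 x0)))\<^sup>2"
      using cr[OF x0X] P[OF x0X] by auto
    fix d z v assume d: "d \<in> \<A>" and z: "z \<in> chart_image d"
    define y where "y = chart_inv d z"
    have y: "y \<in> fst d" "snd d y = z" using d z by (simp_all add: y_def)
    then have "y \<in> topspace X" using chart_subset[OF d] by blast
    then obtain x where x: "x \<in> F" "y \<in> U x" using F(3) by blast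
    then have xX: "x \<in> topspace X" using F(2) by blast
    have c: "c x \<in> \<A>" using cr[OF xX] by blast
    have yc: "y \<in> fst (c x)" "snd (c x) y \<in> cball (snd (c x) x) (r x)" using x(2) by (auto simp: U_def)
    have zo: "z \<in> overlap d (c x)" using overlap_in[OF d c y(1) yc(1)] y(2) by simp
    have t: "transition d (c x) z = snd (c x) y" using transition_chart[OF d c y(1)] y(2) by simp
    let ?T = "frechet_derivative (transition d (c x)) (at z)"
    have "m x0 * (Re (sesq (g d z) v v))\<^sup>2 \<le> m x * (Re (sesq (g d z) v v))\<^sup>2"
      by (rule mult_right_mono[OF x0(2)[OF x(1)]]) simp
    also have "\<dots> \<le> Re (curvature4 (g d) z v v v v)"
      unfolding curvature4_transition[OF d c zo] sesq_transition[OF d c zo] t using P[OF xX] yc(2) by blast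
    finally show "m x0 * (Re (sesq (g d z) v v))\<^sup>2 \<le> Re (curvature4 (g d) z v v v v)" .
  qed
qed

text \<open>If \<open>m\<close> were nonnegative, the holomorphic sectional curvature would be
  nonnegative everywhere, hence the curvature zero by trace-freeness and the metric flat.\<close>

lemma ex_RC_point:
  obtains c0 z0 where "c0 \<in> \<A>" "z0 \<in> chart_image c0" "\<And>v. v \<noteq> 0 \<Longrightarrow> \<exists>u. 0 < Re (curvature4 (g c0) z0 u u v v)"
proof -
  obtain c0 z0 v0 m where c0: "c0 \<in> \<A>" and z0: "z0 \<in> chart_image c0" and v0: "v0 \<noteq> 0"
    "Re (curvature4 (g c0) z0 v0 v0 v0 v0) = m * (Re (sesq (g c0 z0) v0 v0))\<^sup>2"
    and min: "\<And>c z v. c \<in> \<A> \<Longrightarrow> z \<in> chart_image c \<Longrightarrow> m * (Re (sesq (g c z) v v))\<^sup>2 \<le> Re (curvature4 (g c) z v v v v)"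
    using global_minimum by metis
  have "m < 0"
  proof (rule ccontr)
    assume "\<not> m < 0"
    then have "0 \<le> Re (curvature4 (g c) z v v v v)" if "c \<in> \<A>" "z \<in> chart_image c" for c z v
      using order_trans[OF _ min[OF that]] by simp
    then have "curvature4 (g c) z b a u v = 0" if "c \<in> \<A>" "z \<in> chart_image c" for c z b a u v
      using local_kaehler.nonneg_imp_curvature4_zero[OF local_kaehler[OF that(1)] that(2) mixed_disc_zero[OF that]] that by blast
    then have "flat \<A> g"
      using local_kaehler.curvature4_zero_imp_flat[OF local_kaehler] unfolding flat_def by blast
    then show False using not_flat by blast
  qed
  then have "\<exists>u. 0 < Re (curvature4 (g c0) z0 u u v v)" if "v \<noteq> 0" for v
    using local_kaehler.RC_at_minimum[OF local_kaehler[OF c0] z0 mixed_disc_zero[OF c0] min[OF c0] v0 _ that] by simp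
  with c0 z0 that show thesis by blast
qed

end

section \<open>A function that is subharmonic outside a small set\<close>

text \<open>The classical \<open>exp (- 1/x)\<close> extended by zero; polynomial factors in
  \<open>1/x\<close> make the family closed under differentiation.\<close>

definition flat_exp :: "real poly \<Rightarrow> real \<Rightarrow> real" where
  "flat_exp p x = (if x \<le> 0 then 0 else poly p (1 / x) * exp (- (1 / x)))"

lemma poly_exp_tendsto_0: "((\<lambda>t. poly p t * exp (- t)) \<longlongrightarrow> (0::real)) at_top"
proof -
  have "((\<lambda>t. \<Sum>i\<le>degree p. coeff p i * (t ^ i / exp t)) \<longlongrightarrow> (\<Sum>i\<le>degree p. coeff p i * (0::real))) at_top"
    by (intro tendsto_intros tendsto_power_div_exp_0)
  moreover have "(\<lambda>t. \<Sum>i\<le>degree p. coeff p i * (t ^ i / exp t)) = (\<lambda>t. poly p t * exp (- t))"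
    by (simp add: fun_eq_iff poly_altdef sum_distrib_right exp_minus divide_inverse mult.assoc)
  ultimately show ?thesis by simp
qed

text \<open>With \<open>t = 1/x\<close>, whose derivative is \<open>- t^2\<close>, the chain rule
  turns \<open>p t * exp (- t)\<close> into \<open>t^2 * (p t - p' t) * exp (- t)\<close>. At
  \<open>0\<close> both one-sided difference quotients tend to zero.\<close>

lemma flat_exp_has_derivative:
  "(flat_exp p has_real_derivative flat_exp (monom 1 2 * (p - pderiv p)) x) (at x)"
proof -
  consider "x < 0" | "x = 0" | "0 < x" by linarith
  then show ?thesis
  proof cases
    case 1
    have "((\<lambda>x. 0) has_real_derivative 0) (at x)" by simp
    then have "(flat_exp p has_real_derivative 0) (at x)"
      by (rule has_field_derivative_transform_within_open[of _ _ _ "{..<0}"])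
         (use 1 in \<open>auto simp: flat_exp_def\<close>)
    then show ?thesis using 1 by (simp add: flat_exp_def)
  next
    case 2
    have "((\<lambda>y. (flat_exp p y - flat_exp p 0) / (y - 0)) \<longlongrightarrow> 0) (at_left 0)"
      by (rule tendsto_eventually) (auto simp: eventually_at_filter flat_exp_def)
    moreover have "((\<lambda>y. (flat_exp p y - flat_exp p 0) / (y - 0)) \<longlongrightarrow> 0) (at_right 0)"
    proof -
      \<comment> \<open>The right difference quotient at \<open>0\<close> has an extra factor
        \<open>1/y\<close>, which \<open>pCons 0 p\<close> supplies.\<close>
      have "((\<lambda>y. poly (pCons 0 p) (inverse y) * exp (- inverse y)) \<longlongrightarrow> 0) (at_right (0::real))"
        by (rule filterlim_compose[OF poly_exp_tendsto_0 filterlim_inverse_at_top_right])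
      then show ?thesis
        by (rule Lim_transform_eventually)
           (auto simp: eventually_at_filter flat_exp_def field_simps inverse_eq_divide)
    qed
    ultimately have "((\<lambda>y. (flat_exp p y - flat_exp p 0) / (y - 0)) \<longlongrightarrow> 0) (at 0)"
      by (simp add: filterlim_at_split)
    then show ?thesis using 2 by (simp add: has_field_derivative_iff flat_exp_def)
  next
    case 3
    have "((\<lambda>x. poly p (1 / x) * exp (- (1 / x))) has_real_derivative
       poly (monom 1 2 * (p - pderiv p)) (1 / x) * exp (- (1 / x))) (at x)"
      using 3 by (auto intro!: derivative_eq_intros simp: poly_monom field_simps power2_eq_square)
    then have "(flat_exp p has_real_derivative poly (monom 1 2 * (p - pderiv p)) (1 / x) * exp (- (1 / x))) (at x)"
      by (rule has_field_derivative_transform_within_open[of _ _ _ "{0<..}"])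
         (use 3 in \<open>auto simp: flat_exp_def\<close>)
    then show ?thesis using 3 by (simp add: flat_exp_def)
  qed
qed

lemma smooth_flat_exp: "smooth_on UNIV (flat_exp p)"
proof -
  define q where "q n = ((\<lambda>p. monom 1 2 * (p - pderiv p)) ^^ n) p" for n
  have "smooth_on UNIV ((\<lambda>n. flat_exp (q n)) 0)"
    by (rule smooth_on_real_function) (simp add: q_def flat_exp_has_derivative)
  then show ?thesis by (simp add: q_def)
qed

lemma dz_real_compose:
  fixes s :: "complex^'n \<Rightarrow> real"
  assumes s: "s differentiable (at z)" and f: "(f has_real_derivative f') (at (s z))"
  shows "dz p (\<lambda>y. of_real (f (s y))) z = of_real f' * dz p (\<lambda>y. of_real (s y)) z"
    "dzb p (\<lambda>y. of_real (f (s y))) z = of_real f' * dzb p (\<lambda>y. of_real (s y)) z"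
proof -
  let ?D = "frechet_derivative s (at z)"
  have s': "(s has_derivative ?D) (at z)" using s by (simp add: frechet_derivative_works)
  have 1: "((\<lambda>y. complex_of_real (s y)) has_derivative (\<lambda>v. of_real (?D v))) (at z)"
    by (rule bounded_linear.has_derivative[OF bounded_linear_of_real s'])
  have "((\<lambda>y. f (s y)) has_derivative (\<lambda>v. f' * ?D v)) (at z)"
    by (rule has_derivative_compose[OF s' f[unfolded has_field_derivative_def]])
  then have 2: "((\<lambda>y. complex_of_real (f (s y))) has_derivative (\<lambda>v. of_real (f' * ?D v))) (at z)"
    by (rule bounded_linear.has_derivative[OF bounded_linear_of_real])
  show "dz p (\<lambda>y. of_real (f (s y))) z = of_real f' * dz p (\<lambda>y. of_real (s y)) z"
    "dzb p (\<lambda>y. of_real (f (s y))) z = of_real f' * dzb p (\<lambda>y. of_real (s y)) z"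
    unfolding dz_has_derivative[OF 1] dz_has_derivative[OF 2] dzb_has_derivative[OF 1] dzb_has_derivative[OF 2]
    by (simp_all add: field_simps)
qed

lemma smooth_on_of_real: "open S \<Longrightarrow> smooth_on S f \<Longrightarrow> smooth_on S (\<lambda>x. complex_of_real (f x))"
  by (rule smooth_on_bounded_linear[OF bounded_linear_of_real])

lemma dz_dzb_real_compose:
  fixes s :: "complex^'n \<Rightarrow> real"
  assumes S: "open S" "z \<in> S" and s: "smooth_on S s" and f: "\<And>x. (f has_real_derivative f' x) (at x)"
    "\<And>x. (f' has_real_derivative f'' x) (at x)"
  shows "dz p (dzb q (\<lambda>y. of_real (f (s y)))) z =
    of_real (f'' (s z)) * dz p (\<lambda>y. of_real (s y)) z * dzb q (\<lambda>y. of_real (s y)) z +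
    of_real (f' (s z)) * dz p (dzb q (\<lambda>y. of_real (s y))) z"
proof -
  have sd: "s differentiable (at y)" if "y \<in> S" for y by (rule smooth_on_differentiable[OF s that])
  have d1: "(\<lambda>y. complex_of_real (f' (s y))) differentiable (at z)"
  proof -
    have "(f' o s) differentiable (at z)"
      using differentiable_chain_at[OF sd[OF S(2)], of f'] f(2)[of "s z"] by (auto simp: differentiable_def has_field_derivative_def)
    then show ?thesis using bounded_linear.has_derivative[OF bounded_linear_of_real] unfolding differentiable_def o_def by blast
  qed
  have d2: "dzb q (\<lambda>y. complex_of_real (s y)) differentiable (at z)"
    by (rule smooth_on_differentiable[OF smooth_on_dzb[OF S(1) smooth_on_of_real[OF S(1) s]] S(2)])
  have "dz p (dzb q (\<lambda>y. of_real (f (s y)))) z = dz p (\<lambda>y. of_real (f' (s y)) * dzb q (\<lambda>y. of_real (s y)) y) z"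
    by (rule dz_cong_open[OF S]) (rule dz_real_compose(2)[OF sd f(1)])
  also have "\<dots> = dz p (\<lambda>y. of_real (f' (s y))) z * dzb q (\<lambda>y. of_real (s y)) z + of_real (f' (s z)) * dz p (dzb q (\<lambda>y. of_real (s y))) z"
    by (rule dz_mult[OF d1 d2])
  finally show ?thesis by (simp add: dz_real_compose(1)[OF sd[OF S(2)] f(2)])
qed

definition hess :: "(complex^2 \<Rightarrow> complex) \<Rightarrow> complex^2 \<Rightarrow> complex^2^2" where
  "hess f z = (\<chi> \<alpha> \<beta>. dz (axis \<alpha> 1) (dzb (axis \<beta> 1) f) z)"

lemma sesq_hess:
  assumes "open S" "smooth_on S f" "z \<in> S"
  shows "sesq (hess f z) u w = dz u (dzb w f) z"
proof -
  have fd: "f differentiable (at y)" if "y \<in> S" for y by (rule smooth_on_differentiable[OF assms(2) that])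
  have bd: "dzb v f differentiable (at z)" for v
    by (rule smooth_on_differentiable[OF smooth_on_dzb[OF assms(1,2)] assms(3)])
  show ?thesis unfolding hess_def
  proof (rule sesq_eq_matrix)
    fix u v w :: "complex^2" and k :: complex
    show "dz (u + v) (dzb w f) z = dz u (dzb w f) z + dz v (dzb w f) z" by (rule dz_dir_add[OF bd bd])
    show "dz (k *s u) (dzb v f) z = k * dz u (dzb v f) z" by (rule dz_dir_smult[OF bd bd])
    have "dz u (dzb (v + w) f) z = dz u (\<lambda>y. dzb v f y + dzb w f y) z"
      by (rule dz_cong_open[OF assms(1,3)]) (rule dzb_dir_add[OF fd fd])
    then show "dz u (dzb (v + w) f) z = dz u (dzb v f) z + dz u (dzb w f) z" by (simp add: dz_add bd)
    have "dz u (dzb (k *s v) f) z = dz u (\<lambda>y. cnj k * dzb v f y) z"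
      by (rule dz_cong_open[OF assms(1,3)]) (rule dzb_dir_smult[OF fd fd])
    then show "dz u (dzb (k *s v) f) z = cnj k * dz u (dzb v f) z" by (simp add: dz_cmult bd)
  qed
qed

lemma dz_coordinate:
  shows "(\<lambda>y::complex^'n. y $ i - c) differentiable (at z)" "dz v (\<lambda>y. y $ i - c) z = v $ i" "dzb v (\<lambda>y. y $ i - c) z = 0"
proof -
  have 1: "((\<lambda>y::complex^'n. y $ i - c) has_derivative (\<lambda>v. v $ i)) (at z)"
    by (auto intro!: derivative_eq_intros bounded_linear.has_derivative[OF bounded_linear_vec_nth])
  then show "(\<lambda>y::complex^'n. y $ i - c) differentiable (at z)" by (auto simp: differentiable_def)
  show "dz v (\<lambda>y. y $ i - c) z = v $ i" "dzb v (\<lambda>y. y $ i - c) z = 0"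
    by (simp_all add: dz_has_derivative[OF 1] dzb_has_derivative[OF 1] field_simps)
qed

lemma norm_squared_complex2: "complex_of_real ((norm (z - a))\<^sup>2) = (z $ 1 - a $ 1) * cnj (z $ 1 - a $ 1) + (z $ 2 - a $ 2) * cnj (z $ 2 - a $ 2)"
  for z a :: "complex^2"
  unfolding complex_norm_square[symmetric] of_real_add[symmetric]
  by (simp add: norm_vec_def L2_set_def sum_2)

lemma dz_norm_squared:
  fixes a z :: "complex^2"
  shows "dz v (\<lambda>y. complex_of_real ((norm (y - a))\<^sup>2)) z = v $ 1 * cnj (z $ 1 - a $ 1) + v $ 2 * cnj (z $ 2 - a $ 2)"
    and "dzb v (\<lambda>y. complex_of_real ((norm (y - a))\<^sup>2)) z = (z $ 1 - a $ 1) * cnj (v $ 1) + (z $ 2 - a $ 2) * cnj (v $ 2)"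
    and "dz u (dzb v (\<lambda>y. complex_of_real ((norm (y - a))\<^sup>2))) z = u $ 1 * cnj (v $ 1) + u $ 2 * cnj (v $ 2)"
    and "smooth_on UNIV (\<lambda>y. (norm (y - a))\<^sup>2)"
proof -
  have c: "(\<lambda>y. cnj (y $ i - k)) differentiable (at x)" for i k and x :: "complex^2"
    using bounded_linear.has_derivative[OF bounded_linear_cnj] dz_coordinate(1)[of i k x] unfolding differentiable_def by blast
  have cc: "dz v (\<lambda>y. cnj (y $ i - k)) x = 0" "dzb v (\<lambda>y. cnj (y $ i - k)) x = cnj (v $ i)" for i k v and x :: "complex^2"
    unfolding dz_cnj[OF dz_coordinate(1) dz_coordinate(1)] dzb_cnj[OF dz_coordinate(1) dz_coordinate(1)] dz_coordinate
    by simp_all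
  have d: "(\<lambda>y. (y $ i - k) * cnj (y $ i - k)) differentiable (at x)" for i k and x :: "complex^2"
    by (rule differentiable_mult[OF dz_coordinate(1) c])
  show 1: "dz v (\<lambda>y. complex_of_real ((norm (y - a))\<^sup>2)) z = v $ 1 * cnj (z $ 1 - a $ 1) + v $ 2 * cnj (z $ 2 - a $ 2)"
    and 2: "dzb v (\<lambda>y. complex_of_real ((norm (y - a))\<^sup>2)) z = (z $ 1 - a $ 1) * cnj (v $ 1) + (z $ 2 - a $ 2) * cnj (v $ 2)" for v z
    unfolding norm_squared_complex2 dz_add[OF d d] dzb_add[OF d d] dz_mult[OF dz_coordinate(1) c] dzb_mult[OF dz_coordinate(1) c]
    by (simp_all only: cc dz_coordinate, simp_all)
  have e: "(\<lambda>y. (y $ i - k) * l) differentiable (at x)" for i k l and x :: "complex^2"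
    by (rule differentiable_mult[OF dz_coordinate(1)]) simp
  have "dz u (dzb v (\<lambda>y. complex_of_real ((norm (y - a))\<^sup>2))) z =
     dz u (\<lambda>y. (y $ 1 - a $ 1) * cnj (v $ 1) + (y $ 2 - a $ 2) * cnj (v $ 2)) z"
    by (rule dz_cong_open[of UNIV]) (simp_all only: 2 open_UNIV UNIV_I)
  then show "dz u (dzb v (\<lambda>y. complex_of_real ((norm (y - a))\<^sup>2))) z = u $ 1 * cnj (v $ 1) + u $ 2 * cnj (v $ 2)"
    unfolding dz_add[OF e e] dz_mult[OF dz_coordinate(1) differentiable_const] by (simp only: dz_coordinate dz_const) simp
  have "smooth_on UNIV (\<lambda>y::complex^2. (y - a) \<bullet> (y - a))"
    by (intro smooth_on_bilinear[OF bounded_bilinear_inner] smooth_on_diff smooth_on_const smooth_on_linear[OF bounded_linear_ident] open_UNIV)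
  then show "smooth_on UNIV (\<lambda>y. (norm (y - a))\<^sup>2)" by (simp add: power2_norm_eq_inner)
qed

text \<open>Second and first derivative of the profile, with the inner factors \<open>1/k\<close>.
  The common factor \<open>exp (- (k / t)) * (k / t^2)\<close> is split off so that their comparison
  no longer involves the exponential.\<close>

lemma flat_exp_values:
  fixes k t :: real
  assumes t: "0 < t" and k: "0 < k"
  shows "flat_exp (monom 1 2 * (monom 1 2 - monom 2 1)) (t / k) / k\<^sup>2 = exp (- (k / t)) * (k / t\<^sup>2) * ((k - 2 * t) / t\<^sup>2)"
    "flat_exp (monom 1 2) (t / k) / k = exp (- (k / t)) * (k / t\<^sup>2)"
proof -
  have "\<not> t / k \<le> 0" using assms by (simp add: divide_le_0_iff)
  then show "flat_exp (monom 1 2 * (monom 1 2 - monom 2 1)) (t / k) / k\<^sup>2 = exp (- (k / t)) * (k / t\<^sup>2) * ((k - 2 * t) / t\<^sup>2)"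
    "flat_exp (monom 1 2) (t / k) / k = exp (- (k / t)) * (k / t\<^sup>2)"
    using t k by (simp_all add: flat_exp_def poly_monom field_simps power2_eq_square)
qed

lemma mixed_disc_linear:
  "mixed_disc H (\<chi> \<alpha> \<beta>. a * P $ \<alpha> $ \<beta> - b * Q $ \<alpha> $ \<beta>) = a * mixed_disc H P - b * mixed_disc H Q"
  by (simp add: mixed_disc_def algebra_simps)

text \<open>Chain rule for a function of the squared distance: the gradient contributes a rank-one
  form, and the complex Hessian of the squared norm is the identity.\<close>

lemma hess_flat_exp:
  fixes a z :: "complex^2" and k R :: real
  assumes k: "0 < k"
  defines "s \<equiv> (R\<^sup>2 - (norm (z - a))\<^sup>2) / k"
  shows "Re (mixed_disc H (hess (\<lambda>y. of_real (flat_exp 1 ((R\<^sup>2 - (norm (y - a))\<^sup>2) / k))) z)) =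
    flat_exp (monom 1 2 * (monom 1 2 - monom 2 1)) s / k\<^sup>2 *
      Re (mixed_disc H (\<chi> \<alpha> \<beta>. (\<chi> i. cnj (z $ i - a $ i)) $ \<alpha> * cnj ((\<chi> i. cnj (z $ i - a $ i)) $ \<beta>))) -
    flat_exp (monom 1 2) s / k * Re (mixed_disc H (mat 1))"
proof -
  let ?s = "\<lambda>y::complex^2. (R\<^sup>2 - (norm (y - a))\<^sup>2) / k"
  let ?r = "\<lambda>y::complex^2. complex_of_real ((norm (y - a))\<^sup>2)"
  have ss: "smooth_on UNIV ?s"
    unfolding divide_inverse by (intro smooth_on_mult smooth_on_diff smooth_on_const dz_norm_squared open_UNIV)
  have sr: "smooth_on UNIV ?r" by (intro smooth_on_of_real dz_norm_squared open_UNIV)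
  have rd: "?r differentiable (at y)" "dzb v ?r differentiable (at y)" for y v
    using smooth_on_differentiable[OF sr] smooth_on_differentiable[OF smooth_on_dzb[OF open_UNIV sr]] by simp_all
  have eq: "(\<lambda>y. complex_of_real (?s y)) = (\<lambda>y. of_real (R\<^sup>2 / k) - of_real (1 / k) * ?r y)"
    using k by (simp add: fun_eq_iff field_simps)
  have rd': "(\<lambda>y. complex_of_real (1 / k) * ?r y) differentiable (at y)" for y
    by (rule differentiable_mult[OF differentiable_const rd(1)])
  have s1: "dz v (\<lambda>y. complex_of_real (?s y)) y = - of_real (1 / k) * dz v ?r y"
    and s2: "dzb v (\<lambda>y. complex_of_real (?s y)) y = - of_real (1 / k) * dzb v ?r y" for v y
    unfolding eq dz_diff[OF differentiable_const rd'] dzb_diff[OF differentiable_const rd'] dz_cmult[OF rd(1)] dzb_cmult[OF rd(1)]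
    by simp_all
  have s3: "dz u (dzb v (\<lambda>y. complex_of_real (?s y))) z = - of_real (1 / k) * dz u (dzb v ?r) z" for u v
    unfolding s2[abs_def] by (rule dz_cmult[OF rd(2)])
  have p1: "monom 1 2 * (1 - pderiv 1) = (monom 1 2 :: real poly)" by simp
  have p2: "monom 1 2 * (monom 1 2 - pderiv (monom 1 2)) = (monom 1 2 * (monom 1 2 - monom 2 1) :: real poly)"
    by (simp add: pderiv_monom)
  have L: "dz u (dzb v (\<lambda>y. of_real (flat_exp 1 (?s y)))) z =
      of_real (flat_exp (monom 1 2 * (monom 1 2 - monom 2 1)) s / k\<^sup>2) * (dz u ?r z * dzb v ?r z) -
      of_real (flat_exp (monom 1 2) s / k) * dz u (dzb v ?r) z" for u v
    unfolding dz_dzb_real_compose[OF open_UNIV UNIV_I ss flat_exp_has_derivative flat_exp_has_derivative] p1 p2 s1 s2 s3 s_def[symmetric]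
    by (simp add: power2_eq_square)
  define P :: "complex^2^2" where "P = (\<chi> \<alpha> \<beta>. (\<chi> i. cnj (z $ i - a $ i)) $ \<alpha> * cnj ((\<chi> i. cnj (z $ i - a $ i)) $ \<beta>))"
  have "hess (\<lambda>y. of_real (flat_exp 1 (?s y))) z =
     (\<chi> \<alpha> \<beta>. of_real (flat_exp (monom 1 2 * (monom 1 2 - monom 2 1)) s / k\<^sup>2) * P $ \<alpha> $ \<beta> -
      of_real (flat_exp (monom 1 2) s / k) * mat 1 $ \<alpha> $ \<beta>)"
    unfolding hess_def L dz_norm_squared P_def by (simp add: vec_eq_iff forall_2 axis_def mat_def)
  then have "mixed_disc H (hess (\<lambda>y. of_real (flat_exp 1 (?s y))) z) =
     of_real (flat_exp (monom 1 2 * (monom 1 2 - monom 2 1)) s / k\<^sup>2) * mixed_disc H P -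
     of_real (flat_exp (monom 1 2) s / k) * mixed_disc H (mat 1)"
    by (simp only: mixed_disc_linear)
  then show ?thesis unfolding P_def[symmetric]
    by (simp only: minus_complex.sel times_complex.sel Re_complex_of_real Im_complex_of_real mult_zero_left diff_zero)
qed

context local_hermitian
begin

text \<open>Hopf's barrier: away from the centre the gradient term of the Laplacian dominates for large \<open>k\<close>.\<close>

lemma ex_bump:
  assumes ball: "cball a R \<subseteq> S" and R: "0 < \<delta>" "\<delta> < R"
  obtains \<psi> :: "complex^2 \<Rightarrow> real" where "smooth_on UNIV \<psi>" "\<And>z. R \<le> dist a z \<Longrightarrow> \<psi> z = 0"
    "\<And>z. z \<in> S \<Longrightarrow> \<delta> \<le> dist a z \<Longrightarrow> 0 \<le> Re (mixed_disc (H z) (hess (\<lambda>y. of_real (\<psi> y)) z))"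
    "\<And>z. \<delta> \<le> dist a z \<Longrightarrow> dist a z < R \<Longrightarrow> 0 < Re (mixed_disc (H z) (hess (\<lambda>y. of_real (\<psi> y)) z))"
proof -
  define M1 where "M1 z = Re (mixed_disc (H z) (\<chi> \<alpha> \<beta>. (\<chi> i. cnj (z $ i - a $ i)) $ \<alpha> * cnj ((\<chi> i. cnj (z $ i - a $ i)) $ \<beta>)))" for z
  define M2 where "M2 z = Re (mixed_disc (H z) (mat 1))" for z
  \<comment> \<open>Away from the centre the gradient does not vanish, so \<open>M1\<close> has a
    positive minimum on this compact annulus.\<close>
  let ?C = "cball a R - ball a \<delta>"
  have C: "compact ?C" by (rule compact_diff) auto
  have CS: "?C \<subseteq> S" using ball by auto
  have Hc: "continuous_on ?C (\<lambda>z. H z $ i $ j)" for i j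
    by (rule continuous_on_subset[OF smooth_on_continuous[OF sm] CS])
  have zc: "continuous_on ?C (\<lambda>z. z $ i)" for i by (rule linear_continuous_on[OF bounded_linear_vec_nth])
  have c1: "continuous_on ?C M1" unfolding M1_def mixed_disc_def vec_lambda_beta
    by (intro continuous_on_Re continuous_on_add continuous_on_diff continuous_on_mult continuous_on_cnj continuous_on_const Hc zc)
  have c2: "continuous_on ?C M2" unfolding M2_def mixed_disc_def
    by (intro continuous_on_Re continuous_on_add continuous_on_diff continuous_on_mult continuous_on_const Hc)
  obtain u :: "complex^2" where "norm u = 1" using vector_choose_size[of 1] by auto
  then have "a + R *\<^sub>R u \<in> ?C" using R by (simp add: dist_norm)
  then have "?C \<noteq> {}" by blast
  obtain z1 where z1: "z1 \<in> ?C" "\<And>z. z \<in> ?C \<Longrightarrow> M1 z1 \<le> M1 z"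
    using continuous_attains_inf[OF C \<open>?C \<noteq> {}\<close> c1] by blast
  obtain z2 where z2: "z2 \<in> ?C" "\<And>z. z \<in> ?C \<Longrightarrow> M2 z \<le> M2 z2"
    using continuous_attains_sup[OF C \<open>?C \<noteq> {}\<close> c2] by blast
  have m1: "0 < M1 z1" unfolding M1_def
  proof (rule mixed_disc_rank_one_pos)
    show "hermitian_posdef (H z1)" using z1(1) CS pd by blast
    have "z1 \<noteq> a" using z1(1) R by auto
    then show "(\<chi> i. cnj (z1 $ i - a $ i)) \<noteq> 0" by (auto simp: vec_eq_iff)
  qed
  \<comment> \<open>Chosen so that \<open>(k - 2 R^2) / R^4\<close> times the minimum of
    \<open>M1\<close> equals \<open>|M2 z2| + 1\<close> and so exceeds \<open>M2\<close> on the
    annulus. For \<open>0 < t \<le> R^2\<close> the factor \<open>(k - 2 t) / t^2\<close> is at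
    least as large.\<close>
  define k where "k = 2 * R\<^sup>2 + R^4 * (\<bar>M2 z2\<bar> + 1) / M1 z1"
  have R0: "0 < R" using R by simp
  have k: "0 < k" unfolding k_def using m1 R0 by (intro add_pos_nonneg) auto
  define \<psi> where "\<psi> z = flat_exp 1 ((R\<^sup>2 - (norm (z - a))\<^sup>2) / k)" for z
  have pos: "0 < Re (mixed_disc (H z) (hess (\<lambda>y. of_real (\<psi> y)) z))" if "\<delta> \<le> dist a z" "dist a z < R" for z
  proof -
    let ?t = "R\<^sup>2 - (norm (z - a))\<^sup>2"
    have zC: "z \<in> ?C" using that by auto
    have "norm (z - a) < R" using that by (simp add: dist_norm norm_minus_commute)
    then have t: "0 < ?t" by (simp add: power_strict_mono)
    have tR: "?t \<le> R\<^sup>2" by simp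
    have e1: "flat_exp (monom 1 2 * (monom 1 2 - monom 2 1)) (?t / k) / k\<^sup>2 = exp (- (k / ?t)) * (k / ?t\<^sup>2) * ((k - 2 * ?t) / ?t\<^sup>2)"
      by (rule flat_exp_values[OF t k])
    have e2: "flat_exp (monom 1 2) (?t / k) / k = exp (- (k / ?t)) * (k / ?t\<^sup>2)"
      by (rule flat_exp_values[OF t k])
    have "M2 z < (k - 2 * R\<^sup>2) / R^4 * M1 z1"
      using z2(2)[OF zC] m1 R0 by (simp add: k_def)
    also have "\<dots> \<le> (k - 2 * ?t) / ?t\<^sup>2 * M1 z"
    proof (rule mult_mono)
      have "0 \<le> R^4 * (\<bar>M2 z2\<bar> + 1) / M1 z1" using m1 R0 by simp
      then have k2: "0 \<le> k - 2 * R\<^sup>2" by (simp add: k_def)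
      have kle: "k - 2 * R\<^sup>2 \<le> k - 2 * ?t" by simp
      have kt: "0 \<le> k - 2 * ?t" by (rule order_trans[OF k2 kle])
      have "?t\<^sup>2 \<le> (R\<^sup>2)\<^sup>2" using t tR by (intro power_mono) auto
      then have t4: "?t\<^sup>2 \<le> R^4" by (simp flip: power_mult)
      show "(k - 2 * R\<^sup>2) / R^4 \<le> (k - 2 * ?t) / ?t\<^sup>2"
        by (rule frac_le[OF kt kle _ t4]) (use t in simp)
      show "0 \<le> (k - 2 * ?t) / ?t\<^sup>2" using kt by (intro divide_nonneg_nonneg) auto
    qed (use z1(2)[OF zC] m1 in auto)
    finally have "0 < exp (- (k / ?t)) * (k / ?t\<^sup>2) * ((k - 2 * ?t) / ?t\<^sup>2 * M1 z - M2 z)"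
      using t k by (intro mult_pos_pos) auto
    then show ?thesis
      unfolding \<psi>_def hess_flat_exp[OF k] e1 e2 M1_def[symmetric] M2_def[symmetric] by (simp add: algebra_simps)
  qed
  have zero: "Re (mixed_disc (H z) (hess (\<lambda>y. of_real (\<psi> y)) z)) = 0" if "R \<le> dist a z" for z
  proof -
    have "R\<^sup>2 \<le> (norm (z - a))\<^sup>2" using that R0 by (intro power_mono) (auto simp: dist_norm norm_minus_commute)
    then have "(R\<^sup>2 - (norm (z - a))\<^sup>2) / k \<le> 0" using k by (simp add: divide_le_0_iff)
    then show ?thesis unfolding \<psi>_def hess_flat_exp[OF k] by (simp add: flat_exp_def)
  qed
  show thesis
  proof (rule that[of \<psi>])
    show "smooth_on UNIV \<psi>" unfolding \<psi>_def divide_inverse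
      by (rule smooth_on_compose[OF open_UNIV open_UNIV _ smooth_flat_exp])
         (auto intro!: smooth_on_mult smooth_on_diff smooth_on_const dz_norm_squared(4))
    show "\<psi> z = 0" if "R \<le> dist a z" for z
    proof -
      have "R\<^sup>2 \<le> (norm (z - a))\<^sup>2" using that R0 by (intro power_mono) (auto simp: dist_norm norm_minus_commute)
      then have "(R\<^sup>2 - (norm (z - a))\<^sup>2) / k \<le> 0" using k by (simp add: divide_le_0_iff)
      then show ?thesis by (simp add: \<psi>_def flat_exp_def)
    qed
    show "0 \<le> Re (mixed_disc (H z) (hess (\<lambda>y. of_real (\<psi> y)) z))" if "z \<in> S" "\<delta> \<le> dist a z" for z
      using pos[OF that(2)] zero[of z] by (cases "dist a z < R") auto
  qed (rule pos)
qed

end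

section \<open>Smooth functions on the manifold and the sign of their Laplacian\<close>

context complex_manifold_atlas
begin

definition pullback :: "('a, 'n) chart \<Rightarrow> ('a \<Rightarrow> real) \<Rightarrow> complex^'n \<Rightarrow> complex" where
  "pullback c \<phi> z = of_real (\<phi> (chart_inv c z))"

definition smooth_function :: "('a \<Rightarrow> real) \<Rightarrow> bool" where
  "smooth_function \<phi> \<longleftrightarrow> (\<forall>c\<in>\<A>. smooth_on (chart_image c) (pullback c \<phi>))"

lemma smooth_functionD: "smooth_function \<phi> \<Longrightarrow> c \<in> \<A> \<Longrightarrow> smooth_on (chart_image c) (pullback c \<phi>)"
  by (simp add: smooth_function_def)

lemma pullback_transition:
  assumes "c \<in> \<A>" "d \<in> \<A>" "z \<in> overlap c d"
  shows "pullback c \<phi> z = pullback d \<phi> (transition c d z)"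
proof -
  have "transition c d z = snd d (chart_inv c z)" by (simp add: transition_def chart_inv_def)
  then show ?thesis using overlap_chart_inv[OF assms] chart_inv[OF assms(2)] by (simp add: pullback_def)
qed

lemma pullback_linear: "pullback c (\<lambda>x. a * \<phi> x + \<psi> x) = (\<lambda>z. of_real a * pullback c \<phi> z + pullback c \<psi> z)"
  by (simp add: pullback_def fun_eq_iff)

lemma smooth_function_linear:
  assumes "smooth_function \<phi>" "smooth_function \<psi>" shows "smooth_function (\<lambda>x. a * \<phi> x + \<psi> x)"
  unfolding smooth_function_def pullback_linear
  by (intro ballI smooth_on_add smooth_on_mult smooth_on_const smooth_functionD assms open_image)

lemma smooth_function_const: "smooth_function (\<lambda>x. k)"
  unfolding smooth_function_def pullback_def by (intro ballI smooth_on_const)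

text \<open>A point outside the chart has a neighbourhood that misses the preimage of
  \<open>K\<close>, since that set is closed; on this neighbourhood the function is zero.\<close>

lemma smooth_function_extend:
  assumes c: "c \<in> \<A>" and K: "compact K" "K \<subseteq> chart_image c"
    and \<psi>: "smooth_on UNIV \<psi>" "\<And>z. z \<notin> K \<Longrightarrow> \<psi> z = 0"
  shows "smooth_function (\<lambda>x. if x \<in> fst c then \<psi> (snd c x) else 0)"
  unfolding smooth_function_def
proof
  fix d assume d: "d \<in> \<A>"
  let ?\<phi> = "\<lambda>x. if x \<in> fst c then \<psi> (snd c x) else 0"
  have s\<psi>: "smooth_on UNIV (\<lambda>z. complex_of_real (\<psi> z))" by (rule smooth_on_of_real[OF open_UNIV \<psi>(1)])
  show "smooth_on (chart_image d) (pullback d ?\<phi>)"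
  proof (rule smooth_on_local)
    fix z assume z: "z \<in> chart_image d"
    define x where "x = chart_inv d z"
    have x: "x \<in> fst d" "snd d x = z" using d z by (simp_all add: x_def)
    show "\<exists>U. open U \<and> z \<in> U \<and> smooth_on U (pullback d ?\<phi>)"
    proof (cases "x \<in> fst c")
      case True
      have "smooth_on (overlap d c) (\<lambda>z. complex_of_real (\<psi> (transition d c z)))"
        by (rule smooth_on_compose[OF open_overlap[OF d c] open_UNIV _ s\<psi> transition_smooth[OF d c]]) simp
      then have "smooth_on (overlap d c) (pullback d ?\<phi>)"
      proof (rule smooth_on_cong[OF open_overlap[OF d c], rotated])
        fix y assume "y \<in> overlap d c"
        then show "complex_of_real (\<psi> (transition d c y)) = pullback d ?\<phi> y"
          using overlap_chart_inv[OF d c, of y] by (simp add: pullback_def transition_def chart_inv_def)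
      qed
      moreover have "z \<in> overlap d c" using overlap_in[OF d c x(1) True] x(2) by simp
      ultimately show ?thesis using open_overlap[OF d c] by blast
    next
      case False
      let ?K = "{y \<in> fst c. snd c y \<in> K}"
      let ?U = "snd d ` (fst d \<inter> (topspace X - ?K))"
      have U: "open ?U" by (rule open_chart_image[OF d]) (use closedin_chart_preimage[OF c K] in blast)
      have "smooth_on ?U (pullback d ?\<phi>)"
      proof (rule smooth_on_cong[OF U _ smooth_on_const[of _ 0]])
        fix y assume "y \<in> ?U"
        then obtain w where w: "w \<in> fst d" "y = snd d w" "w \<notin> ?K" by blast
        then show "0 = pullback d ?\<phi> y" using \<psi>(2) chart_inv[OF d w(1)] by (auto simp: pullback_def)
      qed
      moreover have "z \<in> ?U" using x False chart_subset[OF d] by force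
      ultimately show ?thesis using U by blast
    qed
  qed
qed

end

lemma hess_cong: "open S \<Longrightarrow> z \<in> S \<Longrightarrow> (\<And>y. y \<in> S \<Longrightarrow> f y = f' y) \<Longrightarrow> hess f z = hess f' z"
  unfolding hess_def vec_eq_iff by (auto intro!: dz_cong_open[of S] dzb_cong_open[of S])

lemma hess_linear:
  assumes "open S" "smooth_on S f" "smooth_on S f'" "z \<in> S"
  shows "hess (\<lambda>y. k * f y + f' y) z = (\<chi> \<alpha> \<beta>. k * hess f z $ \<alpha> $ \<beta> + hess f' z $ \<alpha> $ \<beta>)"
proof -
  have "smooth_on S (\<lambda>y. k * f y)" by (intro smooth_on_mult smooth_on_const assms)
  then show ?thesis unfolding hess_def vec_eq_iff
    by (simp add: dz_dzb_add[OF assms(1) _ assms(3,4)] dz_dzb_mult[OF assms(1) smooth_on_const assms(2,4)] dzb_const[abs_def])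
qed

lemma mixed_disc_linear_add: "mixed_disc H (\<chi> \<alpha> \<beta>. a * P $ \<alpha> $ \<beta> + Q $ \<alpha> $ \<beta>) = a * mixed_disc H P + mixed_disc H Q"
  by (simp add: mixed_disc_def algebra_simps)

context hermitian_manifold
begin

definition lap :: "('a, 2) chart \<Rightarrow> ('a \<Rightarrow> real) \<Rightarrow> complex^2 \<Rightarrow> real" where
  "lap c \<phi> z = Re (mixed_disc (g c z) (hess (pullback c \<phi>) z))"

text \<open>The value of \<open>L\<close> depends on the choice of the chart, but its sign does not.\<close>

definition L :: "('a \<Rightarrow> real) \<Rightarrow> 'a \<Rightarrow> real" where
  "L \<phi> x = (let c = SOME c. c \<in> \<A> \<and> x \<in> fst c in lap c \<phi> (snd c x))"

text \<open>Under a holomorphic coordinate change the complex Hessian transforms like the metric, so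
  \<open>r\<close> is the squared modulus of the Jacobian determinant, by the scaling of
  \<open>mixed_disc\<close>.\<close>

lemma lap_transition:
  assumes c: "c \<in> \<A>" and d: "d \<in> \<A>" and z: "z \<in> overlap c d" and \<phi>: "smooth_function \<phi>"
  obtains r where "0 < r" "lap c \<phi> z = r * lap d \<phi> (transition c d z)"
proof -
  let ?T = "frechet_derivative (transition c d) (at z)"
  let ?r = "(cmod (?T e1 $ 1 * ?T e2 $ 2 - ?T e1 $ 2 * ?T e2 $ 1))\<^sup>2"
  let ?f = "pullback d \<phi>"
  note sf = smooth_functionD[OF \<phi> d] and od = open_image[OF d] and tz = transition_in[OF c d z]
  have "hess (pullback c \<phi>) z = hess (\<lambda>y. ?f (transition c d y)) z"
    by (rule hess_cong[OF open_overlap[OF c d] z]) (rule pullback_transition[OF c d])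
  also have "\<dots> = (\<chi> \<alpha> \<beta>. sesq (hess ?f (transition c d z)) (?T (axis \<alpha> 1)) (?T (axis \<beta> 1)))"
    unfolding hess_def[of _ z] sesq_hess[OF od sf tz]
    by (simp add: dz_dzb_compose_holomorphic[OF open_overlap[OF c d] od transition_holomorphic[OF c d] transition_image[OF c d] sf z])
  finally have 1: "hess (pullback c \<phi>) z = (\<chi> \<alpha> \<beta>. sesq (hess ?f (transition c d z)) (?T (axis \<alpha> 1)) (?T (axis \<beta> 1)))" .
  have 2: "g c z = (\<chi> \<alpha> \<beta>. sesq (g d (transition c d z)) (?T (axis \<alpha> 1)) (?T (axis \<beta> 1)))"
    by (simp add: vec_eq_iff sesq_transition[OF c d z, symmetric] sesq_axis)
  have eq: "mixed_disc (g c z) (hess (pullback c \<phi>) z) = of_real ?r * mixed_disc (g d (transition c d z)) (hess ?f (transition c d z))"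
    unfolding 1 2 by (rule mixed_disc_pullback)
  have "?T e1 $ 1 * ?T e2 $ 2 - ?T e1 $ 2 * ?T e2 $ 1 \<noteq> 0"
  proof
    assume "?T e1 $ 1 * ?T e2 $ 2 - ?T e1 $ 2 * ?T e2 $ 1 = 0"
    then have "mixed_disc (g c z) (g c z) = 0" by (subst (1 2) 2) (simp only: mixed_disc_pullback, simp)
    then have "g c z $ 1 $ 1 * g c z $ 2 $ 2 - g c z $ 1 $ 2 * g c z $ 2 $ 1 = 0"
      by (simp add: mixed_disc_def algebra_simps)
    then show False
      using det2_nonzero[OF hermitian_posdef_invertible[OF local_hermitian.pd[OF local_hermitian[OF c] zc[OF c d z]]]] by blast
  qed
  then show thesis using that[of ?r] eq by (simp add: lap_def)
qed

lemma L_chart: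
  assumes c: "c \<in> \<A>" and x: "x \<in> fst c" and \<phi>: "smooth_function \<phi>"
  obtains r where "0 < r" "L \<phi> x = r * lap c \<phi> (snd c x)"
proof -
  define d where "d = (SOME c. c \<in> \<A> \<and> x \<in> fst c)"
  have d: "d \<in> \<A>" "x \<in> fst d" using someI[of "\<lambda>c. c \<in> \<A> \<and> x \<in> fst c" c] c x by (auto simp: d_def)
  obtain r where "0 < r" "lap d \<phi> (snd d x) = r * lap c \<phi> (transition d c (snd d x))"
    using lap_transition[OF d(1) c overlap_in[OF d(1) c d(2) x] \<phi>] by blast
  then show thesis using that transition_chart[OF d(1) c d(2)] by (simp add: L_def d_def[symmetric])
qed

lemma L_pos_iff:
  "c \<in> \<A> \<Longrightarrow> x \<in> fst c \<Longrightarrow> smooth_function \<phi> \<Longrightarrow> 0 < L \<phi> x \<longleftrightarrow> 0 < lap c \<phi> (snd c x)"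
  "c \<in> \<A> \<Longrightarrow> x \<in> fst c \<Longrightarrow> smooth_function \<phi> \<Longrightarrow> 0 \<le> L \<phi> x \<longleftrightarrow> 0 \<le> lap c \<phi> (snd c x)"
  by (metis L_chart zero_less_mult_pos zero_less_mult_iff less_asym, metis L_chart zero_le_mult_iff less_le_not_le)

lemma lap_linear:
  assumes c: "c \<in> \<A>" and z: "z \<in> chart_image c" and "smooth_function \<phi>" "smooth_function \<psi>"
  shows "lap c (\<lambda>x. a * \<phi> x + \<psi> x) z = a * lap c \<phi> z + lap c \<psi> z"
  unfolding lap_def pullback_linear
    hess_linear[OF open_image[OF c] smooth_functionD[OF assms(3) c] smooth_functionD[OF assms(4) c] z] mixed_disc_linear_add
  by simp

text \<open>The chart behind \<open>L\<close> depends on the point alone and not on the function, so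
  linearity holds exactly and not merely up to a positive factor.\<close>

lemma L_linear:
  assumes "x \<in> topspace X" "smooth_function \<phi>" "smooth_function \<psi>"
  shows "L (\<lambda>x. a * \<phi> x + \<psi> x) x = a * L \<phi> x + L \<psi> x"
proof -
  have "\<exists>c. c \<in> \<A> \<and> x \<in> fst c" using ex_chart[OF assms(1)] by blast
  from someI_ex[OF this] show ?thesis
    unfolding L_def Let_def using lap_linear[OF _ chart_in assms(2,3)] by blast
qed

lemma continuous_on_lap:
  assumes "c \<in> \<A>" "smooth_function \<phi>" shows "continuous_on (chart_image c) (lap c \<phi>)"
proof -
  interpret C: local_hermitian "chart_image c" "g c" by (rule local_hermitian[OF assms(1)])
  have 1: "continuous_on (chart_image c) (\<lambda>z. g c z $ i $ j)" for i j by (rule smooth_on_continuous[OF C.sm])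
  have 2: "continuous_on (chart_image c) (\<lambda>z. hess (pullback c \<phi>) z $ i $ j)" for i j
    unfolding hess_def vec_lambda_beta
    by (intro smooth_on_continuous smooth_on_dz smooth_on_dzb C.S smooth_functionD assms)
  show ?thesis unfolding lap_def mixed_disc_def
    by (intro continuous_on_Re continuous_on_add continuous_on_diff continuous_on_mult 1 2)
qed

text \<open>The chosen chart may jump from point to point, so \<open>L\<close> need not be
  continuous; openness is read off in one fixed chart, where the sign is the same.\<close>

lemma openin_L_pos:
  assumes \<phi>: "smooth_function \<phi>" shows "openin X {x \<in> topspace X. 0 < L \<phi> x}"
proof (subst openin_subopen, intro ballI)
  fix x assume x: "x \<in> {x \<in> topspace X. 0 < L \<phi> x}"
  then obtain c where c: "c \<in> \<A>" "x \<in> fst c" using ex_chart by blast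
  let ?W = "{z \<in> chart_image c. lap c \<phi> z \<in> {0<..}}"
  have "open ?W" by (rule continuous_open_preimage[OF continuous_on_lap[OF c(1) \<phi>] open_image[OF c(1)], unfolded vimage_def Int_def mem_Collect_eq]) simp
  then have "openin X {y \<in> fst c. snd c y \<in> ?W}" by (rule openin_chart_preimage[OF c(1)])
  moreover have "x \<in> {y \<in> fst c. snd c y \<in> ?W}"
    using x c L_pos_iff(1)[OF c \<phi>] chart_in[OF c] by simp
  moreover have "{y \<in> fst c. snd c y \<in> ?W} \<subseteq> {x \<in> topspace X. 0 < L \<phi> x}"
    using chart_subset[OF c(1)] L_pos_iff(1)[OF c(1) _ \<phi>] by auto
  ultimately show "\<exists>T. openin X T \<and> x \<in> T \<and> T \<subseteq> {x \<in> topspace X. 0 < L \<phi> x}" by blast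
qed

text \<open>The barrier extended by zero. Its sign is left open only on the core of radius
  \<open>\<delta>\<close>, which later steps have to cover by other means.\<close>

lemma ex_global_bump:
  assumes c: "c \<in> \<A>" and ball: "cball a R \<subseteq> chart_image c" and R: "0 < \<delta>" "\<delta> < R"
  obtains \<psi> where "smooth_function \<psi>"
    "\<And>x. x \<in> topspace X \<Longrightarrow> \<not> (x \<in> fst c \<and> dist a (snd c x) < \<delta>) \<Longrightarrow> 0 \<le> L \<psi> x"
    "\<And>x. x \<in> fst c \<Longrightarrow> \<delta> \<le> dist a (snd c x) \<Longrightarrow> dist a (snd c x) < R \<Longrightarrow> 0 < L \<psi> x"
proof -
  interpret C: local_hermitian "chart_image c" "g c" by (rule local_hermitian[OF c])
  obtain \<psi> where \<psi>: "smooth_on UNIV \<psi>" "\<And>z. R \<le> dist a z \<Longrightarrow> \<psi> z = 0"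
    "\<And>z. z \<in> chart_image c \<Longrightarrow> \<delta> \<le> dist a z \<Longrightarrow> 0 \<le> Re (mixed_disc (g c z) (hess (\<lambda>y. of_real (\<psi> y)) z))"
    "\<And>z. \<delta> \<le> dist a z \<Longrightarrow> dist a z < R \<Longrightarrow> 0 < Re (mixed_disc (g c z) (hess (\<lambda>y. of_real (\<psi> y)) z))"
    using C.ex_bump[OF ball R] by metis
  let ?\<phi> = "\<lambda>x. if x \<in> fst c then \<psi> (snd c x) else 0"
  have sm: "smooth_function ?\<phi>"
    by (rule smooth_function_extend[OF c compact_cball ball \<psi>(1)]) (use \<psi>(2) in auto)
  have lc: "lap c ?\<phi> z = Re (mixed_disc (g c z) (hess (\<lambda>y. of_real (\<psi> y)) z))" if "z \<in> chart_image c" for z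
  proof -
    have "hess (pullback c ?\<phi>) z = hess (\<lambda>y. of_real (\<psi> y)) z"
      by (rule hess_cong[OF C.S that]) (simp add: pullback_def c)
    then show ?thesis by (simp add: lap_def)
  qed
  show thesis
  proof (rule that[OF sm])
    fix x assume x: "x \<in> topspace X" and nx: "\<not> (x \<in> fst c \<and> dist a (snd c x) < \<delta>)"
    show "0 \<le> L ?\<phi> x"
    proof (cases "x \<in> fst c")
      case True
      then show ?thesis using nx \<psi>(3)[OF chart_in[OF c True]]
        by (simp add: L_pos_iff(2)[OF c True sm] lc[OF chart_in[OF c True]])
    next
      case False
      obtain d where d: "d \<in> \<A>" "x \<in> fst d" using ex_chart[OF x] by blast
      let ?K = "{y \<in> fst c. snd c y \<in> cball a R}"
      let ?U = "snd d ` (fst d \<inter> (topspace X - ?K))"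
      have "open ?U" by (rule open_chart_image[OF d(1)]) (use closedin_chart_preimage[OF c compact_cball ball] in blast)
      moreover have "snd d x \<in> ?U" using x d False by blast
      moreover have "pullback d ?\<phi> y = 0" if "y \<in> ?U" for y
      proof -
        obtain w where w: "w \<in> fst d" "y = snd d w" "w \<notin> ?K" using \<open>y \<in> ?U\<close> by blast
        then show ?thesis using \<psi>(2) chart_inv[OF d(1) w(1)] by (auto simp: pullback_def)
      qed
      ultimately have "hess (pullback d ?\<phi>) (snd d x) = hess (\<lambda>y. 0) (snd d x)" by (rule hess_cong)
      then have "lap d ?\<phi> (snd d x) = 0" by (simp add: lap_def hess_def mixed_disc_def dzb_const[abs_def])
      then show ?thesis by (simp add: L_pos_iff(2)[OF d sm])
    qed
  next
    fix x assume x: "x \<in> fst c" "\<delta> \<le> dist a (snd c x)" "dist a (snd c x) < R"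
    then show "0 < L ?\<phi> x" using \<psi>(4)[OF x(2,3)] by (simp add: L_pos_iff(1)[OF c x(1) sm] lc[OF chart_in[OF c x(1)]])
  qed
qed

lemma ex_near_point:
  fixes z :: "complex^2" assumes "0 < r" obtains a where "dist a z = r"
proof -
  obtain u :: "complex^2" where "norm u = r" using vector_choose_size[of r] assms by auto
  then show thesis using that[of "z + u"] by (simp add: dist_norm)
qed

section \<open>Spreading positivity of the Laplacian by chains of balls\<close>

context
  fixes V assumes V: "openin X V" "V \<noteq> {}" and compact: "compact_space X" and connected: "connected_space X"
begin

text \<open>Leaving the sign free on \<open>V\<close> is what allows such functions to exist on a
  compact manifold.\<close>

definition good :: "'a \<Rightarrow> ('a \<Rightarrow> real) \<Rightarrow> bool" where
  "good x \<phi> \<longleftrightarrow> smooth_function \<phi> \<and> (\<forall>y\<in>topspace X - V. 0 \<le> L \<phi> y) \<and> 0 < L \<phi> x"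

lemma good_in_V:
  assumes x: "x \<in> V" shows "\<exists>\<phi>. good x \<phi>"
proof -
  obtain c where c: "c \<in> \<A>" "x \<in> fst c" using ex_chart openin_subset[OF V(1)] x by blast
  have "open (snd c ` (fst c \<inter> V))" by (rule open_chart_image[OF c(1) V(1)])
  then obtain r where r: "0 < r" "ball (snd c x) r \<subseteq> snd c ` (fst c \<inter> V)"
    using c x openE by (metis IntI imageI)
  \<comment> \<open>The centre is moved off \<open>x\<close> so that \<open>x\<close> falls into the
    annulus of strict positivity, as \<open>r/8 \<le> r/4 < r/2\<close>, while the whole barrier
    ball and hence its core lies in \<open>V\<close>.\<close>
  obtain a where a: "dist a (snd c x) = r / 4" using ex_near_point[of "r / 4"] r(1) by auto
  have ballr: "cball a (r / 2) \<subseteq> ball (snd c x) r"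
  proof
    fix z assume "z \<in> cball a (r / 2)"
    then have "dist (snd c x) z \<le> r / 4 + r / 2"
      using dist_triangle[of "snd c x" z a] a by (simp add: dist_commute)
    then show "z \<in> ball (snd c x) r" using r(1) by simp
  qed
  then have ball: "cball a (r / 2) \<subseteq> chart_image c" using r(2) by (auto simp: chart_image_def)
  obtain \<psi> where \<psi>: "smooth_function \<psi>"
    "\<And>x. x \<in> topspace X \<Longrightarrow> \<not> (x \<in> fst c \<and> dist a (snd c x) < r / 8) \<Longrightarrow> 0 \<le> L \<psi> x"
    "\<And>x. x \<in> fst c \<Longrightarrow> r / 8 \<le> dist a (snd c x) \<Longrightarrow> dist a (snd c x) < r / 2 \<Longrightarrow> 0 < L \<psi> x"
    using ex_global_bump[OF c(1) ball, of "r / 8"] r(1) by auto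
  have "0 \<le> L \<psi> y" if y: "y \<in> topspace X - V" for y
  proof (rule \<psi>(2))
    show "\<not> (y \<in> fst c \<and> dist a (snd c y) < r / 8)"
    proof
      assume h: "y \<in> fst c \<and> dist a (snd c y) < r / 8"
      then have "snd c y \<in> cball a (r / 2)" using r(1) by simp
      then have "snd c y \<in> snd c ` (fst c \<inter> V)" using ballr r(2) by blast
      then obtain w where "w \<in> fst c" "w \<in> V" "snd c y = snd c w" by blast
      then have "y = w" using inj_onD[OF inj_chart[OF c(1)]] h by blast
      then show False using y \<open>w \<in> V\<close> by blast
    qed
  qed (use y in blast)
  moreover have "0 < L \<psi> x" by (rule \<psi>(3)[OF c(2)]) (use a r(1) in auto)
  ultimately show ?thesis using \<psi>(1) unfolding good_def by blast
qed

text \<open>One link of a chain of balls: a barrier centred at \<open>y\<close> is positive at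
  \<open>x\<close> and can be negative only on its core, where a large multiple of
  \<open>\<phi>\<close> outweighs it.\<close>

lemma good_closed:
  assumes c: "c \<in> \<A>" "x \<in> fst c" and r: "0 < r" "ball (snd c x) r \<subseteq> chart_image c"
    and y: "y \<in> fst c" "dist (snd c y) (snd c x) < r / 4" "good y \<phi>"
  shows "\<exists>\<phi>. good x \<phi>"
proof (cases "x \<in> V \<or> x = y")
  case True then show ?thesis using good_in_V y(3) by blast
next
  case False
  have \<phi>: "smooth_function \<phi>" "\<And>y. y \<in> topspace X - V \<Longrightarrow> 0 \<le> L \<phi> y" "0 < L \<phi> y"
    using y(3) unfolding good_def by blast+
  let ?a = "snd c y"
  have xy: "?a \<noteq> snd c x" using inj_onD[OF inj_chart[OF c(1)] _ y(1) c(2)] False by blast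
  have ball: "cball ?a (r / 2) \<subseteq> chart_image c"
  proof
    fix z assume "z \<in> cball ?a (r / 2)"
    then have "dist (snd c x) z < r" using dist_triangle[of "snd c x" z ?a] y(2) r(1) by (simp add: dist_commute)
    then show "z \<in> chart_image c" using r(2) by auto
  qed
  have o: "open {z \<in> chart_image c. lap c \<phi> z \<in> {0<..}}"
    by (rule continuous_open_preimage[OF continuous_on_lap[OF c(1) \<phi>(1)] open_image[OF c(1)], unfolded vimage_def Int_def mem_Collect_eq]) simp
  have a: "?a \<in> {z \<in> chart_image c. lap c \<phi> z \<in> {0<..}}"
    using L_pos_iff(1)[OF c(1) y(1) \<phi>(1)] \<phi>(3) chart_in[OF c(1) y(1)] by simp
  from o[unfolded open_contains_cball, rule_format, OF a]
  obtain e where e: "0 < e" "cball ?a e \<subseteq> {z \<in> chart_image c. lap c \<phi> z \<in> {0<..}}" by blast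
  \<comment> \<open>The core must lie where the Laplacian of \<open>\<phi>\<close> is positive, must
    leave \<open>x\<close> in the annulus, and must be smaller than the barrier radius
    \<open>r / 2\<close>.\<close>
  define \<delta> where "\<delta> = min e (min (dist ?a (snd c x)) (r / 4))"
  have \<delta>: "0 < \<delta>" "\<delta> \<le> e" "\<delta> \<le> dist ?a (snd c x)" "\<delta> < r / 2"
    using e(1) xy r(1) by (auto simp: \<delta>_def)
  obtain \<psi> where \<psi>: "smooth_function \<psi>"
    "\<And>x. x \<in> topspace X \<Longrightarrow> \<not> (x \<in> fst c \<and> dist ?a (snd c x) < \<delta>) \<Longrightarrow> 0 \<le> L \<psi> x"
    "\<And>x. x \<in> fst c \<Longrightarrow> \<delta> \<le> dist ?a (snd c x) \<Longrightarrow> dist ?a (snd c x) < r / 2 \<Longrightarrow> 0 < L \<psi> x"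
    using ex_global_bump[OF c(1) ball \<delta>(1,4)] by metis
  have sub: "cball ?a \<delta> \<subseteq> chart_image c" using e(2) subset_cball[OF \<delta>(2), of ?a] by blast
  have ne: "cball ?a \<delta> \<noteq> {}" using \<delta>(1) by simp
  obtain z1 where z1: "z1 \<in> cball ?a \<delta>" "\<And>z. z \<in> cball ?a \<delta> \<Longrightarrow> lap c \<phi> z1 \<le> lap c \<phi> z"
    using continuous_attains_inf[OF compact_cball ne continuous_on_subset[OF continuous_on_lap[OF c(1) \<phi>(1)] sub]] by blast
  obtain z2 where z2: "\<And>z. z \<in> cball ?a \<delta> \<Longrightarrow> lap c \<psi> z2 \<le> lap c \<psi> z"
    using continuous_attains_inf[OF compact_cball ne continuous_on_subset[OF continuous_on_lap[OF c(1) \<psi>(1)] sub]] by blast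
  have m: "0 < lap c \<phi> z1" using z1(1) e(2) \<delta>(2) by (auto simp: subset_iff)
  \<comment> \<open>Makes \<open>C\<close> times the least Laplacian of \<open>\<phi>\<close> on the
    core outweigh the most negative value of that of \<open>\<psi>\<close>; the \<open>1\<close>
    keeps \<open>C\<close> positive.\<close>
  define C where "C = (\<bar>lap c \<psi> z2\<bar> + 1) / lap c \<phi> z1"
  have C: "0 < C" using m by (simp add: C_def)
  let ?f = "\<lambda>x. C * \<phi> x + \<psi> x"
  have sf: "smooth_function ?f" by (rule smooth_function_linear[OF \<phi>(1) \<psi>(1)])
  have "0 \<le> L ?f w" if w: "w \<in> topspace X - V" for w
  proof (cases "w \<in> fst c \<and> dist ?a (snd c w) < \<delta>")
    case True
    let ?z = "snd c w"
    have z: "?z \<in> cball ?a \<delta>" using True by simp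
    have "\<bar>lap c \<psi> z2\<bar> + 1 = C * lap c \<phi> z1" using m by (simp add: C_def)
    also have "\<dots> \<le> C * lap c \<phi> ?z" using z1(2)[OF z] C by (intro mult_left_mono) auto
    finally have "0 \<le> C * lap c \<phi> ?z + lap c \<psi> ?z" using z2[OF z] by linarith
    then show ?thesis using True lap_linear[OF c(1) chart_in[OF c(1)] \<phi>(1) \<psi>(1)] L_pos_iff(2)[OF c(1) _ sf] by metis
  next
    case False
    then have "0 \<le> L \<psi> w" using \<psi>(2) w by blast
    moreover have "0 \<le> C * L \<phi> w" using \<phi>(2)[OF w] C by simp
    ultimately show ?thesis using L_linear[OF _ \<phi>(1) \<psi>(1)] w by simp
  qed
  moreover have "0 < L ?f x"
  proof -
    have xX: "x \<in> topspace X" using chart_subset[OF c(1)] c(2) by blast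
    then have "0 \<le> C * L \<phi> x" using \<phi>(2) False C by simp
    moreover have "0 < L \<psi> x" by (rule \<psi>(3)[OF c(2) \<delta>(3)]) (use y(2) r(1) in simp)
    ultimately show ?thesis using L_linear[OF xX \<phi>(1) \<psi>(1)] by simp
  qed
  ultimately show ?thesis using sf unfolding good_def by blast
qed

text \<open>The points that have a good function form an open set by continuity. It is closed by the
  ball step: if some point of a small chart ball around \<open>x\<close> has one, so does
  \<open>x\<close>. Connectedness finishes, starting from \<open>V\<close>.\<close>

lemma ex_good: "x \<in> topspace X \<Longrightarrow> \<exists>\<phi>. good x \<phi>"
proof -
  let ?S = "{x \<in> topspace X. \<exists>\<phi>. good x \<phi>}"
  have "openin X ?S"
  proof (subst openin_subopen, intro ballI)
    fix x assume "x \<in> ?S"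
    then obtain \<phi> where x: "x \<in> topspace X" and \<phi>: "good x \<phi>" by blast
    then have "openin X {x \<in> topspace X. 0 < L \<phi> x}" using openin_L_pos unfolding good_def by blast
    moreover have "x \<in> {x \<in> topspace X. 0 < L \<phi> x}" using x \<phi> unfolding good_def by blast
    moreover have "{x \<in> topspace X. 0 < L \<phi> x} \<subseteq> ?S" using \<phi> unfolding good_def by blast
    ultimately show "\<exists>T. openin X T \<and> x \<in> T \<and> T \<subseteq> ?S" by blast
  qed
  moreover have "openin X (topspace X - ?S)"
  proof (subst openin_subopen, intro ballI)
    fix x assume x: "x \<in> topspace X - ?S"
    then obtain c where c: "c \<in> \<A>" "x \<in> fst c" using ex_chart by blast
    obtain r where r: "0 < r" "ball (snd c x) r \<subseteq> chart_image c"
      using openE[OF open_image[OF c(1)] chart_in[OF c]] by blast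
    let ?N = "{y \<in> fst c. snd c y \<in> ball (snd c x) (r / 4)}"
    have "openin X ?N" by (rule openin_chart_preimage[OF c(1)]) simp
    moreover have "x \<in> ?N" using c r by simp
    moreover have "?N \<subseteq> topspace X - ?S"
    proof
      fix y assume y: "y \<in> ?N"
      then have "dist (snd c y) (snd c x) < r / 4" by (simp add: dist_commute)
      then have "\<not> good y \<phi>" for \<phi> using good_closed[OF c r _ _, of y \<phi>] y x by blast
      then show "y \<in> topspace X - ?S" using y chart_subset[OF c(1)] by blast
    qed
    ultimately show "\<exists>T. openin X T \<and> x \<in> T \<and> T \<subseteq> topspace X - ?S" by blast
  qed
  then have "closedin X ?S" by (auto simp: closedin_def)
  ultimately have "?S = {} \<or> ?S = topspace X" using connected unfolding connected_space_clopen_in by blast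
  moreover obtain v where "v \<in> V" using V(2) by blast
  then have "v \<in> ?S" using good_in_V openin_subset[OF V(1)] by blast
  ultimately have "?S = topspace X" by blast
  then show "x \<in> topspace X \<Longrightarrow> \<exists>\<phi>. good x \<phi>" by blast
qed

text \<open>Outside \<open>V\<close> the Laplacians of good functions are nonnegative and cannot
  cancel, so a sum over a finite cover is strictly positive there.\<close>

lemma ex_subharmonic: "\<exists>\<phi>. smooth_function \<phi> \<and> (\<forall>x\<in>topspace X - V. 0 < L \<phi> x)"
proof -
  obtain f where f: "\<And>x. x \<in> topspace X \<Longrightarrow> good x (f x)" using ex_good by metis
  define U where "U x = {y \<in> topspace X. 0 < L (f x) y}" for x
  have "openin X (U x) \<and> x \<in> U x" if "x \<in> topspace X" for x
    using openin_L_pos[of "f x"] f[OF that] that unfolding good_def U_def by blast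
  then obtain F where F: "finite F" "F \<subseteq> topspace X" "topspace X \<subseteq> (\<Union>x\<in>F. U x)"
    using compact_space_finite_cover[OF compact] by metis
  have "\<exists>\<phi>. smooth_function \<phi> \<and> (\<forall>y\<in>topspace X - V. 0 \<le> L \<phi> y \<and> ((\<exists>x\<in>F. y \<in> U x) \<longrightarrow> 0 < L \<phi> y))"
    using F(1,2)
  proof (induction F rule: finite_induct)
    case empty
    have "L (\<lambda>x. 0) y = 0" for y
    proof -
      have "pullback c (\<lambda>x. 0) = (\<lambda>z. 0)" for c by (simp add: pullback_def fun_eq_iff)
      then show ?thesis by (simp add: L_def lap_def hess_def mixed_disc_def dzb_const[abs_def])
    qed
    then show ?case using smooth_function_const[of 0] by (intro exI[of _ "\<lambda>x. 0"]) simp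
  next
    case (insert x F)
    then obtain \<phi> where \<phi>: "smooth_function \<phi>" "\<forall>y\<in>topspace X - V. 0 \<le> L \<phi> y \<and> ((\<exists>x\<in>F. y \<in> U x) \<longrightarrow> 0 < L \<phi> y)"
      by blast
    have g: "smooth_function (f x)" "\<forall>y\<in>topspace X - V. 0 \<le> L (f x) y"
      using f[of x] insert.prems unfolding good_def by blast+
    show ?case
    proof (intro exI[of _ "\<lambda>y. 1 * f x y + \<phi> y"] conjI ballI impI)
      show "smooth_function (\<lambda>y. 1 * f x y + \<phi> y)" by (rule smooth_function_linear[OF g(1) \<phi>(1)])
      fix y assume y: "y \<in> topspace X - V"
      have e: "L (\<lambda>y. 1 * f x y + \<phi> y) y = L (f x) y + L \<phi> y" using L_linear[OF _ g(1) \<phi>(1), of y 1] y by simp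
      show "0 \<le> L (\<lambda>y. 1 * f x y + \<phi> y) y" unfolding e using g(2) \<phi>(2) y by simp
      assume "\<exists>x\<in>insert x F. y \<in> U x"
      then show "0 < L (\<lambda>y. 1 * f x y + \<phi> y) y"
        unfolding e using g(2) \<phi>(2) y by (auto simp: U_def add_pos_nonneg add_nonneg_pos)
    qed
  qed
  then show ?thesis using F(3) by blast
qed

end

end

section \<open>Conformal change of the metric\<close>

definition conformal :: "('b \<Rightarrow> real) \<Rightarrow> ('b \<Rightarrow> complex^'r^'r) \<Rightarrow> 'b \<Rightarrow> complex^'r^'r" where
  "conformal s H y = (\<chi> \<alpha> \<beta>. of_real (exp (s y)) * H y $ \<alpha> $ \<beta>)"

lemma sesq_conformal: "sesq (conformal s H y) v w = of_real (exp (s y)) * sesq (H y) v w"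
  by (simp add: sesq_def conformal_def sum_distrib_left mult.assoc)

context local_hermitian
begin

lemma smooth_exp: "smooth_on S s \<Longrightarrow> smooth_on S (\<lambda>y. complex_of_real (exp (s y)))"
  by (rule smooth_on_of_real[OF S smooth_on_compose[OF S open_UNIV _ smooth_on_exp]]) simp_all

lemma conformal_hermitian:
  assumes s: "smooth_on S s" shows "local_hermitian S (conformal s H)"
proof
  fix y assume y: "y \<in> S"
  have "cnj (H y $ \<alpha> $ \<beta>) = H y $ \<beta> $ \<alpha>" for \<alpha> \<beta> using pd[OF y] unfolding hermitian_posdef_def by metis
  moreover have "0 < Re (sesq (conformal s H y) v v)" if "v \<noteq> 0" for v
    using hermitian_posdef_pos[OF pd[OF y] that] by (simp add: sesq_conformal)
  ultimately show "hermitian_posdef (conformal s H y)"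
    unfolding hermitian_posdef_def by (simp add: conformal_def)
qed (auto intro!: S smooth_on_mult smooth_exp sm s simp: conformal_def)

text \<open>The connection gains the derivative of \<open>s\<close> along \<open>b\<close> times the
  section. The products of first derivatives then cancel, and only the complex Hessian of
  \<open>s\<close> remains.\<close>

lemma curvature4_conformal:
  assumes s: "smooth_on S s" and z: "z \<in> S"
  shows "curvature4 (conformal s H) z b a c d =
    of_real (exp (s z)) * (curvature4 H z b a c d - dz b (dzb a (\<lambda>y. of_real (s y))) z * sesq (H z) c d)"
proof -
  interpret C: local_hermitian S "conformal s H" by (rule conformal_hermitian[OF s])
  let ?E = "\<lambda>y. complex_of_real (exp (s y))" and ?s = "\<lambda>y. complex_of_real (s y)"
  have sd: "s differentiable (at z)" by (rule smooth_on_differentiable[OF s z])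
  have sE: "smooth_on S ?E" by (rule smooth_exp[OF s])
  have ss: "smooth_on S ?s" by (rule smooth_on_of_real[OF S s])
  have Ed: "?E differentiable (at z)" by (rule smooth_on_differentiable[OF sE z])
  note E1 = dz_real_compose[OF sd DERIV_exp]
  note E2 = dz_dzb_real_compose[OF S z s DERIV_exp DERIV_exp]
  have h: "sesq (conformal s H y) u v = ?E y * h u v y" for y u v by (rule sesq_conformal)
  have d1: "dz p (\<lambda>y. sesq (conformal s H y) u v) z = ?E z * (dz p ?s z * h u v z + dz p (h u v) z)"
    and d1b: "dzb p (\<lambda>y. sesq (conformal s H y) u v) z = ?E z * (dzb p ?s z * h u v z + dzb p (h u v) z)" for p u v
    unfolding h dz_mult[OF Ed h_differentiable[OF z]] dzb_mult[OF Ed h_differentiable[OF z]] E1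
    by (simp_all add: algebra_simps)
  have d2: "dz b (dzb a (\<lambda>y. sesq (conformal s H y) c d)) z =
      ?E z * ((dz b ?s z * dzb a ?s z + dz b (dzb a ?s) z) * h c d z + dzb a ?s z * dz b (h c d) z
        + dz b ?s z * dzb a (h c d) z + dz b (dzb a (h c d)) z)"
    unfolding h dz_dzb_mult[OF S sE smooth_h z] E1 E2 by (simp add: algebra_simps)
  have w: "sesq (conformal s H z) (\<Gamma> b c z + dz b ?s z *s c) e = dz b (\<lambda>y. sesq (conformal s H y) c e) z" for e
    unfolding d1 unfolding sesq_conformal by (simp add: sesq_add_left sesq_smult_left \<Gamma>[OF z] algebra_simps)
  have "curvature4 (conformal s H) z b a c d = - dz b (dzb a (\<lambda>y. sesq (conformal s H y) c d)) z +
      dzb a (\<lambda>y. sesq (conformal s H y) (\<Gamma> b c z + dz b ?s z *s c) d) z"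
    by (rule curvature4_eq[OF S z C.sm C.pd[OF z] w])
  also have "dzb a (h (\<Gamma> b c z + dz b ?s z *s c) d) z = dzb a (h (\<Gamma> b c z) d) z + dz b ?s z * dzb a (h c d) z"
    unfolding dzb_h_\<Gamma>[OF z] by (simp add: sesq_add_left sesq_smult_left)
  then have "dzb a (\<lambda>y. sesq (conformal s H y) (\<Gamma> b c z + dz b ?s z *s c) d) z =
      ?E z * (dzb a ?s z * (dz b (h c d) z + dz b ?s z * h c d z) + sesq (H z) (\<Gamma> b c z) (\<Gamma> a d z) + dz b ?s z * dzb a (h c d) z)"
    unfolding d1b by (simp add: sesq_add_left sesq_smult_left \<Gamma>[OF z] dzb_h_\<Gamma>[OF z])
  finally show ?thesis unfolding d2 curvature4_\<Gamma>[OF z] by (simp add: algebra_simps)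
qed

end

context hermitian_manifold
begin

lemma smooth_pullback_real:
  assumes "smooth_function \<phi>" "c \<in> \<A>"
  shows "smooth_on (chart_image c) (\<lambda>z. k * \<phi> (chart_inv c z))"
proof -
  have "smooth_on (chart_image c) (\<lambda>z. Re (pullback c \<phi> z))"
    by (rule smooth_on_bounded_linear[OF bounded_linear_Re open_image[OF assms(2)] smooth_functionD[OF assms]])
  then show ?thesis unfolding pullback_def Re_complex_of_real
    by (intro smooth_on_mult smooth_on_const open_image assms)
qed

lemma conformal_metric:
  assumes \<phi>: "smooth_function \<phi>"
  shows "hermitian_manifold X \<A> (\<lambda>c. conformal (\<lambda>z. k * \<phi> (chart_inv c z)) (g c))"
proof (unfold_locales, unfold hermitian_metric_def, intro conjI ballI allI)
  fix c assume c: "c \<in> \<A>"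
  interpret C: local_hermitian "chart_image c" "conformal (\<lambda>z. k * \<phi> (chart_inv c z)) (g c)"
    by (rule local_hermitian.conformal_hermitian[OF local_hermitian[OF c] smooth_pullback_real[OF \<phi> c]])
  show "smooth_on (chart_image c) (\<lambda>z. conformal (\<lambda>z. k * \<phi> (chart_inv c z)) (g c) z $ \<alpha> $ \<beta>)" for \<alpha> \<beta>
    by (rule C.sm)
  show "hermitian_posdef (conformal (\<lambda>z. k * \<phi> (chart_inv c z)) (g c) z)" if "z \<in> chart_image c" for z
    by (rule C.pd[OF that])
  fix d z v w assume d: "d \<in> \<A>" and z: "z \<in> overlap c d"
  have "chart_inv d (transition c d z) = chart_inv c z"
    using overlap_chart_inv[OF c d z] chart_inv[OF d] by (simp add: transition_def chart_inv_def)
  then show "sesq (conformal (\<lambda>z. k * \<phi> (chart_inv c z)) (g c) z) v w =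
      sesq (conformal (\<lambda>z. k * \<phi> (chart_inv d z)) (g d) (transition c d z))
       (holomorphic_tangent_bundle c d z *v v) (holomorphic_tangent_bundle c d z *v w)"
    by (simp add: sesq_conformal transition_derivative[OF c d z] sesq_transition[OF c d z, symmetric])
qed

text \<open>The minus sign in the exponent makes the complex Hessian of \<open>\<phi>\<close> enter
  with a plus sign.\<close>

lemma Re_curvature4_conformal:
  assumes c: "c \<in> \<A>" and z: "z \<in> chart_image c" and \<phi>: "smooth_function \<phi>"
  shows "Re (curvature4 (conformal (\<lambda>z. - \<epsilon> * \<phi> (chart_inv c z)) (g c)) z u u v v) =
    exp (- \<epsilon> * \<phi> (chart_inv c z)) *
      (Re (curvature4 (g c) z u u v v) + \<epsilon> * Re (dz u (dzb u (pullback c \<phi>)) z) * Re (sesq (g c z) v v))"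
proof -
  interpret C: local_hermitian "chart_image c" "g c" by (rule local_hermitian[OF c])
  have "dz u (dzb u (\<lambda>y. complex_of_real (- \<epsilon> * \<phi> (chart_inv c y)))) z = dz u (dzb u (\<lambda>y. of_real (- \<epsilon>) * pullback c \<phi> y)) z"
    by (simp add: pullback_def)
  also have "\<dots> = of_real (- \<epsilon>) * dz u (dzb u (pullback c \<phi>)) z"
    by (subst dz_dzb_mult[OF C.S smooth_on_const smooth_functionD[OF \<phi> c] z]) (simp add: dzb_const[abs_def])
  finally have "curvature4 (conformal (\<lambda>z. - \<epsilon> * \<phi> (chart_inv c z)) (g c)) z u u v v =
      of_real (exp (- \<epsilon> * \<phi> (chart_inv c z))) *
      (curvature4 (g c) z u u v v + of_real \<epsilon> * dz u (dzb u (pullback c \<phi>)) z * of_real (Re (sesq (g c z) v v)))"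
    unfolding C.curvature4_conformal[OF smooth_pullback_real[OF \<phi> c] z] hermitian_posdef_real[OF C.pd[OF z], of v, symmetric]
    by (simp del: of_real_exp)
  then show ?thesis by simp
qed

end

text \<open>The existential is a union of open sets, so having a positive direction is an open
  condition even though the direction may vary discontinuously with the point.\<close>

lemma open_exists_positive:
  fixes F :: "'u \<Rightarrow> 't::topological_space \<Rightarrow> real"
  assumes "open A" "\<And>u. continuous_on A (F u)"
  shows "open {t \<in> A. \<exists>u. 0 < F u t}"
proof -
  have "open {t \<in> A. F u t \<in> {0<..}}" for u
    using continuous_open_preimage[OF assms(2,1), of "{0<..}" u] by (simp add: vimage_def Int_def)
  moreover have "{t \<in> A. \<exists>u. 0 < F u t} = (\<Union>u. {t \<in> A. F u t \<in> {0<..}})" by auto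
  ultimately show ?thesis by auto
qed

context local_kaehler
begin

text \<open>The condition is open in point and vector jointly; compactness of the unit sphere gives
  one radius for all unit vectors.\<close>

lemma RC_neighbourhood:
  assumes z0: "z0 \<in> S" and rc: "\<And>v. v \<noteq> 0 \<Longrightarrow> \<exists>u. 0 < Re (curvature4 H z0 u u v v)"
  obtains r where "0 < r" "cball z0 r \<subseteq> S" "\<And>z v. z \<in> cball z0 r \<Longrightarrow> norm v = 1 \<Longrightarrow> \<exists>u. 0 < Re (curvature4 H z u u v v)"
proof -
  let ?O = "{t \<in> S \<times> UNIV. \<exists>u. 0 < Re (curvature4 H (fst t) u u (snd t) (snd t))}"
  have O: "open ?O"
    by (rule open_exists_positive) (auto intro!: open_Times S continuous_intros)
  have "v \<noteq> 0" if "norm v = 1" for v :: "complex^2" using that by auto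
  then have "{z0} \<times> sphere 0 1 \<subseteq> ?O" using z0 rc by auto
  from compact_subset_open_imp_ball_epsilon_subset[OF compact_Times[OF compact_sing compact_sphere] O this]
  obtain e where e: "0 < e" "(\<Union>x\<in>{z0} \<times> sphere 0 1. ball x e) \<subseteq> ?O" by blast
  have in_O: "(z, v) \<in> ?O" if "dist z0 z < e" "norm v = 1" for z v
  proof -
    have "(z, v) \<in> ball (z0, v) e" using that by (simp add: dist_Pair_Pair)
    then show ?thesis using e(2) that(2) by force
  qed
  obtain v :: "complex^2" where v: "norm v = 1" using vector_choose_size[of 1] by auto
  show thesis
  proof (rule that[of "e / 2"])
    show "cball z0 (e / 2) \<subseteq> S" using in_O[OF _ v] e(1) by auto
    show "\<exists>u. 0 < Re (curvature4 H z u u v v)" if "z \<in> cball z0 (e / 2)" "norm v = 1" for z v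
      using in_O[of z v] that e(1) by auto
  qed (use e in simp)
qed

text \<open>The parameter \<open>\<epsilon>\<close> is treated as a further variable. The condition
  is open and holds on the compact set with \<open>\<epsilon> = 0\<close>, hence for one positive
  value uniformly in point and vector.\<close>

lemma RC_perturbation:
  assumes K: "compact K" "K \<subseteq> S" and f: "smooth_on S f"
    and rc: "\<And>z v. z \<in> K \<Longrightarrow> norm v = 1 \<Longrightarrow> \<exists>u. 0 < Re (curvature4 H z u u v v)"
  obtains \<epsilon> where "0 < \<epsilon>"
    "\<And>z v. z \<in> K \<Longrightarrow> norm v = 1 \<Longrightarrow> \<exists>u. 0 < Re (curvature4 H z u u v v) + \<epsilon> * Re (dz u (dzb u f) z) * Re (sesq (H z) v v)"
proof -
  define F where "F u t = Re (curvature4 H (fst (snd t)) u u (snd (snd t)) (snd (snd t))) +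
      fst t * Re (dz u (dzb u f) (fst (snd t))) * Re (sesq (H (fst (snd t))) (snd (snd t)) (snd (snd t)))" for u and t :: "real \<times> (complex^2) \<times> (complex^2)"
  let ?O = "{t \<in> UNIV \<times> S \<times> UNIV. \<exists>u. 0 < F u t}"
  have "continuous_on (UNIV \<times> S \<times> UNIV) (F u)" for u
  proof -
    have "continuous_on S (dz u (dzb u f))" by (intro smooth_on_continuous smooth_on_dz smooth_on_dzb S f)
    then have "continuous_on (UNIV \<times> S \<times> UNIV) (\<lambda>t::real \<times> (complex^2) \<times> (complex^2). dz u (dzb u f) (fst (snd t)))"
      by (rule continuous_on_compose2) (auto intro!: continuous_intros)
    then show ?thesis unfolding F_def by (intro continuous_intros) auto
  qed
  then have O: "open ?O" by (intro open_exists_positive open_Times open_UNIV S)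
  have "{0} \<times> K \<times> sphere 0 1 \<subseteq> ?O" using K rc by (auto simp: F_def)
  from compact_subset_open_imp_ball_epsilon_subset[OF compact_Times[OF compact_sing compact_Times[OF K(1) compact_sphere]] O this]
  obtain e where e: "0 < e" "(\<Union>x\<in>{0} \<times> K \<times> sphere 0 1. ball x e) \<subseteq> ?O" by blast
  show thesis
  proof (rule that[of "e / 2"])
    fix z and v :: "complex^2" assume zv: "z \<in> K" "norm v = 1"
    have "(e / 2, z, v) \<in> ball (0, z, v) e" using e(1) by (simp add: dist_Pair_Pair)
    then have "(e / 2, z, v) \<in> ?O" using e(2) zv by force
    then show "\<exists>u. 0 < Re (curvature4 H z u u v v) + e / 2 * Re (dz u (dzb u f) z) * Re (sesq (H z) v v)"
      by (simp add: F_def)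
  qed (use e in simp)
qed

lemma RC_of_subharmonic:
  assumes z: "z \<in> S" and ric: "\<And>b a. mixed_disc (H z) (curvature_mat H z b a) = 0"
    and f: "smooth_on S f" "0 < Re (mixed_disc (H z) (hess f z))" and "0 < \<epsilon>" "v \<noteq> 0"
  shows "\<exists>u. 0 < Re (curvature4 H z u u v v) + \<epsilon> * Re (dz u (dzb u f) z) * Re (sesq (H z) v v)"
proof -
  let ?k = "\<epsilon> * Re (sesq (H z) v v)"
  \<comment> \<open>Up to exchanging the two pairs of the curvature, this is the form in
    \<open>u\<close> whose positivity is claimed. Its trace is a positive multiple of the Laplacian
    of \<open>f\<close>, since the curvature part is trace-free.\<close>
  let ?P = "\<chi> \<alpha> \<beta>. of_real ?k * hess f z $ \<alpha> $ \<beta> + curvature_mat H z v v $ \<alpha> $ \<beta>"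
  have "0 < ?k" using hermitian_posdef_pos[OF pd[OF z] assms(6)] assms(5) by simp
  then have "0 < Re (mixed_disc (H z) ?P)"
    unfolding mixed_disc_linear_add ric using f(2) by (simp del: of_real_mult)
  then obtain u where u: "0 < Re (sesq ?P u u)" using mixed_disc_pos_imp[OF pd[OF z]] by blast
  have "sesq ?P u u = of_real ?k * sesq (hess f z) u u + sesq (curvature_mat H z v v) u u"
    by (simp add: sesq_2 algebra_simps del: of_real_mult)
  also have "\<dots> = of_real ?k * dz u (dzb u f) z + curvature4 H z v v u u"
    by (simp only: sesq_hess[OF S f(1) z] curvature_mat)
  also have "curvature4 H z v v u u = curvature4 H z u u v v" by (metis curvature4_sym[OF z] curvature4_sym'[OF z])
  finally show ?thesis using u by (intro exI[of _ u]) (simp add: algebra_simps)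
qed

end

theorem theorem1p1:
  fixes X :: "'a topology" and \<A> :: "('a, 2) chart set"
  assumes "complex_manifold X \<A>" and "compact_space X" and "connected_space X"
    and "\<exists>g. kaehler_metric \<A> g \<and> ricci_flat \<A> g \<and> \<not> flat \<A> g"
  shows "\<exists>h. hermitian_metric \<A> holomorphic_tangent_bundle h \<and> RC_positive X \<A> h"
proof -
  obtain g where g: "kaehler_metric \<A> g" "ricci_flat \<A> g" "\<not> flat \<A> g" using assms(4) by blast
  interpret ricci_flat_manifold X \<A> g
    by unfold_locales (use assms g in \<open>auto simp: kaehler_metric_def\<close>)
  obtain c0 z0 where c0: "c0 \<in> \<A>" and z0: "z0 \<in> chart_image c0"
    and rc0: "\<And>v. v \<noteq> 0 \<Longrightarrow> \<exists>u. 0 < Re (curvature4 (g c0) z0 u u v v)" using ex_RC_point by metis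
  obtain r where r: "0 < r" "cball z0 r \<subseteq> chart_image c0"
    "\<And>z v. z \<in> cball z0 r \<Longrightarrow> norm v = 1 \<Longrightarrow> \<exists>u. 0 < Re (curvature4 (g c0) z u u v v)"
    using local_kaehler.RC_neighbourhood[OF local_kaehler[OF c0] z0 rc0] by metis
  define V where "V = {x \<in> fst c0. snd c0 x \<in> ball z0 r}"
  have V: "openin X V" unfolding V_def by (rule openin_chart_preimage[OF c0]) simp
  have "chart_inv c0 z0 \<in> V" using c0 z0 r(1) by (simp add: V_def)
  then have "V \<noteq> {}" by blast
  then obtain \<phi> where \<phi>: "smooth_function \<phi>" "\<And>x. x \<in> topspace X - V \<Longrightarrow> 0 < L \<phi> x"
    using ex_subharmonic[OF V _ assms(2,3)] by blast
  \<comment> \<open>The closed ball alone determines how small \<open>\<epsilon>\<close> has to be;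
    outside \<open>V\<close> every positive value works.\<close>
  obtain \<epsilon> where \<epsilon>: "0 < \<epsilon>" "\<And>z v. z \<in> cball z0 r \<Longrightarrow> norm v = 1 \<Longrightarrow>
      \<exists>u. 0 < Re (curvature4 (g c0) z u u v v) + \<epsilon> * Re (dz u (dzb u (pullback c0 \<phi>)) z) * Re (sesq (g c0 z) v v)"
    using local_kaehler.RC_perturbation[OF local_kaehler[OF c0] compact_cball r(2) smooth_functionD[OF \<phi>(1) c0] r(3)] by metis
  define h where "h = (\<lambda>c. conformal (\<lambda>z. - \<epsilon> * \<phi> (chart_inv c z)) (g c))"
  interpret h: hermitian_manifold X \<A> h unfolding h_def by (rule conformal_metric[OF \<phi>(1)])
  have "RC_positive_at \<A> h x" if x: "x \<in> topspace X" for x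
  proof (cases "x \<in> V")
    case True
    then have xc: "x \<in> fst c0" "snd c0 x \<in> cball z0 r" by (auto simp: V_def)
    show ?thesis
    proof (rule h.RC_positive_at_chart[OF c0 xc(1)])
      fix v :: "complex^2" assume v: "v \<noteq> 0"
      define w where "w = complex_of_real (1 / norm v) *s v"
      have vw: "v = complex_of_real (norm v) *s w" using v by (simp add: w_def vec_eq_iff)
      have "norm w = 1" using v by (simp add: w_def norm_smult_complex norm_divide)
      then obtain u where "0 < Re (curvature4 (g c0) (snd c0 x) u u w w) +
          \<epsilon> * Re (dz u (dzb u (pullback c0 \<phi>)) (snd c0 x)) * Re (sesq (g c0 (snd c0 x)) w w)"
        using \<epsilon>(2)[OF xc(2)] by blast
      then have "0 < Re (curvature4 (h c0) (snd c0 x) u u w w)"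
        unfolding h_def Re_curvature4_conformal[OF c0 chart_in[OF c0 xc(1)] \<phi>(1)] by simp
      moreover have "curvature4 (h c0) (snd c0 x) u u v v = of_real ((norm v)\<^sup>2) * curvature4 (h c0) (snd c0 x) u u w w"
        by (subst (1 2) vw) (simp add: curvature4_smult power2_eq_square)
      ultimately show "\<exists>u. 0 < Re (curvature4 (h c0) (snd c0 x) u u v v)"
        using v by (intro exI[of _ u]) (simp flip: of_real_power)
    qed
  next
    case False
    obtain c where c: "c \<in> \<A>" "x \<in> fst c" using ex_chart[OF x] by blast
    have z: "snd c x \<in> chart_image c" by (rule chart_in[OF c])
    have "0 < lap c \<phi> (snd c x)" using L_pos_iff(1)[OF c \<phi>(1)] \<phi>(2) x False by blast
    show ?thesis
    proof (rule h.RC_positive_at_chart[OF c])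
      fix v :: "complex^2" assume "v \<noteq> 0"
      then obtain u where "0 < Re (curvature4 (g c) (snd c x) u u v v) +
          \<epsilon> * Re (dz u (dzb u (pullback c \<phi>)) (snd c x)) * Re (sesq (g c (snd c x)) v v)"
        using local_kaehler.RC_of_subharmonic[OF local_kaehler[OF c(1)] z mixed_disc_zero[OF c(1) z]
          smooth_functionD[OF \<phi>(1) c(1)] _ \<epsilon>(1)] \<open>0 < lap c \<phi> (snd c x)\<close> unfolding lap_def by blast
      then show "\<exists>u. 0 < Re (curvature4 (h c) (snd c x) u u v v)"
        unfolding h_def Re_curvature4_conformal[OF c(1) z \<phi>(1)] by (intro exI[of _ u] mult_pos_pos) simp_all
    qed
  qed
  then show ?thesis using h.metric unfolding RC_positive_def by blast
qed

end
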